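(* Let $n\ge3$, let $\mathcal{H}$ be a Hilbert space, and let $T=(T_1,\ldots,T_n)\in\mathcal{T}^n_{1,2}(\mathcal{H})$ be of finite rank. Then there exists an algebraic variety $V$ in $\overline{\mathbb{D}}^n$ such that for all $f\in\mathbb{C}[z_1,\dots,z_n]$, \[ \|f(T)\|\le\sup_{\boldsymbol{z}\in V}|f(\boldsymbol{z})|. \] If, in addition, $T_1$ is a pure contraction, then there exists a distinguished variety $V'$ in $\mathbb{D}^2$ such that this inequality holds, for all $f\in\mathbb{C}[z_1,\dots,z_n]$, with \[ V=V'\times\mathbb{D}^{n-2}\subseteq\mathbb{D}^n. \]
   Context: $\mathcal{T}^m(\mathcal{H})$ is the set of $m$-tuples $(T_1,\ldots,T_m)$ of pairwise commuting contractions ($\|T_i\|\le1$) on $\mathcal{H}$. For $T\in\mathcal{T}^m(\mathcal{H})$ and $\boldsymbol{k}\in\mathbb{Z}_+^m$ write $T^{\boldsymbol{k}}=T_1^{k_1}\cdots T_m^{k_m}$, $T^{*\boldsymbol{k}}=T_1^{*k_1}\cdots T_m^{*k_m}$, $|\boldsymbol{k}|=\sum_i k_i$, and \[ \mathbb{S}_m^{-1}(T,T^* )=\sum_{\boldsymbol{k}\in\{0,1\}^m}(-1)^{|\boldsymbol{k}|}T^{\boldsymbol{k}}T^{*\boldsymbol{k}}. \] Let $\mathbb{S}_m(\mathcal{H})=\{T\in\mathcal{T}^m(\mathcal{H}):\mathbb{S}_m^{-1}(T,T^* )\ge0\}$; for $T\in\mathbb{S}_m(\mathcal{H})$ let $\mathcal{D}_T=\overline{\mathrm{ran}}\,\mathbb{S}_m^{-1}(T,T^*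 )$. A contraction $S$ is pure if $\|S^{*r}h\|\to0$ as $r\to\infty$ for all $h\in\mathcal{H}$; a tuple in $\mathcal{T}^m(\mathcal{H})$ is pure if each of its entries is pure. For $T\in\mathcal{T}^n(\mathcal{H})$, $\hat{T}_i\in\mathcal{T}^{n-1}(\mathcal{H})$ denotes the $(n-1)$-tuple obtained from $T$ by removing $T_i$. For $n\ge3$ and $1\le p<q\le n$, \[ \mathcal{T}^n_{p,q}(\mathcal{H})=\{T\in\mathcal{T}^n(\mathcal{H}):\hat{T}_p,\hat{T}_q\in\mathbb{S}_{n-1}(\mathcal{H})\text{ and }\hat{T}_p\text{ is pure}\}. \] $T\in\mathcal{T}^n_{p,q}(\mathcal{H})$ is of finite rank if $\dim\mathcal{D}_{\hat{T}_i}<\infty$ for $i=p,q$ (here $p=1$, $q=2$). An algebraic variety in $\overline{\mathbb{D}}^n$ means the part lying in $\overline{\mathbb{D}}^n$ of the common zero set of a set of polynomials in $\mathbb{C}[z_1,\ldots,z_n]$. A non-empty set $V'\subseteq\mathbb{C}^2$ is a distinguished variety in $\mathbb{D}^2$ if there is a polynomial $g\in\mathbb{C}[z_1,z_2]$ with $V'=\{(z_1,z_2)\in\mathbb{D}^2:g(z_1,z_2)=0\}$ and \[ \overline{V'}\cap\partial\mathbb{D}^2=\overline{V'}\cap(\partial\mathbb{D}\times\partial\mathbb{D}), \] where $\partial\mathbb{D}^2$ is the topological boundary of the bidisc and $\overline{V'}$ is the closure of $V'$ in $\overline{\mathbb{D}^2}$. *)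

theory Defs
  imports "HOL-Analysis.Analysis" "HOL-Library.Poly_Mapping"
begin

section \<open>Complex Hilbert spaces and their operators\<close>

text \<open>The inner product is linear in the first argument. Positivity and definiteness follow
  from the last axiom, and \<open>scaleC 1 x = x\<close> from the axiom \<open>scaleC_of_real\<close>.\<close>

class chilbert_space = banach +
  fixes scaleC :: "complex \<Rightarrow> 'a \<Rightarrow> 'a"
    and cinner :: "'a \<Rightarrow> 'a \<Rightarrow> complex"
  assumes scaleC_add_right: "scaleC c (x + y) = scaleC c x + scaleC c y"
    and scaleC_add_left: "scaleC (c + d) x = scaleC c x + scaleC d x"
    and scaleC_scaleC: "scaleC c (scaleC d x) = scaleC (c * d) x"
    and scaleC_of_real: "scaleC (of_real r) x = r *\<^sub>R x"
    and cinner_commute: "cinner x y = cnj (cinner y x)"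
    and cinner_add_left: "cinner (x + y) z = cinner x z + cinner y z"
    and cinner_scaleC_left: "cinner (scaleC c x) y = c * cinner x y"
    and cinner_self: "cinner x x = of_real ((norm x)\<^sup>2)"

lemma vector_space_scaleC: "vector_space (scaleC :: complex \<Rightarrow> 'a \<Rightarrow> 'a::chilbert_space)"
proof
  show "scaleC 1 x = x" for x :: 'a
    using scaleC_of_real[of 1 x] by simp
qed (simp_all add: scaleC_add_right scaleC_add_left scaleC_scaleC)

interpretation chilbert: vector_space "scaleC :: complex \<Rightarrow> 'a \<Rightarrow> 'a::chilbert_space"
  by (rule vector_space_scaleC)

definition bounded_clinear :: "('h::chilbert_space \<Rightarrow> 'h) \<Rightarrow> bool" where
  "bounded_clinear A \<longleftrightarrow> bounded_linear A \<and> (\<forall>c x. A (scaleC c x) = scaleC c (A x))"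

text \<open>The adjoint exists and is unique for every bounded complex-linear operator.\<close>

definition cadjoint :: "('h::chilbert_space \<Rightarrow> 'h) \<Rightarrow> 'h \<Rightarrow> 'h" where
  "cadjoint A = (THE B. \<forall>x y. cinner (A x) y = cinner x (B y))"

definition positive_op :: "('h::chilbert_space \<Rightarrow> 'h) \<Rightarrow> bool" where
  "positive_op A \<longleftrightarrow> (\<forall>h. cinner (A h) h \<in> \<real>\<^sub>\<ge>\<^sub>0)"

definition contraction :: "('h::chilbert_space \<Rightarrow> 'h) \<Rightarrow> bool" where
  "contraction A \<longleftrightarrow> bounded_clinear A \<and> onorm A \<le> 1"

definition pure_contraction :: "('h::chilbert_space \<Rightarrow> 'h) \<Rightarrow> bool" where
  "pure_contraction S \<longleftrightarrow> contraction S \<and> (\<forall>h. (\<lambda>r. norm ((cadjoint S ^^ r) h)) \<longlonglongrightarrow> 0)"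

definition finite_cdim :: "'h::chilbert_space set \<Rightarrow> bool" where
  "finite_cdim S \<longleftrightarrow> (\<exists>B. finite B \<and> S \<subseteq> chilbert.span B)"


section \<open>Tuples of operators\<close>

text \<open>An \<open>m\<close>-tuple is a function on \<^typ>\<open>nat\<close> of which only the entries with index in
  \<open>{1..m}\<close> are used.\<close>

definition contraction_tuples :: "nat \<Rightarrow> (nat \<Rightarrow> 'h::chilbert_space \<Rightarrow> 'h) set" where
  "contraction_tuples m = {T. (\<forall>i\<in>{1..m}. contraction (T i)) \<and>
     (\<forall>i\<in>{1..m}. \<forall>j\<in>{1..m}. T i \<circ> T j = T j \<circ> T i)}"

primrec tuple_power :: "nat \<Rightarrow> (nat \<Rightarrow> 'h \<Rightarrow> 'h) \<Rightarrow> (nat \<Rightarrow> nat) \<Rightarrow> 'h \<Rightarrow> 'h" where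
  "tuple_power 0 T k = id"
| "tuple_power (Suc m) T k = tuple_power m T k \<circ> (T (Suc m) ^^ k (Suc m))"

definition szego_inverse :: "nat \<Rightarrow> (nat \<Rightarrow> 'h::chilbert_space \<Rightarrow> 'h) \<Rightarrow> 'h \<Rightarrow> 'h" where
  "szego_inverse m T h = (\<Sum>k\<in>{1..m} \<rightarrow>\<^sub>E {0, 1}. (-1) ^ (\<Sum>i=1..m. k i) *\<^sub>R
     tuple_power m T k (tuple_power m (\<lambda>i. cadjoint (T i)) k h))"

definition szego_tuples :: "nat \<Rightarrow> (nat \<Rightarrow> 'h::chilbert_space \<Rightarrow> 'h) set" where
  "szego_tuples m = {T \<in> contraction_tuples m. positive_op (szego_inverse m T)}"

definition defect_space :: "nat \<Rightarrow> (nat \<Rightarrow> 'h::chilbert_space \<Rightarrow> 'h) \<Rightarrow> 'h set" where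
  "defect_space m T = closure (range (szego_inverse m T))"

definition pure_tuple :: "nat \<Rightarrow> (nat \<Rightarrow> 'h::chilbert_space \<Rightarrow> 'h) \<Rightarrow> bool" where
  "pure_tuple m T \<longleftrightarrow> (\<forall>i\<in>{1..m}. pure_contraction (T i))"

definition remove_entry :: "nat \<Rightarrow> (nat \<Rightarrow> 'b) \<Rightarrow> nat \<Rightarrow> 'b" where
  "remove_entry i T = (\<lambda>j. if j < i then T j else T (Suc j))"

definition pq_tuples :: "nat \<Rightarrow> nat \<Rightarrow> nat \<Rightarrow> (nat \<Rightarrow> 'h::chilbert_space \<Rightarrow> 'h) set" where
  "pq_tuples n p q = {T \<in> contraction_tuples n.
     remove_entry p T \<in> szego_tuples (n - 1) \<and> remove_entry q T \<in> szego_tuples (n - 1) \<and>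
     pure_tuple (n - 1) (remove_entry p T)}"

definition finite_rank :: "nat \<Rightarrow> nat \<Rightarrow> nat \<Rightarrow> (nat \<Rightarrow> 'h::chilbert_space \<Rightarrow> 'h) \<Rightarrow> bool" where
  "finite_rank n p q T \<longleftrightarrow>
     (\<forall>i\<in>{p, q}. finite_cdim (defect_space (n - 1) (remove_entry i T)))"


section \<open>Polynomials in several variables\<close>

text \<open>A polynomial is a finitely supported map from exponents to coefficients; an exponent is a
  finitely supported map from variable indices to powers. The variables of
  $\mathbb{C}[z_1, \ldots, z_n]$ are those with index in \<open>{1..n}\<close>.\<close>

type_synonym cmpoly = "(nat \<Rightarrow>\<^sub>0 nat) \<Rightarrow>\<^sub>0 complex"

definition polys :: "nat \<Rightarrow> cmpoly set" where
  "polys n = {f. \<forall>k\<in>Poly_Mapping.keys f. Poly_Mapping.keys k \<subseteq> {1..n}}"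

definition eval_point :: "nat \<Rightarrow> cmpoly \<Rightarrow> (nat \<Rightarrow> complex) \<Rightarrow> complex" where
  "eval_point n f z = (\<Sum>k\<in>Poly_Mapping.keys f.
     Poly_Mapping.lookup f k * (\<Prod>i=1..n. z i ^ Poly_Mapping.lookup k i))"

definition eval_tuple :: "nat \<Rightarrow> cmpoly \<Rightarrow> (nat \<Rightarrow> 'h::chilbert_space \<Rightarrow> 'h) \<Rightarrow> 'h \<Rightarrow> 'h" where
  "eval_tuple n f T h = (\<Sum>k\<in>Poly_Mapping.keys f.
     scaleC (Poly_Mapping.lookup f k) (tuple_power n T (Poly_Mapping.lookup k) h))"


section \<open>Varieties\<close>

text \<open>Points of $\mathbb{C}^n$ are functions that are \<open>undefined\<close> outside \<open>{1..n}\<close>; points of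
  $\mathbb{C}^2$ in a distinguished variety are pairs, for which the product topology
  is available.\<close>

definition algebraic_variety :: "nat \<Rightarrow> (nat \<Rightarrow> complex) set \<Rightarrow> bool" where
  "algebraic_variety n V \<longleftrightarrow> (\<exists>F \<subseteq> polys n.
     V = {z \<in> {1..n} \<rightarrow>\<^sub>E cball 0 1. \<forall>f\<in>F. eval_point n f z = 0})"

definition distinguished_variety :: "(complex \<times> complex) set \<Rightarrow> bool" where
  "distinguished_variety W \<longleftrightarrow> W \<noteq> {} \<and>
     (\<exists>g\<in>polys 2. W = {(z1, z2) \<in> ball 0 1 \<times> ball 0 1.
        eval_point 2 g (\<lambda>i. if i = 1 then z1 else z2) = 0}) \<and>
     closure W \<inter> frontier (ball 0 1 \<times> ball 0 1) = closure W \<inter> (sphere 0 1 \<times> sphere 0 1)"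

text \<open>The set $W \times \mathbb{D}^{n-2}$ for $W \subseteq \mathbb{D}^2$ and $n \ge 2$.\<close>

definition times_polydisc :: "nat \<Rightarrow> (complex \<times> complex) set \<Rightarrow> (nat \<Rightarrow> complex) set" where
  "times_polydisc n W = {z \<in> {1..n} \<rightarrow>\<^sub>E ball 0 1. (z 1, z 2) \<in> W}"

end

theory Submission
  imports Defs "HOL-Library.Function_Algebras" "HOL-Computational_Algebra.Fundamental_Theorem_Algebra"
    "HOL-Complex_Analysis.Great_Picard" "Jordan_Normal_Form.Determinant"
begin

text \<open>Write \<open>A i\<close> for the adjoint of \<open>T i\<close>. For a set \<open>S\<close> of indices let \<open>q\<close> be the alternating sum of
  \<open>(norm (A R h))\<^sup>2\<close> over the subsets \<open>R\<close> of \<open>S\<close>, where \<open>A R\<close> is the product of the \<open>A i\<close> with \<open>i \<in> R\<close>. These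
  forms satisfy a difference equation: adding \<open>i\<close> to \<open>S\<close> replaces \<open>q h\<close> by \<open>q h - q (A i h)\<close>. The
  hypotheses say that the forms of \<open>{2..n}\<close> and of \<open>{1, 3..n}\<close> are positive of finite rank; purity and
  the difference equation then make all forms of subsets of \<open>{2..n}\<close> positive.

  The variables from the third on are removed one at a time (\<open>defect_step\<close>). If the orbit of \<open>h\<close> under
  \<open>A i\<close> tends to \<open>0\<close>, then \<open>q h\<close> is the sum of the defects \<open>q x - q (A i x)\<close> over that orbit, on which
  \<open>A i\<close> is a shift. A discrete Fourier transform diagonalizes the shift, so that a bound for the
  defect form with \<open>A i\<close> replaced by every unimodular scalar gives the bound for \<open>q\<close> with \<open>A i\<close>.
  This plays the role of a dilation to a Hardy space, but needs only finite sums.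

  What remains is the form \<open>b\<close> of \<open>{3..n}\<close> with the pair \<open>A 1\<close>, \<open>A 2\<close>. Let \<open>b1\<close> and \<open>b2\<close> be its defects
  under \<open>A 2\<close> and \<open>A 1\<close>. Computing the defect under the product of both operators in two ways gives
  \<open>b1 x x + b2 (A 2 x) (A 2 x) = b1 (A 1 x) (A 1 x) + b2 x x\<close>. Both forms have finite rank, hence
  an isometric square matrix \<open>U\<close> maps the coordinates of \<open>(x, A 2 x)\<close> to those of \<open>(A 1 x, x)\<close>
  (\<open>isometry_extension\<close>, \<open>realization_exists\<close>). For a unimodular frequency \<open>\<zeta>\<close> of the shift \<open>A 2\<close> the
  operator \<open>A 1\<close> becomes the transfer function of \<open>U\<close> at \<open>\<zeta>\<close>, a unitary matrix whose eigenvalues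
  \<open>\<kappa>\<close> are the solutions of \<open>det (U diag(1, \<zeta>) - diag(\<kappa>, 1)) = 0\<close>. The spectral theorem bounds a
  polynomial by its values on this curve (\<open>solutions_functional_calculus_bound\<close>). The transfer function
  has poles outside the closed disc, so the Fourier transform of a truncated orbit is no longer exact;
  conservation of energy controls the error (\<open>approximation\<close>, \<open>pair_bound\<close>).

  The curve is algebraic because the determinant is a polynomial. Purity of \<open>T 2\<close>, and of \<open>T 1\<close> for the
  second claim, removes the unimodular eigenvalues of the diagonal blocks of \<open>U\<close>; with the energy
  identity \<open>curve_energy\<close> this keeps the curve away from the part of the boundary of the bidisc that is
  outside the torus. By Hurwitz's theorem its points on the torus are limits of points in the open
  bidisc (\<open>curve_torus_in_closure\<close>), so the curve inside the bidisc is a distinguished variety with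
  the same suprema.\<close>


section \<open>Positive semidefinite forms\<close>

text \<open>The scalar multiplication is a parameter because the forms live both on the Hilbert space, as defects
  of the tuple, and on coordinate vectors, as products over a range of indices. Defects usually
  have a kernel, so definiteness would be too much to ask for.\<close>

locale psd_form = vector_space sc
  for sc :: "complex \<Rightarrow> 'v::ab_group_add \<Rightarrow> 'v" +
  fixes b :: "'v \<Rightarrow> 'v \<Rightarrow> complex"
  assumes add_left: "b (x + y) z = b x z + b y z"
    and sc_left: "b (sc c x) z = c * b x z"
    and commute: "b x y = cnj (b y x)"
    and nonneg: "0 \<le> Re (b x x)"
begin

definition sq :: "'v \<Rightarrow> real" where "sq x = Re (b x x)"

lemma self: "b x x = of_real (sq x)"
  using commute[of x x] by (auto simp: sq_def complex_eq_iff)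

lemma sq_nonneg [simp]: "0 \<le> sq x"
  using nonneg by (simp add: sq_def)

lemma add_right: "b z (x + y) = b z x + b z y"
  using commute[of z "x + y"] commute[of z x] commute[of z y] by (simp add: add_left)

lemma sc_right: "b z (sc c x) = cnj c * b z x"
  using commute[of z "sc c x"] commute[of z x] by (simp add: sc_left)

lemma zero_left [simp]: "b 0 z = 0"
  using add_left[of 0 0 z] by simp

lemma zero_right [simp]: "b z 0 = 0"
  using add_right[of z 0 0] by simp

lemma minus_left: "b (- x) z = - b x z"
  using add_left[of "- x" x z] by (simp add: eq_neg_iff_add_eq_0)

lemma minus_right: "b z (- x) = - b z x"
  using add_right[of z "- x" x] by (simp add: eq_neg_iff_add_eq_0)

lemma diff_left: "b (x - y) z = b x z - b y z"
  using add_left[of x "- y" z] by (simp add: minus_left)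

lemma diff_right: "b z (x - y) = b z x - b z y"
  using add_right[of z x "- y"] by (simp add: minus_right)

lemma sum_left: "b (\<Sum>i\<in>I. f i) z = (\<Sum>i\<in>I. b (f i) z)"
  by (induction I rule: infinite_finite_induct) (auto simp: add_left)

lemma sum_right: "b z (\<Sum>i\<in>I. f i) = (\<Sum>i\<in>I. b z (f i))"
  by (induction I rule: infinite_finite_induct) (auto simp: add_right)

lemmas linear_simps = add_left add_right sc_left sc_right minus_left minus_right
  diff_left diff_right sum_left sum_right

lemma sq_zero [simp]: "sq 0 = 0"
  by (simp add: sq_def)

lemma sq_sc: "sq (sc c x) = (norm c)\<^sup>2 * sq x"
proof -
  have "b (sc c x) (sc c x) = (c * cnj c) * b x x"
    by (simp add: sc_left sc_right)
  then have "complex_of_real (sq (sc c x)) = of_real ((norm c)\<^sup>2 * sq x)"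
    by (simp only: self of_real_mult complex_norm_square)
  then show ?thesis
    using of_real_eq_iff by blast
qed

lemma b_null:
  assumes "sq x = 0" shows "b x y = 0"
proof (rule ccontr)
  assume ne: "b x y \<noteq> 0"
  define c where "c = b x y"
  have pos: "(norm c)\<^sup>2 > 0" using ne by (simp add: c_def)
  have key: "0 \<le> sq y - 2 * t * (norm c)\<^sup>2" for t :: real
  proof -
    let ?w = "y - sc (of_real t * cnj c) x"
    have xx: "b x x = 0" using self[of x] assms by simp
    have yx: "b y x = cnj c" using commute[of y x] by (simp add: c_def)
    have "b ?w ?w = b y y - (of_real t * c) * b y x - (of_real t * cnj c) * b x y"
      by (simp add: linear_simps xx algebra_simps)
    also have "\<dots> = b y y - of_real (2 * t) * (c * cnj c)"
      by (simp add: yx c_def[symmetric] algebra_simps)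
    also have "\<dots> = of_real (sq y - 2 * t * (norm c)\<^sup>2)"
      by (simp only: self of_real_mult of_real_diff complex_norm_square)
    finally have "sq ?w = sq y - 2 * t * (norm c)\<^sup>2"
      by (simp add: sq_def)
    then show ?thesis using sq_nonneg[of ?w] by simp
  qed
  \<comment> \<open>For this value of \<open>t\<close> the square of \<open>?w\<close> would be \<open>- sq y - 2\<close>.\<close>
  have "0 \<le> sq y - 2 * ((sq y + 1) / (norm c)\<^sup>2) * (norm c)\<^sup>2" by (rule key)
  also have "\<dots> = - sq y - 2" using pos by (simp add: field_simps)
  finally show False using sq_nonneg[of y] by linarith
qed

definition orthonormal :: "nat \<Rightarrow> (nat \<Rightarrow> 'v) \<Rightarrow> bool" where
  "orthonormal d e \<longleftrightarrow> (\<forall>i<d. \<forall>j<d. b (e i) (e j) = (if i = j then 1 else 0))"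

lemma orthonormalD: "orthonormal d e \<Longrightarrow> i < d \<Longrightarrow> j < d \<Longrightarrow> b (e i) (e j) = (if i = j then 1 else 0)"
  by (simp add: orthonormal_def)

definition residual :: "nat \<Rightarrow> (nat \<Rightarrow> 'v) \<Rightarrow> 'v \<Rightarrow> 'v" where
  "residual d e x = x - (\<Sum>k<d. sc (b x (e k)) (e k))"

lemma residual_orthogonal:
  assumes "orthonormal d e" "j < d"
  shows "b (residual d e x) (e j) = 0"
proof -
  have "(\<Sum>k<d. b x (e k) * b (e k) (e j)) = (\<Sum>k<d. if k = j then b x (e j) else 0)"
    by (rule sum.cong) (use assms in \<open>auto simp: orthonormalD\<close>)
  then show ?thesis
    using assms by (simp add: residual_def linear_simps sum.delta)
qed

lemma residual_product:
  assumes "orthonormal d e"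
  shows "b (residual d e x) y = b x y - (\<Sum>k<d. b x (e k) * b (e k) y)"
  by (simp add: residual_def linear_simps)

lemma sq_residual:
  assumes "orthonormal d e"
  shows "sq (residual d e x) = sq x - (\<Sum>k<d. (norm (b x (e k)))\<^sup>2)"
proof -
  let ?r = "residual d e x"
  have "b ?r ?r = b ?r x - (\<Sum>k<d. cnj (b x (e k)) * b ?r (e k))"
    by (subst (2) residual_def) (simp add: linear_simps)
  also have "(\<Sum>k<d. cnj (b x (e k)) * b ?r (e k)) = 0"
    by (rule sum.neutral) (simp add: residual_orthogonal[OF assms])
  also have "b ?r x = b x x - (\<Sum>k<d. b x (e k) * b (e k) x)"
    by (rule residual_product[OF assms])
  also have "(\<Sum>k<d. b x (e k) * b (e k) x) = (\<Sum>k<d. of_real ((norm (b x (e k)))\<^sup>2))"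
  proof (rule sum.cong[OF refl])
    fix k
    show "b x (e k) * b (e k) x = of_real ((norm (b x (e k)))\<^sup>2)"
      using commute[of "e k" x] by (simp add: complex_norm_square del: of_real_power)
  qed
  finally have "complex_of_real (sq ?r) = of_real (sq x - (\<Sum>k<d. (norm (b x (e k)))\<^sup>2))"
    by (simp add: self)
  then show ?thesis using of_real_eq_iff by blast
qed

lemma bessel:
  assumes "orthonormal d e"
  shows "(\<Sum>k<d. (norm (b x (e k)))\<^sup>2) \<le> sq x"
  using sq_residual[OF assms, of x] sq_nonneg[of "residual d e x"] by linarith

lemma orthonormal_extend:
  assumes "orthonormal d e" and "sq (residual d e x) \<noteq> 0"
  shows "\<exists>u. orthonormal (Suc d) (e(d := u))"
proof -
  let ?r = "residual d e x"
  define u where "u = sc (of_real (1 / sqrt (sq ?r))) ?r"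
  have pos: "sq ?r > 0" using assms(2) sq_nonneg[of ?r] by linarith
  have "b u u = of_real (sq u)" by (rule self)
  also have "sq u = 1"
    using pos by (simp add: u_def sq_sc power_divide norm_divide)
  finally have uu: "b u u = 1" by simp
  have ue: "b u (e j) = 0" if "j < d" for j
    using residual_orthogonal[OF assms(1) that] by (simp add: u_def sc_left)
  have eu: "b (e j) u = 0" if "j < d" for j
    using ue[OF that] commute[of "e j" u] by simp
  have "orthonormal (Suc d) (e(d := u))"
    using assms(1) uu ue eu by (auto simp: orthonormal_def less_Suc_eq)
  then show ?thesis by blast
qed

text \<open>A bound on the sizes gives a maximal orthonormal family, whose residuals have square zero and are
  therefore invisible to the form. The resulting coordinates \<open>b x (f k)\<close> take the place of the square
  root of a positive operator of finite rank.\<close>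

lemma orthonormal_basis_extension:
  assumes "orthonormal m e"
    and bound: "\<And>d f. orthonormal d f \<Longrightarrow> d \<le> R"
  obtains d f where "m \<le> d" "orthonormal d f" "\<And>k. k < m \<Longrightarrow> f k = e k"
    "\<And>x y. b x y = (\<Sum>k<d. b x (f k) * b (f k) y)"
proof -
  let ?P = "\<lambda>d. \<exists>f. m \<le> d \<and> orthonormal d f \<and> (\<forall>k<m. f k = e k)"
  define d where "d = (GREATEST d. ?P d)"
  have ex: "?P m" using assms(1) by blast
  have le: "d' \<le> R" if "?P d'" for d' using that bound by blast
  have "?P d" unfolding d_def by (rule GreatestI_nat[of ?P, OF ex]) (use le in blast)
  then obtain f where f: "m \<le> d" "orthonormal d f" "\<forall>k<m. f k = e k" by blast
  have max: "\<not> ?P (Suc d)"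
  proof
    assume "?P (Suc d)"
    then have "Suc d \<le> d" unfolding d_def by (rule Greatest_le_nat[of ?P]) (use le in blast)
    then show False by simp
  qed
  have "sq (residual d f x) = 0" for x
  proof (rule ccontr)
    assume "sq (residual d f x) \<noteq> 0"
    then obtain u where "orthonormal (Suc d) (f(d := u))"
      using orthonormal_extend f(2) by blast
    then have "?P (Suc d)"
      using f by (intro exI[of _ "f(d := u)"]) auto
    then show False using max by blast
  qed
  then have "b x y = (\<Sum>k<d. b x (f k) * b (f k) y)" for x y
    using residual_product[OF f(2), of x y] b_null[of "residual d f x" y] by simp
  then show thesis using that f by blast
qed

lemma cauchy_schwarz: "(norm (b x y))\<^sup>2 \<le> sq x * sq y"
proof (cases "sq y = 0")
  case True
  then have "b y x = 0" by (rule b_null)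
  then show ?thesis using commute[of x y] True by simp
next
  case False
  then have pos: "sq y > 0" using sq_nonneg[of y] by linarith
  define e where "e = sc (of_real (1 / sqrt (sq y))) y"
  have "b e e = of_real (sq e)" by (rule self)
  also have "sq e = 1" using pos by (simp add: e_def sq_sc power_divide norm_divide)
  finally have "orthonormal 1 (\<lambda>_. e)" by (simp add: orthonormal_def)
  from bessel[OF this, of x] have "(norm (b x e))\<^sup>2 \<le> sq x" by simp
  moreover have "(norm (b x e))\<^sup>2 = (norm (b x y))\<^sup>2 / sq y"
    using pos by (simp add: e_def sc_right norm_mult norm_divide power_divide)
  ultimately show ?thesis using pos by (simp add: field_simps)
qed

lemma sq_expansion:
  assumes "\<And>x y. b x y = (\<Sum>k<d. b x (f k) * b (f k) y)"
  shows "sq x = (\<Sum>k<d. (norm (b (f k) x))\<^sup>2)"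
proof -
  have "b x x = (\<Sum>k<d. of_real ((norm (b (f k) x))\<^sup>2))"
    unfolding assms[of x x]
  proof (rule sum.cong[OF refl])
    fix k
    show "b x (f k) * b (f k) x = of_real ((norm (b (f k) x))\<^sup>2)"
      using commute[of x "f k"] by (simp add: complex_norm_square mult.commute del: of_real_power)
  qed
  then show ?thesis by (simp add: sq_def)
qed

end


section \<open>Discrete Fourier transform\<close>

text \<open>These are the characters of the cyclic group of order \<open>K\<close>, written symmetrically in the index of the
  character and its argument.\<close>

definition dft_char :: "nat \<Rightarrow> nat \<Rightarrow> nat \<Rightarrow> complex" where
  "dft_char K s r = cis (2 * pi * real s * real r / real K)"

lemma dft_char_sym: "dft_char K s r = dft_char K r s"
  by (simp add: dft_char_def mult_ac)

lemma norm_dft_char [simp]: "norm (dft_char K s r) = 1"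
  by (simp add: dft_char_def)

lemma dft_char_add: "dft_char K s (r + r') = dft_char K s r * dft_char K s r'"
  by (simp add: dft_char_def cis_mult add_divide_distrib[symmetric] distrib_left)

lemma dft_char_power: "dft_char K s (r * j) = dft_char K s r ^ j"
  unfolding dft_char_def Complex.DeMoivre by (rule arg_cong[where f = cis]) (simp add: field_simps)

lemma dft_char_1_power: "dft_char K s r = dft_char K s 1 ^ r"
  using dft_char_power[of K s 1 r] by simp

lemma dft_orthogonality:
  assumes "s < K" "t < K"
  shows "(\<Sum>r<K. dft_char K s r * cnj (dft_char K t r)) = (if s = t then of_nat K else 0)"
proof (cases "s = t")
  case True
  then show ?thesis by (simp add: complex_norm_square[symmetric])
next
  case False
  define w where "w = cis (2 * pi * (real s - real t) / real K)"
  have K: "K > 0" using assms by simp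
  have eq: "dft_char K s r * cnj (dft_char K t r) = w ^ r" for r
    unfolding dft_char_def w_def Complex.DeMoivre cis_cnj cis_mult
    by (rule arg_cong[where f = cis]) (simp add: diff_divide_distrib algebra_simps)
  have "w ^ K = cis (2 * pi * (real s - real t))"
    using K by (simp add: w_def Complex.DeMoivre)
  also have "\<dots> = cis (2 * pi * of_int (int s - int t))"
    by simp
  also have "\<dots> = 1"
    using cis_multiple_2pi[of "of_int (int s - int t)"] by simp
  finally have wK: "w ^ K = 1" .
  have w1: "w \<noteq> 1"
  proof
    assume "w = 1"
    then obtain k :: int where "2 * pi * (real s - real t) / real K = of_int k * (2 * pi)"
      unfolding w_def by (auto simp: complex_eq_iff cos_one_2pi_int)
    then have "2 * pi * (real s - real t) = 2 * pi * (of_int k * real K)"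
      using K by (simp add: field_simps)
    then have "real s - real t = of_int k * real K" by simp
    then have st: "int s - int t = k * int K"
      by (metis of_int_diff of_int_eq_iff of_int_mult of_int_of_nat_eq)
    have "\<bar>int s - int t\<bar> < int K" using assms by auto
    then have "\<bar>k\<bar> * int K < 1 * int K" using st by (simp add: abs_mult)
    then have "k = 0" using K by simp
    then show False using st False by simp
  qed
  have "(\<Sum>r<K. w ^ r) = 0"
    using geometric_sum[OF w1, of K] wK by simp
  then show ?thesis using False by (simp add: eq)
qed

lemma dft_orthogonality':
  assumes "s < K" "t < K"
  shows "(\<Sum>r<K. dft_char K r s * cnj (dft_char K r t)) = (if s = t then of_nat K else 0)"
  using dft_orthogonality[OF assms] by (simp add: dft_char_sym)

lemma (in psd_form) dft_parseval:
  assumes K: "K > 0"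
  shows "(\<Sum>r<K. sq (sc (1 / of_nat K) (\<Sum>s<K. sc (dft_char K s r) (a s)))) = (\<Sum>s<K. sq (a s)) / real K"
proof -
  let ?W = "\<lambda>r. sc (1 / of_nat K) (\<Sum>s<K. sc (dft_char K s r) (a s))"
  let ?k = "of_nat K :: complex"
  have 1: "b (?W r) (?W r) = (1 / ?k\<^sup>2) * (\<Sum>s<K. \<Sum>t<K. dft_char K s r * cnj (dft_char K t r) * b (a s) (a t))" for r
  proof -
    have "b (\<Sum>s<K. sc (dft_char K s r) (a s)) (\<Sum>s<K. sc (dft_char K s r) (a s))
       = (\<Sum>s<K. \<Sum>t<K. dft_char K s r * cnj (dft_char K t r) * b (a s) (a t))"
      by (subst sum_left, rule sum.cong[OF refl], subst sum_right, rule sum.cong[OF refl])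
         (simp add: sc_left sc_right)
    then show ?thesis
      by (simp add: sc_left sc_right power2_eq_square)
  qed
  have "(\<Sum>r<K. b (?W r) (?W r)) = (1 / ?k\<^sup>2) * (\<Sum>r<K. \<Sum>s<K. \<Sum>t<K. dft_char K s r * cnj (dft_char K t r) * b (a s) (a t))"
    by (simp only: 1 sum_distrib_left[symmetric])
  also have "(\<Sum>r<K. \<Sum>s<K. \<Sum>t<K. dft_char K s r * cnj (dft_char K t r) * b (a s) (a t))
      = (\<Sum>s<K. \<Sum>t<K. (\<Sum>r<K. dft_char K s r * cnj (dft_char K t r)) * b (a s) (a t))"
    by (subst sum.swap, rule sum.cong[OF refl], subst sum.swap) (simp add: sum_distrib_right)
  also have "\<dots> = (\<Sum>s<K. \<Sum>t<K. if s = t then ?k * b (a s) (a s) else 0)"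
    by (intro sum.cong refl) (auto simp: dft_orthogonality)
  also have "\<dots> = (\<Sum>s<K. ?k * b (a s) (a s))"
    by (intro sum.cong refl) (auto simp: sum.delta)
  also have "\<dots> = ?k * (\<Sum>s<K. b (a s) (a s))"
    by (simp add: sum_distrib_left)
  finally have "(\<Sum>r<K. b (?W r) (?W r)) = (\<Sum>s<K. b (a s) (a s)) / ?k"
    using K by (simp add: power2_eq_square)
  then have "complex_of_real (\<Sum>r<K. sq (?W r)) = of_real ((\<Sum>s<K. sq (a s)) / real K)"
    by (simp add: self)
  then show ?thesis using of_real_eq_iff by blast
qed

lemma (in psd_form) dft_inversion:
  assumes "r < K"
  shows "sc (1 / of_nat K) (\<Sum>s<K. sc (dft_char K s r) (\<Sum>t<K. sc (cnj (dft_char K s t)) (u t))) = u r"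
proof -
  have "(\<Sum>s<K. sc (dft_char K s r) (\<Sum>t<K. sc (cnj (dft_char K s t)) (u t)))
     = (\<Sum>s<K. \<Sum>t<K. sc (dft_char K s r * cnj (dft_char K s t)) (u t))"
    by (simp add: scale_sum_right)
  also have "\<dots> = (\<Sum>t<K. sc (\<Sum>s<K. dft_char K s r * cnj (dft_char K s t)) (u t))"
    by (subst sum.swap) (simp add: scale_sum_left)
  also have "\<dots> = (\<Sum>t<K. if t = r then sc (of_nat K) (u r) else 0)"
    by (intro sum.cong refl) (use assms in \<open>auto simp: dft_orthogonality'\<close>)
  also have "\<dots> = sc (of_nat K) (u r)"
    using assms by (simp add: sum.delta)
  finally show ?thesis using assms by simp
qed


section \<open>Replacing an operator by unimodular scalars\<close>

text \<open>The square of \<open>h\<close> is the sum of the defects \<open>sq x - sq (A x)\<close> over the orbit of \<open>h\<close> under \<open>A\<close>, since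
  the orbit tends to zero. On the orbit the operator in the conclusion acts as a convolution, and the
  discrete Fourier transform turns the convolution into the operators in \<open>bound\<close>.\<close>

lemma (in psd_form) defect_step:
  fixes A :: "'v \<Rightarrow> 'v" and L :: "'i \<Rightarrow> 'v \<Rightarrow> 'v"
  assumes A_add: "\<And>x y. A (x + y) = A x + A y" and A_sc: "\<And>c x. A (sc c x) = sc c (A x)"
    and defect: "\<And>x. sq (A x) \<le> sq x"
    and pure: "\<And>x. (\<lambda>k. sq ((A ^^ k) x)) \<longlonglongrightarrow> 0"
    and I: "finite I"
    and L_add: "\<And>s x y. s \<in> I \<Longrightarrow> L s (x + y) = L s x + L s y"
    and L_sc: "\<And>s c x. s \<in> I \<Longrightarrow> L s (sc c x) = sc c (L s x)"
    and L_A: "\<And>s x. s \<in> I \<Longrightarrow> L s (A x) = A (L s x)"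
    and bound: "\<And>\<zeta> x. norm \<zeta> = 1 \<Longrightarrow>
      sq (\<Sum>s\<in>I. sc (\<zeta> ^ e s) (L s x)) - sq (A (\<Sum>s\<in>I. sc (\<zeta> ^ e s) (L s x))) \<le> M\<^sup>2 * (sq x - sq (A x))"
  shows "sq (\<Sum>s\<in>I. (A ^^ e s) (L s h)) \<le> M\<^sup>2 * sq h"
proof -
  define b' where "b' x y = b x y - b (A x) (A y)" for x y
  interpret D: psd_form sc b'
  proof
    show "b' x y = cnj (b' y x)" for x y
      unfolding b'_def by (simp add: commute[of x y] commute[of "A x" "A y"])
    show "0 \<le> Re (b' x x)" for x using defect[of x] by (simp add: b'_def sq_def)
  qed (simp_all add: b'_def A_add A_sc add_left sc_left algebra_simps)
  have Dsq: "D.sq x = sq x - sq (A x)" for x by (simp add: D.sq_def b'_def sq_def)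
  have A_pow_L: "(A ^^ r) (L s x) = L s ((A ^^ r) x)" if "s \<in> I" for s r x
    by (induction r) (auto simp: L_A that)
  have A0: "A 0 = 0" using A_add[of 0 0] by simp
  have L0: "L s 0 = 0" if "s \<in> I" for s using L_add[OF that, of 0 0] by simp
  have L_sum: "L s (\<Sum>t\<in>T. u t) = (\<Sum>t\<in>T. L s (u t))" if "s \<in> I" for s and T :: "nat set" and u
    by (induction T rule: infinite_finite_induct) (auto simp: L0 L_add that)
  have A_pow_sum: "(A ^^ r) (\<Sum>s\<in>S. u s) = (\<Sum>s\<in>S. (A ^^ r) (u s))" for r S and u :: "'i \<Rightarrow> 'v"
  proof -
    have "(A ^^ r) 0 = 0" by (induction r) (auto simp: A0)
    moreover have "(A ^^ r) (x + y) = (A ^^ r) x + (A ^^ r) y" for x y by (induction r) (auto simp: A_add)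
    ultimately show ?thesis by (induction S rule: infinite_finite_induct) auto
  qed
  have telescope: "(\<Sum>r<R. D.sq ((A ^^ r) x)) = sq x - sq ((A ^^ R) x)" for R x
    by (induction R) (auto simp: Dsq)
  define g where "g = (\<Sum>s\<in>I. (A ^^ e s) (L s h))"
  have partial: "(\<Sum>r<R. D.sq ((A ^^ r) g)) \<le> M\<^sup>2 * sq h" for R
  proof -
    \<comment> \<open>With this period the first \<open>R\<close> outputs of the convolution involve no wrap-around.\<close>
    define K where "K = Suc (R + (\<Sum>s\<in>I. e s))"
    have K: "K > 0" by (simp add: K_def)
    have eK: "r + e s < K" if "s \<in> I" "r < R" for s r
      using member_le_sum[of s I e] that I by (simp add: K_def)
    define u where "u s = (\<Sum>t<K. sc (cnj (dft_char K s t)) ((A ^^ t) h))" for s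
    define a where "a t = (\<Sum>s\<in>I. sc (dft_char K t 1 ^ e s) (L s (u t)))" for t
    let ?W = "\<lambda>r. sc (1 / of_nat K) (\<Sum>t<K. sc (dft_char K t r) (a t))"
    have W: "?W r = (A ^^ r) g" if r: "r < R" for r
    proof -
      have "?W r = sc (1 / of_nat K) (\<Sum>t<K. \<Sum>s\<in>I. L s (sc (dft_char K t (r + e s)) (u t)))"
        by (simp add: a_def scale_sum_right dft_char_add dft_char_1_power[of K _ "e _"] L_sc cong: sum.cong)
      also have "\<dots> = (\<Sum>s\<in>I. sc (1 / of_nat K) (\<Sum>t<K. L s (sc (dft_char K t (r + e s)) (u t))))"
        by (subst sum.swap) (simp add: scale_sum_right)
      also have "\<dots> = (\<Sum>s\<in>I. L s (sc (1 / of_nat K) (\<Sum>t<K. sc (dft_char K t (r + e s)) (u t))))"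
        by (intro sum.cong refl) (simp add: L_sum L_sc)
      also have "\<dots> = (\<Sum>s\<in>I. L s ((A ^^ (r + e s)) h))"
        unfolding u_def by (intro sum.cong refl, subst dft_inversion) (use eK r in auto)
      also have "\<dots> = (A ^^ r) g"
        by (simp add: g_def A_pow_sum A_pow_L funpow_add cong: sum.cong)
      finally show ?thesis .
    qed
    have "(\<Sum>r<R. D.sq ((A ^^ r) g)) = (\<Sum>r<R. D.sq (?W r))" by (simp add: W)
    also have "\<dots> \<le> (\<Sum>r<K. D.sq (?W r))" by (rule sum_mono2) (auto simp: K_def)
    also have "\<dots> = (\<Sum>t<K. D.sq (a t)) / real K" by (rule D.dft_parseval[OF K])
    also have "\<dots> \<le> (\<Sum>t<K. M\<^sup>2 * D.sq (u t)) / real K"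
      by (intro divide_right_mono sum_mono) (use bound in \<open>auto simp: Dsq a_def\<close>)
    also have "\<dots> = M\<^sup>2 * ((\<Sum>t<K. D.sq (u t)) / real K)" by (simp add: sum_distrib_left)
    also have "(\<Sum>t<K. D.sq (u t)) / real K = (\<Sum>r<K. D.sq (sc (1 / of_nat K) (\<Sum>t<K. sc (dft_char K t r) (u t))))"
      by (rule D.dft_parseval[OF K, symmetric])
    also have "\<dots> = (\<Sum>r<K. D.sq ((A ^^ r) h))"
      unfolding u_def by (intro sum.cong refl, subst D.dft_inversion) auto
    also have "M\<^sup>2 * \<dots> \<le> M\<^sup>2 * sq h" by (intro mult_left_mono) (auto simp: telescope)
    finally show ?thesis .
  qed
  have "sq g \<le> M\<^sup>2 * sq h"
  proof (rule LIMSEQ_le_const2)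
    show "(\<lambda>R. sq g - sq ((A ^^ R) g)) \<longlonglongrightarrow> sq g"
      using tendsto_diff[OF tendsto_const pure, of "sq g" g] by simp
    show "\<exists>N. \<forall>n\<ge>N. sq g - sq ((A ^^ n) g) \<le> M\<^sup>2 * sq h"
      using partial by (simp add: telescope)
  qed
  then show ?thesis by (simp add: g_def)
qed


section \<open>Coordinate vectors and isometric matrices\<close>

text \<open>A vector of length \<open>N\<close> is a function of which only the values below \<open>N\<close> matter, and the product over
  any set of indices is a semidefinite form on such functions. Splitting a vector into blocks is then
  only a splitting of the index set.\<close>

definition vscale :: "complex \<Rightarrow> (nat \<Rightarrow> complex) \<Rightarrow> nat \<Rightarrow> complex" where
  "vscale c v = (\<lambda>a. c * v a)"

definition cdot :: "nat set \<Rightarrow> (nat \<Rightarrow> complex) \<Rightarrow> (nat \<Rightarrow> complex) \<Rightarrow> complex" where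
  "cdot I v w = (\<Sum>a\<in>I. v a * cnj (w a))"

definition norm2 :: "nat set \<Rightarrow> (nat \<Rightarrow> complex) \<Rightarrow> real" where
  "norm2 I v = (\<Sum>a\<in>I. (norm (v a))\<^sup>2)"

lemma cdot_self: "cdot I v v = of_real (norm2 I v)"
  by (simp add: cdot_def norm2_def complex_norm_square del: of_real_power)

lemma norm2_nonneg [simp]: "0 \<le> norm2 I v"
  by (simp add: norm2_def sum_nonneg)

lemma norm2_eq_0_iff: "finite I \<Longrightarrow> norm2 I v = 0 \<longleftrightarrow> (\<forall>a\<in>I. v a = 0)"
  by (simp add: norm2_def sum_nonneg_eq_0_iff)

lemma cdot_cong: "(\<And>a. a \<in> I \<Longrightarrow> v a = v' a) \<Longrightarrow> (\<And>a. a \<in> I \<Longrightarrow> w a = w' a) \<Longrightarrow> cdot I v w = cdot I v' w'"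
  by (simp add: cdot_def)

lemma norm2_cong: "(\<And>a. a \<in> I \<Longrightarrow> v a = v' a) \<Longrightarrow> norm2 I v = norm2 I v'"
  by (simp add: norm2_def)

interpretation cv: psd_form vscale "cdot I" for I
proof
  show "0 \<le> Re (cdot I x x)" for x by (simp add: cdot_self)
qed (auto simp: vscale_def cdot_def fun_eq_iff algebra_simps sum.distrib sum_distrib_left)

lemma cv_sq: "psd_form.sq (cdot I) v = norm2 I v"
  by (simp add: cv.sq_def cdot_self)

lemma cdot_basis:
  assumes "a < N"
  shows "cdot {..<N} (\<lambda>i. if i = a then 1 else 0) w = cnj (w a)"
proof -
  have "cdot {..<N} (\<lambda>i. if i = a then 1 else 0) w = (\<Sum>i<N. if i = a then cnj (w a) else 0)"
    unfolding cdot_def by (rule sum.cong) auto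
  then show ?thesis using assms by (simp add: sum.delta)
qed

lemma norm2_basis:
  assumes "a < N" shows "norm2 {..<N} (\<lambda>i. if i = a then 1 else 0) = 1"
proof -
  have "norm2 {..<N} (\<lambda>i. if i = a then 1 else 0) = (\<Sum>i<N. if i = a then 1 else 0)"
    unfolding norm2_def by (rule sum.cong) auto
  then show ?thesis using assms by (simp add: sum.delta)
qed

lemma orthonormal_total_norm:
  assumes "cv.orthonormal {..<N} d e"
  shows "(\<Sum>a<N. \<Sum>k<d. (norm (e k a))\<^sup>2) = real d"
proof -
  have "(\<Sum>a<N. \<Sum>k<d. (norm (e k a))\<^sup>2) = (\<Sum>k<d. norm2 {..<N} (e k))"
    unfolding norm2_def by (rule sum.swap)
  also have "\<dots> = (\<Sum>k<d. 1)"
  proof (rule sum.cong[OF refl])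
    fix k assume "k \<in> {..<d}"
    then have "cdot {..<N} (e k) (e k) = 1" using cv.orthonormalD[OF assms, of k k] by simp
    then show "norm2 {..<N} (e k) = 1" using cdot_self by (metis of_real_eq_1_iff)
  qed
  finally show ?thesis by simp
qed

text \<open>Bessel's inequality for the unit vectors, summed over all of them: the trace of a projection is at
  most the dimension.\<close>

lemma orthonormal_le_dim:
  assumes "cv.orthonormal {..<N} d e"
  shows "d \<le> N"
proof -
  have "real d = (\<Sum>a<N. \<Sum>k<d. (norm (e k a))\<^sup>2)"
    using orthonormal_total_norm[OF assms] by simp
  also have "\<dots> \<le> (\<Sum>a<N. 1)"
  proof (rule sum_mono)
    fix a assume "a \<in> {..<N}"
    then show "(\<Sum>k<d. (norm (e k a))\<^sup>2) \<le> 1"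
      using cv.bessel[OF assms, of "\<lambda>i. if i = a then 1 else 0"]
      by (simp add: cdot_basis norm2_basis cv_sq)
  qed
  finally show ?thesis by simp
qed

text \<open>For a maximal family Bessel's inequality is an equality, so that the same trace computation gives
  exactly \<open>N\<close> members.\<close>

lemma orthonormal_basis_completion:
  assumes "cv.orthonormal {..<N} m e"
  obtains f where "m \<le> N" "cv.orthonormal {..<N} N f" "\<And>k. k < m \<Longrightarrow> f k = e k"
    "\<And>x y. cdot {..<N} x y = (\<Sum>k<N. cdot {..<N} x (f k) * cdot {..<N} (f k) y)"
proof -
  obtain d f where f: "m \<le> d" "cv.orthonormal {..<N} d f" "\<And>k. k < m \<Longrightarrow> f k = e k"
    "\<And>x y. cdot {..<N} x y = (\<Sum>k<d. cdot {..<N} x (f k) * cdot {..<N} (f k) y)"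
  proof (rule cv.orthonormal_basis_extension[OF assms])
    show "d \<le> N" if "cv.orthonormal {..<N} d g" for d g
      using that by (rule orthonormal_le_dim)
  qed blast
  have "real d = (\<Sum>a<N. \<Sum>k<d. (norm (f k a))\<^sup>2)"
    using orthonormal_total_norm[OF f(2)] by simp
  also have "\<dots> = (\<Sum>a<N. 1)"
  proof (rule sum.cong[OF refl])
    fix a assume a: "a \<in> {..<N}"
    let ?u = "\<lambda>i. if i = a then 1 else 0 :: complex"
    have "norm (cdot {..<N} (f k) ?u) = norm (f k a)" for k
    proof -
      have "cdot {..<N} (f k) ?u = cnj (cdot {..<N} ?u (f k))" by (rule cv.commute)
      then show ?thesis using a cdot_basis[of a N "f k"] by simp
    qed
    then show "(\<Sum>k<d. (norm (f k a))\<^sup>2) = 1"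
      using cv.sq_expansion[OF f(4), of ?u] a by (simp add: norm2_basis cv_sq)
  qed
  finally have "d = N" by simp
  then show thesis using that f by blast
qed

definition mapply :: "nat \<Rightarrow> (nat \<Rightarrow> nat \<Rightarrow> complex) \<Rightarrow> (nat \<Rightarrow> complex) \<Rightarrow> nat \<Rightarrow> complex" where
  "mapply N U v = (\<lambda>a. \<Sum>j<N. U a j * v j)"

definition is_isometry :: "nat \<Rightarrow> (nat \<Rightarrow> nat \<Rightarrow> complex) \<Rightarrow> bool" where
  "is_isometry N U \<longleftrightarrow> (\<forall>v w. cdot {..<N} (mapply N U v) (mapply N U w) = cdot {..<N} v w)"

lemma mapply_cong: "(\<And>j. j < N \<Longrightarrow> v j = w j) \<Longrightarrow> mapply N U v = mapply N U w"
  by (simp add: mapply_def)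

lemma mapply_add: "mapply N U (\<lambda>j. v j + w j) a = mapply N U v a + mapply N U w a"
  by (simp add: mapply_def distrib_left sum.distrib)

lemma mapply_diff: "mapply N U (\<lambda>j. v j - w j) a = mapply N U v a - mapply N U w a"
  by (simp add: mapply_def right_diff_distrib sum_subtractf)

lemma mapply_scale: "mapply N U (\<lambda>j. c * v j) a = c * mapply N U v a"
  by (simp add: mapply_def sum_distrib_left mult_ac)

lemma mapply_sum: "mapply N U (\<lambda>j. \<Sum>s\<in>S. f s j) a = (\<Sum>s\<in>S. mapply N U (f s) a)"
  unfolding mapply_def by (subst sum.swap) (simp add: sum_distrib_left)

text \<open>Equal Gram matrices make \<open>X x \<mapsto> Y x\<close> a well-defined isometry between subspaces. A family that is
  orthonormal for the common Gram form has orthonormal images under \<open>X\<close> and under \<open>Y\<close>; both images are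
  completed to bases, and \<open>U\<close> maps one basis to the other. The maps are antilinear because they will be
  coordinates \<open>b (e k) x\<close>, in which \<open>x\<close> is the second argument; this choice turns the conjugated
  coefficients of adjoint polynomials back into the original ones.\<close>

lemma isometry_extension:
  fixes X Y :: "'v::ab_group_add \<Rightarrow> nat \<Rightarrow> complex" and sc :: "complex \<Rightarrow> 'v \<Rightarrow> 'v"
  assumes "vector_space sc"
    and X: "\<And>x y a. X (x + y) a = X x a + X y a" "\<And>c x a. X (sc c x) a = cnj c * X x a"
    and Y: "\<And>x y a. Y (x + y) a = Y x a + Y y a" "\<And>c x a. Y (sc c x) a = cnj c * Y x a"
    and gram: "\<And>x y. cdot {..<N} (X x) (X y) = cdot {..<N} (Y x) (Y y)"
  obtains U where "is_isometry N U" "\<And>x a. a < N \<Longrightarrow> mapply N U (X x) a = Y x a"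
proof -
  let ?N = "{..<N}"
  define P where "P x y = cdot ?N (X y) (X x)" for x y
  interpret vector_space sc by fact
  interpret P: psd_form sc P
  proof
    show "P (x + y) z = P x z + P y z" for x y z
      by (simp add: P_def cdot_def X algebra_simps sum.distrib)
    show "P (sc c x) z = c * P x z" for c x z
      by (simp add: P_def cdot_def X sum_distrib_left mult_ac)
    show "P x y = cnj (P y x)" for x y unfolding P_def by (rule cv.commute)
    show "0 \<le> Re (P x x)" for x unfolding P_def by (rule cv.nonneg)
  qed
  have orth: "cv.orthonormal ?N d (\<lambda>k. X (f k))" if "P.orthonormal d f" for d f
    using that unfolding cv.orthonormal_def P.orthonormal_def by (auto simp: P_def)
  have "P.orthonormal 0 (\<lambda>_. 0)" by (simp add: P.orthonormal_def)
  then obtain m e where e: "P.orthonormal m e"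
    and P: "\<And>x y. P x y = (\<Sum>k<m. P x (e k) * P (e k) y)"
    using P.orthonormal_basis_extension[of 0 "\<lambda>_. 0" N] orth orthonormal_le_dim by metis
  have eY: "cv.orthonormal ?N m (\<lambda>k. Y (e k))"
    using orth[OF e] unfolding cv.orthonormal_def by (simp add: gram)
  obtain f where f: "m \<le> N" "cv.orthonormal ?N N f" "\<And>k. k < m \<Longrightarrow> f k = X (e k)"
    and fx: "\<And>x y. cdot ?N x y = (\<Sum>k<N. cdot ?N x (f k) * cdot ?N (f k) y)"
    using orthonormal_basis_completion[OF orth[OF e]] by metis
  obtain f' where f': "cv.orthonormal ?N N f'" "\<And>k. k < m \<Longrightarrow> f' k = Y (e k)"
    using orthonormal_basis_completion[OF eY] by metis
  define U where "U a j = (\<Sum>k<N. f' k a * cnj (f k j))" for a j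
  have U: "mapply N U v a = (\<Sum>k<N. cdot ?N v (f k) * f' k a)" for v a
  proof -
    have "mapply N U v a = (\<Sum>j<N. \<Sum>k<N. f' k a * cnj (f k j) * v j)"
      by (simp add: mapply_def U_def sum_distrib_right)
    also have "\<dots> = (\<Sum>k<N. \<Sum>j<N. f' k a * cnj (f k j) * v j)" by (rule sum.swap)
    finally show ?thesis by (simp add: cdot_def sum_distrib_left mult_ac)
  qed
  have U': "mapply N U v = (\<Sum>k<N. vscale (cdot ?N v (f k)) (f' k))" for v
  proof
    fix a
    have "(\<Sum>k\<in>S. vscale (cdot ?N v (f k)) (f' k)) a = (\<Sum>k\<in>S. cdot ?N v (f k) * f' k a)" for S :: "nat set"
      by (induction S rule: infinite_finite_induct) (auto simp: vscale_def)
    then show "mapply N U v a = (\<Sum>k<N. vscale (cdot ?N v (f k)) (f' k)) a" by (simp add: U)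
  qed
  have "is_isometry N U"
    unfolding is_isometry_def
  proof (intro allI)
    fix v w
    have "cdot ?N (mapply N U v) (mapply N U w)
        = (\<Sum>k<N. \<Sum>l<N. cdot ?N v (f k) * cnj (cdot ?N w (f l)) * cdot ?N (f' k) (f' l))"
      unfolding U' by (simp add: cv.linear_simps sum_distrib_left mult_ac, rule sum.swap)
    also have "\<dots> = (\<Sum>k<N. \<Sum>l<N. if k = l then cdot ?N v (f k) * cnj (cdot ?N w (f k)) else 0)"
      by (intro sum.cong refl) (auto simp: cv.orthonormalD[OF f'(1)])
    also have "\<dots> = (\<Sum>k<N. cdot ?N v (f k) * cnj (cdot ?N w (f k)))"
      by (intro sum.cong refl) (auto simp: sum.delta)
    also have "\<dots> = (\<Sum>k<N. cdot ?N v (f k) * cdot ?N (f k) w)"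
      by (intro sum.cong refl) (simp add: cv.commute[of _ w])
    also have "\<dots> = cdot ?N v w" by (rule fx[symmetric])
    finally show "cdot ?N (mapply N U v) (mapply N U w) = cdot ?N v w" .
  qed
  moreover have "mapply N U (X x) a = Y x a" if a: "a < N" for x a
  proof -
    have expand: "Z x a = (\<Sum>k<m. cnj (P x (e k)) * Z (e k) a)"
      if Z: "\<And>x y a. Z (x + y) a = Z x a + Z y a" "\<And>c x a. Z (sc c x) a = cnj c * Z x a"
        and ZP: "\<And>x. norm2 ?N (Z x) = P.sq x" and a: "a < N" for Z x a
    proof -
      have Z0: "Z 0 a = 0" using Z(1)[of 0 0 a] by simp
      have Zsum: "Z (\<Sum>k\<in>S. g k) a = (\<Sum>k\<in>S. Z (g k) a)" for S :: "nat set" and g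
        by (induction S rule: infinite_finite_induct) (auto simp: Z Z0)
      have Zdiff: "Z (p - q) a = Z p a - Z q a" for p q
        using Z(1)[of "p - q" q a] by simp
      have "norm2 ?N (Z (P.residual m e x)) = 0"
        using P.residual_product[OF e, of x "P.residual m e x", folded P[of x "P.residual m e x"]]
          ZP[of "P.residual m e x"] by (simp add: P.sq_def)
      then have "Z (P.residual m e x) a = 0"
        using a by (simp add: norm2_eq_0_iff)
      then show ?thesis by (simp add: P.residual_def Zdiff Zsum Z)
    qed
    have XP: "norm2 ?N (X x) = P.sq x" for x
      by (simp add: P.sq_def P_def cdot_self)
    have YP: "norm2 ?N (Y x) = P.sq x" for x
      using gram[of x x] by (simp add: P.sq_def P_def cdot_self)
    have coeff: "cdot ?N (X x) (f k) = (if k < m then cnj (P x (e k)) else 0)" if k: "k < N" for k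
    proof (cases "k < m")
      case True
      then show ?thesis using f(3) P.commute[of "e k" x] by (simp add: P_def)
    next
      case False
      have "cdot ?N (X x) (f k) = (\<Sum>a<N. (\<Sum>l<m. cnj (P x (e l)) * X (e l) a) * cnj (f k a))"
        unfolding cdot_def by (rule sum.cong[OF refl]) (subst expand[of X, OF X XP], auto)
      also have "\<dots> = (\<Sum>l<m. cnj (P x (e l)) * cdot ?N (f l) (f k))"
        unfolding cdot_def sum_distrib_right sum_distrib_left
        by (subst sum.swap) (simp add: f(3) mult_ac)
      also have "\<dots> = 0"
        by (rule sum.neutral) (use False f(1) k in \<open>auto simp: cv.orthonormalD[OF f(2)]\<close>)
      finally show ?thesis using False by simp
    qed
    have "mapply N U (X x) a = (\<Sum>k<N. if k < m then cnj (P x (e k)) * Y (e k) a else 0)"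
      unfolding U by (rule sum.cong[OF refl]) (auto simp: coeff f'(2))
    also have "\<dots> = (\<Sum>k<m. cnj (P x (e k)) * Y (e k) a)"
      by (rule sum.mono_neutral_cong_right) (use f(1) in auto)
    also have "\<dots> = Y x a" by (rule expand[of Y, OF Y YP a, symmetric])
    finally show ?thesis .
  qed
  ultimately show thesis using that by blast
qed


section \<open>Linear systems\<close>

lemma det_eq_0_iff_kernel:
  fixes M :: "nat \<Rightarrow> nat \<Rightarrow> complex"
  shows "det (Matrix.mat n n (\<lambda>(i, j). M i j)) = 0 \<longleftrightarrow>
    (\<exists>v. (\<exists>j<n. v j \<noteq> 0) \<and> (\<forall>k<n. (\<Sum>j<n. M k j * v j) = 0))"
proof -
  let ?A = "Matrix.mat n n (\<lambda>(i, j). M i j)"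
  have row: "(?A *\<^sub>v v) $ k = (\<Sum>j<n. M k j * v $ j)" if "v \<in> carrier_vec n" "k < n" for v k
    using that by (auto simp: scalar_prod_def atLeast0LessThan)
  have "det ?A = 0 \<longleftrightarrow> (\<exists>v. v \<in> carrier_vec n \<and> v \<noteq> 0\<^sub>v n \<and> ?A *\<^sub>v v = 0\<^sub>v n)"
    by (rule det_0_iff_vec_prod_zero) simp
  also have "\<dots> \<longleftrightarrow> (\<exists>v. (\<exists>j<n. v j \<noteq> 0) \<and> (\<forall>k<n. (\<Sum>j<n. M k j * v j) = 0))"
  proof
    assume "\<exists>v. v \<in> carrier_vec n \<and> v \<noteq> 0\<^sub>v n \<and> ?A *\<^sub>v v = 0\<^sub>v n"
    then obtain v where v: "v \<in> carrier_vec n" "v \<noteq> 0\<^sub>v n" "?A *\<^sub>v v = 0\<^sub>v n" by blast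
    have "\<exists>j<n. v $ j \<noteq> 0" using v(1,2) by (auto simp: vec_eq_iff)
    moreover have "(\<Sum>j<n. M k j * v $ j) = 0" if "k < n" for k
      using row[OF v(1) that] v(3) that by simp
    ultimately show "\<exists>v. (\<exists>j<n. v j \<noteq> 0) \<and> (\<forall>k<n. (\<Sum>j<n. M k j * v j) = 0)" by blast
  next
    assume "\<exists>v. (\<exists>j<n. v j \<noteq> 0) \<and> (\<forall>k<n. (\<Sum>j<n. M k j * v j) = 0)"
    then obtain v where v: "\<exists>j<n. v j \<noteq> 0" "\<forall>k<n. (\<Sum>j<n. M k j * v j) = 0" by blast
    have c: "vec n v \<in> carrier_vec n" by simp
    have "vec n v \<noteq> 0\<^sub>v n" using v(1) by (auto simp: vec_eq_iff)
    moreover have "?A *\<^sub>v vec n v = 0\<^sub>v n"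
      by (rule eq_vecI) (use v(2) row[OF c] in \<open>auto\<close>)
    ultimately show "\<exists>v. v \<in> carrier_vec n \<and> v \<noteq> 0\<^sub>v n \<and> ?A *\<^sub>v v = 0\<^sub>v n" using c by blast
  qed
  finally show ?thesis .
qed

text \<open>Padding with zero rows gives a square matrix with vanishing determinant.\<close>

lemma underdetermined_system:
  fixes M :: "nat \<Rightarrow> nat \<Rightarrow> complex"
  assumes "m < n"
  obtains v where "\<exists>j<n. v j \<noteq> 0" "\<And>k. k < m \<Longrightarrow> (\<Sum>j<n. M k j * v j) = 0"
proof -
  define M' where "M' k j = (if k < m then M k j else 0)" for k j
  have "Matrix.mat n n (\<lambda>(i, j). M' i j) = mat\<^sub>r n n (\<lambda>i. if i = m then 0\<^sub>v n else Matrix.vec n (M' i))"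
    by (rule eq_matI) (auto simp: M'_def)
  moreover have "det (mat\<^sub>r n n (\<lambda>i. if i = m then 0\<^sub>v n else Matrix.vec n (M' i))) = 0"
    by (rule det_row_0) (use assms in auto)
  ultimately have "det (Matrix.mat n n (\<lambda>(i, j). M' i j)) = 0" by simp
  then obtain v where v: "\<exists>j<n. v j \<noteq> 0" "\<forall>k<n. (\<Sum>j<n. M' k j * v j) = 0"
    unfolding det_eq_0_iff_kernel by blast
  have "(\<Sum>j<n. M k j * v j) = 0" if "k < m" for k
  proof -
    have "(\<Sum>j<n. M' k j * v j) = 0" using v(2) that assms by auto
    then show ?thesis using that by (simp add: M'_def)
  qed
  then show thesis using that v(1) by blast
qed


section \<open>Colligations and their iterates at one frequency\<close>

definition join :: "nat \<Rightarrow> (nat \<Rightarrow> complex) \<Rightarrow> (nat \<Rightarrow> complex) \<Rightarrow> nat \<Rightarrow> complex" where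
  "join d x y = (\<lambda>j. if j < d then x j else y j)"

lemma cdot_split: "d \<le> N \<Longrightarrow> cdot {..<N} v w = cdot {..<d} v w + cdot {d..<N} v w"
  unfolding cdot_def
  by (subst sum.union_disjoint[symmetric]) (auto simp: ivl_disj_un intro: sum.cong)

lemma cdot_join:
  "d \<le> N \<Longrightarrow> cdot {..<N} (join d x y) (join d x' y') = cdot {..<d} x x' + cdot {d..<N} y y'"
  by (subst cdot_split[of d]) (auto simp: join_def cdot_def)

lemma norm2_scale: "norm2 I (\<lambda>a. c * v a) = (norm c)\<^sup>2 * norm2 I v"
  by (simp add: norm2_def norm_mult power_mult_distrib sum_distrib_left)

lemma cdot_scale: "cdot I (\<lambda>a. c * v a) (\<lambda>a. c' * w a) = c * cnj c' * cdot I v w"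
  by (simp add: cdot_def sum_distrib_left mult_ac)

text \<open>The first \<open>d\<close> coordinates of a vector are the input or output of a linear system, the others its state,
  and \<open>U\<close> maps an input and a state to an output and a new state. The last condition says that the
  block from states to states has no unimodular eigenvalue.\<close>

locale colligation =
  fixes N d :: nat and U :: "nat \<Rightarrow> nat \<Rightarrow> complex"
  assumes le: "d \<le> N"
    and iso: "is_isometry N U"
    and stable: "\<And>\<zeta> y. norm \<zeta> = 1 \<Longrightarrow>
      (\<And>a. a < N \<Longrightarrow> mapply N U (join d (\<lambda>_. 0) (\<lambda>j. \<zeta> * y j)) a = join d (\<lambda>_. 0) y a) \<Longrightarrow>
      (\<And>a. d \<le> a \<Longrightarrow> a < N \<Longrightarrow> y a = 0)"
begin

lemma io_product:
  assumes "\<And>a. a < N \<Longrightarrow> mapply N U (join d x y) a = join d x' y' a"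
    and "\<And>a. a < N \<Longrightarrow> mapply N U (join d z w) a = join d z' w' a"
  shows "cdot {..<d} x z + cdot {d..<N} y w = cdot {..<d} x' z' + cdot {d..<N} y' w'"
proof -
  have "cdot {..<N} (join d x y) (join d z w) = cdot {..<N} (mapply N U (join d x y)) (mapply N U (join d z w))"
    using iso by (simp add: is_isometry_def)
  also have "\<dots> = cdot {..<N} (join d x' y') (join d z' w')"
    by (rule cdot_cong) (use assms in auto)
  finally show ?thesis by (simp add: cdot_join le)
qed

lemma io_energy:
  assumes "\<And>a. a < N \<Longrightarrow> mapply N U (join d x y) a = join d x' y' a"
  shows "norm2 {..<d} x + norm2 {d..<N} y = norm2 {..<d} x' + norm2 {d..<N} y'"
  using io_product[OF assms assms] by (simp only: cdot_self of_real_add[symmetric] of_real_eq_iff)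

text \<open>At the frequency \<open>\<zeta>\<close> the state on the input side is \<open>\<zeta>\<close> times the state on the output side. When this
  equation is solved for the state, the map from input to output is the transfer function. It is never
  formed: a sequence in \<open>solutions \<zeta>\<close> contains the iterates of the transfer function on the input
  \<open>v 0\<close> in the first \<open>d\<close> coordinates, together with the states.\<close>

definition step :: "complex \<Rightarrow> (nat \<Rightarrow> complex) \<Rightarrow> nat \<Rightarrow> complex" where
  "step \<zeta> v = mapply N U (join d v (\<lambda>j. \<zeta> * v j))"

definition solutions :: "complex \<Rightarrow> (nat \<Rightarrow> nat \<Rightarrow> complex) set" where
  "solutions \<zeta> = {v. \<forall>i. \<forall>a<N. step \<zeta> (v i) a = join d (v (Suc i)) (v i) a}"

definition eigenvector :: "complex \<Rightarrow> complex \<Rightarrow> (nat \<Rightarrow> complex) \<Rightarrow> bool" where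
  "eigenvector \<kappa> \<zeta> u \<longleftrightarrow> (\<forall>a<N. step \<zeta> u a = join d (\<lambda>j. \<kappa> * u j) u a)"

text \<open>At a frequency that determines the state by the input, a point of the curve is an eigenvalue of the
  transfer function together with the frequency.\<close>

definition curve :: "(complex \<times> complex) set" where
  "curve = {(\<kappa>, \<zeta>). \<exists>u. (\<exists>a<N. u a \<noteq> 0) \<and> eigenvector \<kappa> \<zeta> u}"

lemma step_add: "step \<zeta> (\<lambda>j. v j + w j) a = step \<zeta> v a + step \<zeta> w a"
  unfolding step_def mapply_add[symmetric]
  by (rule arg_cong[where f = "\<lambda>f. mapply N U f a"]) (auto simp: join_def algebra_simps)

lemma step_scale: "step \<zeta> (\<lambda>j. c * v j) a = c * step \<zeta> v a"
  unfolding step_def mapply_scale[symmetric]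
  by (rule arg_cong[where f = "\<lambda>f. mapply N U f a"]) (auto simp: join_def algebra_simps)

lemma step_sum: "step \<zeta> (\<lambda>j. \<Sum>s\<in>S. f s j) a = (\<Sum>s\<in>S. step \<zeta> (f s) a)"
  unfolding step_def mapply_sum[symmetric]
  by (rule arg_cong[where f = "\<lambda>f. mapply N U f a"]) (auto simp: join_def sum_distrib_left)

lemma solutionsD: "v \<in> solutions \<zeta> \<Longrightarrow> a < N \<Longrightarrow> step \<zeta> (v i) a = join d (v (Suc i)) (v i) a"
  by (simp add: solutions_def)

lemma solutions_add: "v \<in> solutions \<zeta> \<Longrightarrow> w \<in> solutions \<zeta> \<Longrightarrow> (\<lambda>i a. v i a + w i a) \<in> solutions \<zeta>"
  by (simp add: solutions_def step_add join_def)

lemma solutions_scale: "v \<in> solutions \<zeta> \<Longrightarrow> (\<lambda>i a. c * v i a) \<in> solutions \<zeta>"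
  by (simp add: solutions_def step_scale join_def)

lemma solutions_sum: "(\<And>s. s \<in> S \<Longrightarrow> f s \<in> solutions \<zeta>) \<Longrightarrow> (\<lambda>i a. \<Sum>s\<in>S. f s i a) \<in> solutions \<zeta>"
  by (simp add: solutions_def step_sum join_def)

lemma solutions_shift: "v \<in> solutions \<zeta> \<Longrightarrow> (\<lambda>i. v (Suc i)) \<in> solutions \<zeta>"
  by (simp add: solutions_def)

lemma eigenvector_solution:
  assumes "eigenvector \<kappa> \<zeta> u"
  shows "(\<lambda>i a. \<kappa> ^ i * u a) \<in> solutions \<zeta>"
  using assms by (simp add: solutions_def eigenvector_def step_scale join_def)

lemma solutions_product:
  assumes "norm \<zeta> = 1" "v \<in> solutions \<zeta>" "w \<in> solutions \<zeta>"
  shows "cdot {..<d} (v (Suc i)) (w (Suc i)) = cdot {..<d} (v i) (w i)"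
proof -
  have "\<zeta> * cnj \<zeta> = 1" using assms(1) by (simp add: complex_norm_square[symmetric])
  moreover have "cdot {..<d} (v i) (w i) + cdot {d..<N} (\<lambda>j. \<zeta> * v i j) (\<lambda>j. \<zeta> * w i j)
    = cdot {..<d} (v (Suc i)) (w (Suc i)) + cdot {d..<N} (v i) (w i)"
    by (rule io_product) (use assms in \<open>auto simp: step_def[symmetric] solutionsD\<close>)
  ultimately show ?thesis by (simp add: cdot_scale)
qed

lemma solutions_norm2:
  assumes "norm \<zeta> = 1" "v \<in> solutions \<zeta>"
  shows "norm2 {..<d} (v i) = norm2 {..<d} (v 0)"
proof (induction i)
  case (Suc i)
  show ?case using solutions_product[OF assms(1,2,2), of i] Suc by (simp add: cdot_self)
qed simp

text \<open>A state that reproduces itself up to a unimodular factor keeps its norm, which without input leaves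
  nothing for the output. So the state equation implies the output equation in \<open>stable\<close>.\<close>

lemma stable_energy:
  assumes "norm \<zeta> = 1"
    and "\<And>a. d \<le> a \<Longrightarrow> a < N \<Longrightarrow> mapply N U (join d (\<lambda>_. 0) (\<lambda>j. \<zeta> * y j)) a = y a"
    and "d \<le> a" "a < N"
  shows "y a = 0"
proof -
  let ?x' = "mapply N U (join d (\<lambda>_. 0) (\<lambda>j. \<zeta> * y j))"
  have "norm2 {..<d} (\<lambda>_. 0) + norm2 {d..<N} (\<lambda>j. \<zeta> * y j) = norm2 {..<d} ?x' + norm2 {d..<N} y"
    by (rule io_energy) (use assms in \<open>auto simp: join_def\<close>)
  then have "norm2 {..<d} ?x' = 0"
    using assms(1) by (simp add: norm2_scale) (simp add: norm2_def)
  then have "?x' a = 0" if "a < d" for a using that by (simp add: norm2_eq_0_iff)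
  then show ?thesis
    using stable[OF assms(1), of y a] assms(2-4) by (simp add: join_def)
qed

text \<open>The squared norm of the input is constant along a solution, and a state without input vanishes by
  stability. Thus the product of the inputs is definite on solutions.\<close>

lemma solutions_eq_0:
  assumes z: "norm \<zeta> = 1" and v: "v \<in> solutions \<zeta>" and 0: "\<And>a. a < d \<Longrightarrow> v 0 a = 0" and a: "a < N"
  shows "v i a = 0"
proof -
  have "norm2 {..<d} (v 0) = 0" using 0 by (simp add: norm2_eq_0_iff)
  then have "norm2 {..<d} (v i) = 0" for i using solutions_norm2[OF z v, of i] by simp
  then have x0: "v i a = 0" if "a < d" for i a using that by (simp add: norm2_eq_0_iff)
  have "v i a = 0" if "d \<le> a" "a < N" for a
  proof (rule stable_energy[OF z _ that])
    fix a assume a: "d \<le> a" "a < N"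
    have "join d (v i) (\<lambda>j. \<zeta> * v i j) = join d (\<lambda>_. 0) (\<lambda>j. \<zeta> * v i j)"
      using x0 by (auto simp: join_def)
    then show "mapply N U (join d (\<lambda>_. 0) (\<lambda>j. \<zeta> * v i j)) a = v i a"
      using solutionsD[OF v a(2), of i] a by (simp add: step_def join_def)
  qed
  then show ?thesis using x0 a by (cases "a < d") auto
qed

text \<open>The state equation becomes homogeneous with one more unknown, the coefficient of the inhomogeneous
  term. It has a nontrivial solution, in which that coefficient is nonzero because the state equation
  has no kernel.\<close>

lemma inner_state_exists:
  assumes z: "norm \<zeta> = 1"
  shows "\<exists>y. \<forall>a. d \<le> a \<longrightarrow> a < N \<longrightarrow> mapply N U (join d x (\<lambda>j. \<zeta> * y j)) a = y a"
proof -
  let ?m = "N - d"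
  have split: "(\<Sum>j<N. f j) = (\<Sum>j<d. f j) + (\<Sum>j<?m. f (d + j))" for f :: "nat \<Rightarrow> complex"
  proof -
    have "(\<Sum>j<d + m. f j) = (\<Sum>j<d. f j) + (\<Sum>j<m. f (d + j))" for m
      by (induction m) (auto simp: add_ac)
    from this[of ?m] show ?thesis using le by simp
  qed
  define c where "c k = (\<Sum>j<d. U (d + k) j * x j)" for k
  define M where "M k j = (if j < ?m then U (d + k) (d + j) * \<zeta> - (if j = k then 1 else 0) else c k)" for k j
  obtain u where u: "\<exists>j<Suc ?m. u j \<noteq> 0" "\<And>k. k < ?m \<Longrightarrow> (\<Sum>j<Suc ?m. M k j * u j) = 0"
    using underdetermined_system[of ?m "Suc ?m" M] by auto
  have eq: "(\<Sum>j<?m. U (d + k) (d + j) * (\<zeta> * u j)) + c k * u ?m = u k" if k: "k < ?m" for k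
  proof -
    have "0 = (\<Sum>j<?m. M k j * u j) + M k ?m * u ?m" using u(2)[OF k] by simp
    also have "(\<Sum>j<?m. M k j * u j) = (\<Sum>j<?m. U (d + k) (d + j) * (\<zeta> * u j) - (if j = k then u k else 0))"
      by (rule sum.cong) (auto simp: M_def algebra_simps)
    also have "\<dots> = (\<Sum>j<?m. U (d + k) (d + j) * (\<zeta> * u j)) - u k"
      using k by (simp add: sum_subtractf sum.delta)
    finally have "(\<Sum>j<?m. U (d + k) (d + j) * (\<zeta> * u j)) - u k + c k * u ?m = 0"
      by (simp add: M_def)
    then show ?thesis by (subst eq_iff_diff_eq_0) (simp add: algebra_simps)
  qed
  have app: "mapply N U (join d x' (\<lambda>j. \<zeta> * y j)) (d + k) =
      (\<Sum>j<d. U (d + k) j * x' j) + (\<Sum>j<?m. U (d + k) (d + j) * (\<zeta> * y (d + j)))" for x' y k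
    unfolding mapply_def split by (simp add: join_def)
  show ?thesis
  proof (cases "u ?m = 0")
    case True
    have "u k = 0" if "k < ?m" for k
    proof -
      have "(\<lambda>j. u (j - d)) (d + k) = 0"
      proof (rule stable_energy[OF z, of "\<lambda>j. u (j - d)" "d + k"])
        fix a assume a: "d \<le> a" "a < N"
        then show "mapply N U (join d (\<lambda>_. 0) (\<lambda>j. \<zeta> * u (j - d))) a = u (a - d)"
          using app[of "\<lambda>_. 0" "\<lambda>j. u (j - d)" "a - d"] eq[of "a - d"] True by simp
      qed (use that in auto)
      then show ?thesis by simp
    qed
    then show ?thesis using u(1) True by (auto simp: less_Suc_eq)
  next
    case False
    show ?thesis
    proof (intro exI allI impI)
      fix a assume a: "d \<le> a" "a < N"
      define k where "k = a - d"
      have k: "k < ?m" "a = d + k" using a by (auto simp: k_def)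
      have "mapply N U (join d x (\<lambda>j. \<zeta> * (u (j - d) / u ?m))) a
          = c k + (\<Sum>j<?m. U (d + k) (d + j) * (\<zeta> * u j)) / u ?m"
        unfolding k(2) app[of x "\<lambda>j. u (j - d) / u ?m"] by (simp add: c_def sum_divide_distrib)
      also have "\<dots> = u k / u ?m"
        using eq[OF k(1)] False by (simp add: field_simps)
      finally show "mapply N U (join d x (\<lambda>j. \<zeta> * (u (j - d) / u ?m))) a = u (a - d) / u ?m"
        by (simp add: k_def)
    qed
  qed
qed

lemma solutions_exist:
  assumes z: "norm \<zeta> = 1"
  obtains v where "v \<in> solutions \<zeta>" "\<And>a. a < d \<Longrightarrow> v 0 a = x a"
proof -
  obtain Y where Y: "\<And>x a. d \<le> a \<Longrightarrow> a < N \<Longrightarrow> mapply N U (join d x (\<lambda>j. \<zeta> * Y x j)) a = Y x a"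
    using inner_state_exists[OF z] by metis
  define X where "X = rec_nat x (\<lambda>_ x. mapply N U (join d x (\<lambda>j. \<zeta> * Y x j)))"
  have X0: "X 0 = x" and XS: "X (Suc i) = mapply N U (join d (X i) (\<lambda>j. \<zeta> * Y (X i) j))" for i
    by (simp_all add: X_def)
  define v where "v i = join d (X i) (Y (X i))" for i
  have "join d (v i) (\<lambda>j. \<zeta> * v i j) = join d (X i) (\<lambda>j. \<zeta> * Y (X i) j)" for i
    by (auto simp: v_def join_def)
  then have "step \<zeta> (v i) = X (Suc i)" for i by (simp add: step_def XS)
  moreover have "X (Suc i) a = join d (v (Suc i)) (v i) a" if "a < N" for i a
    using that Y[of a "X i"] by (cases "a < d") (simp_all add: v_def XS, simp_all add: join_def XS)
  ultimately have "v \<in> solutions \<zeta>" by (simp add: solutions_def)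
  moreover have "v 0 a = x a" if "a < d" for a
    using that by (simp add: v_def join_def X0)
  ultimately show thesis using that by blast
qed

text \<open>The spectral theorem for the shift on solutions: the shift is an isometry, so an annihilating polynomial splits off one root at a time, the roots are unimodular on
  nonzero solutions, and no Jordan blocks occur.\<close>

lemma eigen_decomposition_of_annihilated:
  assumes z: "norm \<zeta> = 1" and v: "v \<in> solutions \<zeta>" and p: "p \<noteq> 0"
    and ann: "\<And>a. a < d \<Longrightarrow> (\<Sum>i\<le>degree p. coeff p i * v i a) = 0"
  shows "\<exists>\<Lambda> u. finite \<Lambda> \<and> (\<forall>\<kappa>\<in>\<Lambda>. norm \<kappa> = 1 \<and> eigenvector \<kappa> \<zeta> (u \<kappa>)) \<and>
    (\<forall>i. \<forall>a<N. v i a = (\<Sum>\<kappa>\<in>\<Lambda>. \<kappa> ^ i * u \<kappa> a))"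
  using v p ann
proof (induction "degree p" arbitrary: p v)
  case 0
  then have "coeff p 0 \<noteq> 0" by (metis leading_coeff_0_iff)
  then have "v 0 a = 0" if "a < d" for a using 0(1) 0(4)[OF that] by simp
  then have "v i a = 0" if "a < N" for i a using solutions_eq_0[OF z 0(2)] that by blast
  then show ?case by (intro exI[of _ "{}"]) auto
next
  case (Suc n)
  have "\<not> constant (poly p)" using Suc(2) by (simp add: constant_degree)
  then obtain r where r: "poly p r = 0" using Fundamental_Theorem_Algebra.fundamental_theorem_of_algebra by blast
  then have "[:- r, 1:] dvd p" by (simp add: poly_eq_0_iff_dvd)
  then obtain q where q: "p = [:- r, 1:] * q" by (rule dvdE)
  have q0: "q \<noteq> 0" using Suc(4) q by auto
  have "degree p = degree [:- r, 1:] + degree q" unfolding q by (rule degree_mult_eq) (use q0 in auto)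
  then have dq: "n = degree q" using Suc(2) by simp
  define v' where "v' i a = v (Suc i) a + (- r) * v i a" for i a
  have v': "v' \<in> solutions \<zeta>"
    unfolding v'_def by (intro solutions_add solutions_scale solutions_shift Suc)
  have cp: "coeff p i = (case i of 0 \<Rightarrow> 0 | Suc j \<Rightarrow> coeff q j) - r * coeff q i" for i
    unfolding q by (simp add: coeff_pCons split: nat.split)
  have "(\<Sum>i\<le>degree q. coeff q i * v' i a) = 0" if "a < d" for a
  proof -
    have "0 = (\<Sum>i\<le>Suc n. coeff p i * v i a)" using Suc(5)[OF that] Suc(2) by simp
    also have "\<dots> = (\<Sum>i\<le>Suc n. (case i of 0 \<Rightarrow> 0 | Suc j \<Rightarrow> coeff q j) * v i a) - r * (\<Sum>i\<le>Suc n. coeff q i * v i a)"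
      by (simp only: cp left_diff_distrib sum_subtractf sum_distrib_left mult.assoc)
    also have "(\<Sum>i\<le>Suc n. (case i of 0 \<Rightarrow> 0 | Suc j \<Rightarrow> coeff q j) * v i a) = (\<Sum>i\<le>n. coeff q i * v (Suc i) a)"
      by (simp add: sum.atMost_Suc_shift del: sum.atMost_Suc)
    also have "(\<Sum>i\<le>Suc n. coeff q i * v i a) = (\<Sum>i\<le>n. coeff q i * v i a)"
      using dq by (simp add: coeff_eq_0)
    also have "(\<Sum>i\<le>n. coeff q i * v (Suc i) a) - r * (\<Sum>i\<le>n. coeff q i * v i a) = (\<Sum>i\<le>n. coeff q i * v' i a)"
      by (simp add: v'_def algebra_simps sum_distrib_left sum_subtractf)
    finally show ?thesis using dq by simp
  qed
  from Suc(1)[OF dq v' q0 this] obtain \<Lambda> u where L: "finite \<Lambda>"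
    "\<And>\<kappa>. \<kappa> \<in> \<Lambda> \<Longrightarrow> norm \<kappa> = 1 \<and> eigenvector \<kappa> \<zeta> (u \<kappa>)"
    "\<And>i a. a < N \<Longrightarrow> v' i a = (\<Sum>\<kappa>\<in>\<Lambda>. \<kappa> ^ i * u \<kappa> a)" by blast
  define \<Lambda>0 where "\<Lambda>0 = \<Lambda> - {r}"
  define s where "s i a = (\<Sum>\<kappa>\<in>\<Lambda>0. \<kappa> ^ i * (1 / (\<kappa> - r) * u \<kappa> a))" for i a
  have scaled: "eigenvector \<kappa> \<zeta> (\<lambda>a. 1 / (\<kappa> - r) * u \<kappa> a)" if "\<kappa> \<in> \<Lambda>" for \<kappa>
    using L(2)[OF that] unfolding eigenvector_def step_scale by (auto simp: join_def)
  have s: "s \<in> solutions \<zeta>"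
    unfolding s_def by (intro solutions_sum eigenvector_solution scaled) (auto simp: \<Lambda>0_def)
  define y where "y i a = v i a + (- 1) * s i a" for i a
  have y: "y \<in> solutions \<zeta>"
    unfolding y_def by (intro solutions_add solutions_scale s Suc)
  \<comment> \<open>A nonzero \<open>w\<close> would be the second half of a Jordan block of the shift on \<open>y\<close>.\<close>
  define w where "w = (if r \<in> \<Lambda> then u r else (\<lambda>_. 0))"
  have yS: "y (Suc i) a = r * y i a + r ^ i * w a" if a: "a < N" for i a
  proof -
    have "s (Suc i) a - r * s i a = (\<Sum>\<kappa>\<in>\<Lambda>0. \<kappa> ^ i * u \<kappa> a)"
      unfolding s_def sum_distrib_left sum_subtractf[symmetric]
    proof (rule sum.cong[OF refl])
      fix \<kappa> assume "\<kappa> \<in> \<Lambda>0"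
      then have "\<kappa> - r \<noteq> 0" by (simp add: \<Lambda>0_def)
      define t where "t = 1 / (\<kappa> - r)"
      have "(\<kappa> - r) * t = 1" using \<open>\<kappa> - r \<noteq> 0\<close> by (simp add: t_def)
      moreover have "\<kappa> ^ Suc i * (t * u \<kappa> a) - r * (\<kappa> ^ i * (t * u \<kappa> a)) = (\<kappa> - r) * t * (\<kappa> ^ i * u \<kappa> a)"
        by (simp add: algebra_simps)
      ultimately show "\<kappa> ^ Suc i * (1 / (\<kappa> - r) * u \<kappa> a) - r * (\<kappa> ^ i * (1 / (\<kappa> - r) * u \<kappa> a)) = \<kappa> ^ i * u \<kappa> a"
        by (simp only: t_def) simp
    qed
    moreover have "v' i a = r ^ i * w a + (\<Sum>\<kappa>\<in>\<Lambda>0. \<kappa> ^ i * u \<kappa> a)"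
      unfolding L(3)[OF a] w_def \<Lambda>0_def using L(1) by (auto simp: sum.remove)
    ultimately show ?thesis by (simp add: y_def v'_def algebra_simps)
  qed
  have w0: "w a = 0" if a: "a < N" for a
  proof (cases "r \<in> \<Lambda>")
    case True
    have r1: "r * cnj r = 1" using L(2)[OF True] by (simp add: complex_norm_square[symmetric])
    have ws: "(\<lambda>i a. r ^ i * w a) \<in> solutions \<zeta>"
      using eigenvector_solution L(2)[OF True] True by (simp add: w_def)
    have "cdot {..<d} (y (Suc 0)) (\<lambda>a. r ^ Suc 0 * w a) = cdot {..<d} (y 0) (\<lambda>a. r ^ 0 * w a)"
      using solutions_product[OF z y ws, of 0] .
    moreover have "cdot {..<d} (y (Suc 0)) (\<lambda>a. r ^ Suc 0 * w a)
        = cdot {..<d} (\<lambda>a. r * y 0 a + w a) (\<lambda>a. r * w a)"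
      by (rule cdot_cong) (use yS le in auto)
    moreover have "\<dots> = r * cnj r * cdot {..<d} (y 0) w + cnj r * cdot {..<d} w w"
      by (simp add: cdot_def algebra_simps sum.distrib sum_distrib_left)
    ultimately have "cnj r * cdot {..<d} w w = 0" by (simp add: r1)
    then have "norm2 {..<d} w = 0" using r1 by (auto simp: cdot_self)
    then have "r ^ 0 * w a = 0" if "a < d" for a using that by (simp add: norm2_eq_0_iff)
    then show ?thesis using solutions_eq_0[OF z ws _ a, of 0] by simp
  qed (simp add: w_def)
  have yi: "y i a = r ^ i * y 0 a" if "a < N" for i a
    by (induction i) (use yS that w0 in auto)
  show ?case
  proof (cases "norm r = 1")
    case True
    let ?u = "\<lambda>\<kappa>. if \<kappa> = r then y 0 else (\<lambda>a. 1 / (\<kappa> - r) * u \<kappa> a)"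
    have "eigenvector r \<zeta> (y 0)"
      using y yS w0 le by (auto simp: eigenvector_def solutions_def join_def)
    then have f1: "\<forall>\<kappa>\<in>insert r \<Lambda>0. norm \<kappa> = 1 \<and> eigenvector \<kappa> \<zeta> (?u \<kappa>)"
      using L(2) scaled True by (auto simp: \<Lambda>0_def)
    have f2: "v i a = (\<Sum>\<kappa>\<in>insert r \<Lambda>0. \<kappa> ^ i * ?u \<kappa> a)" if a: "a < N" for i a
    proof -
      have "(\<Sum>\<kappa>\<in>\<Lambda>0. \<kappa> ^ i * ?u \<kappa> a) = s i a"
        unfolding s_def by (rule sum.cong) (auto simp: \<Lambda>0_def)
      then have "(\<Sum>\<kappa>\<in>insert r \<Lambda>0. \<kappa> ^ i * ?u \<kappa> a) = y i a + s i a"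
        using L(1) yi[OF a, of i] by (subst sum.insert) (auto simp: \<Lambda>0_def)
      then show ?thesis by (simp add: y_def)
    qed
    have "finite (insert r \<Lambda>0)" using L(1) by (simp add: \<Lambda>0_def)
    with f1 show ?thesis
      by (intro exI[of _ "insert r \<Lambda>0"] exI[of _ ?u] conjI allI impI f2)
  next
    case False
    have "norm2 {..<d} (y 1) = (norm r)\<^sup>2 * norm2 {..<d} (y 0)"
      unfolding norm2_scale[symmetric] by (rule norm2_cong) (use yi[of _ 1] le in auto)
    then have "(norm r)\<^sup>2 * norm2 {..<d} (y 0) = 1 * norm2 {..<d} (y 0)"
      using solutions_norm2[OF z y, of 1] by simp
    moreover have "(norm r)\<^sup>2 \<noteq> 1" using False norm_ge_zero[of r] by (auto simp: power2_eq_1_iff simp del: norm_ge_zero)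
    ultimately have "norm2 {..<d} (y 0) = 0" by (metis mult_right_cancel)
    then have "y i a = 0" if "a < N" for i a
      using solutions_eq_0[OF z y _ that] by (simp add: norm2_eq_0_iff)
    then have "v i a = s i a" if "a < N" for i a using that by (auto simp: y_def)
    then show ?thesis
      using L(1,2) scaled
      by (intro exI[of _ \<Lambda>0] exI[of _ "\<lambda>\<kappa> a. 1 / (\<kappa> - r) * u \<kappa> a"]) (auto simp: \<Lambda>0_def s_def)
  qed
qed

text \<open>The inputs of the first \<open>d + 1\<close> iterates are linearly dependent, and a solution is determined by its
  input, so every solution is annihilated by a nonzero polynomial in the shift.\<close>

lemma eigen_decomposition:
  assumes z: "norm \<zeta> = 1" and v: "v \<in> solutions \<zeta>"
  obtains \<Lambda> u where "finite \<Lambda>" "\<And>\<kappa>. \<kappa> \<in> \<Lambda> \<Longrightarrow> norm \<kappa> = 1 \<and> eigenvector \<kappa> \<zeta> (u \<kappa>)"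
    "\<And>i a. a < N \<Longrightarrow> v i a = (\<Sum>\<kappa>\<in>\<Lambda>. \<kappa> ^ i * u \<kappa> a)"
proof -
  obtain c where c: "\<exists>j<Suc d. c j \<noteq> 0" "\<And>a. a < d \<Longrightarrow> (\<Sum>i<Suc d. v i a * c i) = 0"
    using underdetermined_system[of d "Suc d" "\<lambda>a i. v i a"] by auto
  define p where "p = (\<Sum>i<Suc d. monom (c i) i)"
  have cp: "coeff p i = (if i < Suc d then c i else 0)" for i
    by (simp add: p_def coeff_sum sum.delta del: sum.lessThan_Suc)
  have p0: "p \<noteq> 0" using c(1) cp by (metis coeff_0)
  have ann: "(\<Sum>i\<le>degree p. coeff p i * v i a) = 0" if "a < d" for a
  proof -
    have "degree p \<le> d" by (rule degree_le) (simp add: cp)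
    then have "(\<Sum>i\<le>degree p. coeff p i * v i a) = (\<Sum>i<Suc d. coeff p i * v i a)"
      by (intro sum.mono_neutral_left) (auto simp: coeff_eq_0)
    also have "\<dots> = (\<Sum>i<Suc d. v i a * c i)"
      by (rule sum.cong) (auto simp: cp)
    finally show ?thesis using c(2)[OF that] by simp
  qed
  from eigen_decomposition_of_annihilated[OF z v p0 ann] show thesis
    using that by blast
qed

lemma eigenvectors_orthogonal:
  assumes z: "norm \<zeta> = 1" and "eigenvector \<kappa> \<zeta> u" "eigenvector \<mu> \<zeta> w"
    and "norm \<mu> = 1" "\<kappa> \<noteq> \<mu>"
  shows "cdot {..<d} u w = 0"
proof -
  have "cdot {..<d} (\<lambda>a. \<kappa> ^ Suc 0 * u a) (\<lambda>a. \<mu> ^ Suc 0 * w a) = cdot {..<d} (\<lambda>a. \<kappa> ^ 0 * u a) (\<lambda>a. \<mu> ^ 0 * w a)"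
    by (rule solutions_product[OF z]) (use assms in \<open>auto intro: eigenvector_solution\<close>)
  then have eq: "\<kappa> * cnj \<mu> * cdot {..<d} u w = cdot {..<d} u w"
    by (simp add: cdot_scale)
  have "\<kappa> * cnj \<mu> \<noteq> 1"
  proof
    assume "\<kappa> * cnj \<mu> = 1"
    then have "\<kappa> * (\<mu> * cnj \<mu>) = \<mu>" by (simp add: mult_ac)
    then show False using assms by (simp add: complex_norm_square[symmetric])
  qed
  then show ?thesis using eq by (metis mult_cancel_right2)
qed

text \<open>By orthogonality of the eigenvectors a polynomial in the shift multiplies each orthogonal component of
  the input by a value of the polynomial on the curve.\<close>

lemma solutions_functional_calculus_bound:
  assumes z: "norm \<zeta> = 1" and v: "v \<in> solutions \<zeta>" and I: "finite I" and M: "0 \<le> M"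
    and bound: "\<And>\<kappa>. norm \<kappa> = 1 \<Longrightarrow> (\<kappa>, \<zeta>) \<in> curve \<Longrightarrow> norm (\<Sum>s\<in>I. c s * \<kappa> ^ e s) \<le> M"
  shows "norm2 {..<d} (\<lambda>a. \<Sum>s\<in>I. c s * v (e s) a) \<le> M\<^sup>2 * norm2 {..<d} (v 0)"
proof -
  obtain \<Lambda> u where L: "finite \<Lambda>" "\<And>\<kappa>. \<kappa> \<in> \<Lambda> \<Longrightarrow> norm \<kappa> = 1 \<and> eigenvector \<kappa> \<zeta> (u \<kappa>)"
    "\<And>i a. a < N \<Longrightarrow> v i a = (\<Sum>\<kappa>\<in>\<Lambda>. \<kappa> ^ i * u \<kappa> a)"
    using eigen_decomposition[OF z v] by blast
  define P where "P \<kappa> = (\<Sum>s\<in>I. c s * \<kappa> ^ e s)" for \<kappa>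
  have orth: "cdot {..<d} (u \<kappa>) (u \<mu>) = 0" if "\<kappa> \<in> \<Lambda>" "\<mu> \<in> \<Lambda>" "\<kappa> \<noteq> \<mu>" for \<kappa> \<mu>
    using eigenvectors_orthogonal[OF z] L(2) that by blast
  have pyth: "norm2 {..<d} (\<lambda>a. \<Sum>\<kappa>\<in>\<Lambda>. f \<kappa> * u \<kappa> a) = (\<Sum>\<kappa>\<in>\<Lambda>. (norm (f \<kappa>))\<^sup>2 * norm2 {..<d} (u \<kappa>))" for f
  proof -
    have "cdot {..<d} (\<lambda>a. \<Sum>\<kappa>\<in>\<Lambda>. f \<kappa> * u \<kappa> a) (\<lambda>a. \<Sum>\<kappa>\<in>\<Lambda>. f \<kappa> * u \<kappa> a)
       = (\<Sum>a<d. \<Sum>\<kappa>\<in>\<Lambda>. \<Sum>\<mu>\<in>\<Lambda>. f \<kappa> * cnj (f \<mu>) * (u \<kappa> a * cnj (u \<mu> a)))"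
      unfolding cdot_def cnj_sum sum_product by (intro sum.cong refl) (simp add: mult_ac)
    also have "\<dots> = (\<Sum>\<kappa>\<in>\<Lambda>. \<Sum>\<mu>\<in>\<Lambda>. f \<kappa> * cnj (f \<mu>) * cdot {..<d} (u \<kappa>) (u \<mu>))"
      unfolding cdot_def sum_distrib_left
      by (subst sum.swap, rule sum.cong[OF refl], rule sum.swap)
    also have "\<dots> = (\<Sum>\<kappa>\<in>\<Lambda>. \<Sum>\<mu>\<in>\<Lambda>. if \<kappa> = \<mu> then f \<kappa> * cnj (f \<kappa>) * cdot {..<d} (u \<kappa>) (u \<kappa>) else 0)"
      by (intro sum.cong refl) (auto simp: orth)
    also have "\<dots> = (\<Sum>\<kappa>\<in>\<Lambda>. f \<kappa> * cnj (f \<kappa>) * cdot {..<d} (u \<kappa>) (u \<kappa>))"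
      using L(1) by (simp add: sum.delta)
    also have "\<dots> = of_real (\<Sum>\<kappa>\<in>\<Lambda>. (norm (f \<kappa>))\<^sup>2 * norm2 {..<d} (u \<kappa>))"
      by (simp only: of_real_sum of_real_mult complex_norm_square cdot_self)
    finally show ?thesis by (simp only: cdot_self of_real_eq_iff)
  qed
  have "norm2 {..<d} (\<lambda>a. \<Sum>s\<in>I. c s * v (e s) a) = norm2 {..<d} (\<lambda>a. \<Sum>\<kappa>\<in>\<Lambda>. P \<kappa> * u \<kappa> a)"
  proof (rule norm2_cong)
    fix a assume "a \<in> {..<d}"
    then have a: "a < N" using le by simp
    have "(\<Sum>s\<in>I. c s * v (e s) a) = (\<Sum>s\<in>I. \<Sum>\<kappa>\<in>\<Lambda>. c s * \<kappa> ^ e s * u \<kappa> a)"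
      by (simp add: L(3)[OF a] sum_distrib_left mult_ac)
    also have "\<dots> = (\<Sum>\<kappa>\<in>\<Lambda>. \<Sum>s\<in>I. c s * \<kappa> ^ e s * u \<kappa> a)" by (rule sum.swap)
    finally show "(\<Sum>s\<in>I. c s * v (e s) a) = (\<Sum>\<kappa>\<in>\<Lambda>. P \<kappa> * u \<kappa> a)"
      by (simp add: P_def sum_distrib_right)
  qed
  also have "\<dots> = (\<Sum>\<kappa>\<in>\<Lambda>. (norm (P \<kappa>))\<^sup>2 * norm2 {..<d} (u \<kappa>))" by (rule pyth)
  also have "\<dots> \<le> (\<Sum>\<kappa>\<in>\<Lambda>. M\<^sup>2 * norm2 {..<d} (u \<kappa>))"
  proof (rule sum_mono)
    fix \<kappa> assume l: "\<kappa> \<in> \<Lambda>"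
    show "(norm (P \<kappa>))\<^sup>2 * norm2 {..<d} (u \<kappa>) \<le> M\<^sup>2 * norm2 {..<d} (u \<kappa>)"
    proof (cases "norm2 {..<d} (u \<kappa>) = 0")
      case False
      then obtain a where "a < d" "u \<kappa> a \<noteq> 0" by (auto simp: norm2_eq_0_iff)
      then have "\<exists>a<N. u \<kappa> a \<noteq> 0" using le by (intro exI[of _ a]) simp
      then have "(\<kappa>, \<zeta>) \<in> curve" using L(2)[OF l] by (auto simp: curve_def)
      then have "norm (P \<kappa>) \<le> M" using bound L(2)[OF l] by (simp add: P_def)
      then show ?thesis by (intro mult_right_mono power_mono) auto
    qed simp
  qed
  also have "\<dots> = M\<^sup>2 * (\<Sum>\<kappa>\<in>\<Lambda>. (norm (1::complex))\<^sup>2 * norm2 {..<d} (u \<kappa>))" by (simp add: sum_distrib_left)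
  also have "(\<Sum>\<kappa>\<in>\<Lambda>. (norm (1::complex))\<^sup>2 * norm2 {..<d} (u \<kappa>)) = norm2 {..<d} (\<lambda>a. \<Sum>\<kappa>\<in>\<Lambda>. 1 * u \<kappa> a)"
    by (rule pyth[symmetric])
  also have "\<dots> = norm2 {..<d} (v 0)"
    by (rule norm2_cong) (use L(3)[of _ 0] le in auto)
  finally show ?thesis .
qed

end


section \<open>Trajectories of a colligation\<close>

lemma sum_fun_apply: "(\<Sum>k\<in>S. f k) a = (\<Sum>k\<in>S. f k a)" for f :: "'i \<Rightarrow> 'a \<Rightarrow> complex"
  by (induction S rule: infinite_finite_induct) auto

lemma continuous_on_snd_apply: "continuous_on S (\<lambda>p. snd p j)"
  for S :: "('a::topological_space \<times> (nat \<Rightarrow> complex)) set"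
  by (rule continuous_on_product_then_coordinatewise) (intro continuous_intros)

lemma compact_unit_vectors: "compact {y. (\<forall>i. y i \<in> cball 0 1) \<and> norm2 I y = 1}"
proof -
  have "compact (PiE UNIV (\<lambda>i::nat. cball (0::complex) 1))"
    using compactin_PiE[of "\<lambda>i. euclidean" UNIV "\<lambda>i. cball (0::complex) 1"]
    by (simp add: euclidean_product_topology)
  moreover have "closed {y. norm2 I y = 1}"
    unfolding norm2_def by (intro closed_Collect_eq continuous_intros continuous_on_product_coordinates)
  moreover have "{y. (\<forall>i. y i \<in> cball 0 1) \<and> norm2 I y = 1} = PiE UNIV (\<lambda>i. cball 0 1) \<inter> {y. norm2 I y = 1}"
    by (auto simp: PiE_def Pi_def)
  ultimately show ?thesis by (simp add: compact_Int_closed)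
qed

lemma norm2_diff_le: "norm2 I (\<lambda>a. v a - w a) \<le> 2 * norm2 I v + 2 * norm2 I w"
proof -
  have "(norm (x - y))\<^sup>2 \<le> 2 * (norm x)\<^sup>2 + 2 * (norm y)\<^sup>2" for x y :: complex
  proof -
    have "(norm (x - y))\<^sup>2 \<le> (norm x + norm y)\<^sup>2" by (intro power_mono norm_triangle_ineq4) auto
    also have "\<dots> \<le> 2 * (norm x)\<^sup>2 + 2 * (norm y)\<^sup>2"
      using sum_squares_bound[of "norm x" "norm y"] by (simp add: power2_sum)
    finally show ?thesis .
  qed
  then have "norm2 I (\<lambda>a. v a - w a) \<le> (\<Sum>a\<in>I. 2 * (norm (v a))\<^sup>2 + 2 * (norm (w a))\<^sup>2)"
    unfolding norm2_def by (intro sum_mono)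
  then show ?thesis by (simp add: norm2_def sum.distrib sum_distrib_left)
qed

context colligation
begin

text \<open>The state depends boundedly on the input, uniformly in the frequency: without input the residual of the
  state equation is positive by stability, hence bounded below on the compact set of unimodular
  frequencies and unit states.\<close>

lemma inner_state_bound:
  obtains c where "c \<ge> 0" "\<And>\<zeta> x. norm \<zeta> = 1 \<Longrightarrow> (\<And>a. d \<le> a \<Longrightarrow> a < N \<Longrightarrow> step \<zeta> x a = x a) \<Longrightarrow>
      norm2 {d..<N} x \<le> c * norm2 {..<d} x"
proof -
  let ?I = "{d..<N}"
  define F where "F \<zeta> y = norm2 ?I (\<lambda>a. mapply N U (join d (\<lambda>_. 0) (\<lambda>j. \<zeta> * y j)) a - y a)" for \<zeta> y
  define K where "K = sphere (0::complex) 1 \<times> {y. (\<forall>i. y i \<in> cball 0 1) \<and> norm2 ?I y = 1}"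
  have F_scale: "F \<zeta> (\<lambda>a. c * y a) = (norm c)\<^sup>2 * F \<zeta> y" for \<zeta> c y
  proof -
    have "mapply N U (join d (\<lambda>_. 0) (\<lambda>j. \<zeta> * (c * y j))) a = c * mapply N U (join d (\<lambda>_. 0) (\<lambda>j. \<zeta> * y j)) a" for a
      unfolding mapply_scale[symmetric] by (rule arg_cong[where f = "\<lambda>f. mapply N U f a"]) (auto simp: join_def)
    then show ?thesis unfolding F_def norm2_scale[symmetric] by (simp add: algebra_simps)
  qed
  have F_cong: "F \<zeta> y = F \<zeta> y'" if "\<And>a. a \<in> ?I \<Longrightarrow> y a = y' a" for \<zeta> y y'
  proof -
    have "mapply N U (join d (\<lambda>_. 0) (\<lambda>j. \<zeta> * y j)) = mapply N U (join d (\<lambda>_. 0) (\<lambda>j. \<zeta> * y' j))"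
      by (rule mapply_cong) (use that in \<open>auto simp: join_def\<close>)
    then show ?thesis unfolding F_def using that by (intro norm2_cong) simp
  qed
  have "compact K" unfolding K_def by (intro compact_Times compact_sphere compact_unit_vectors)
  moreover have "continuous_on K (\<lambda>p. F (fst p) (snd p))"
  proof -
    have j: "continuous_on K (\<lambda>p. join d (\<lambda>_. 0) (\<lambda>j. fst p * snd p j) j)" for j
      by (cases "j < d") (auto simp: join_def intro!: continuous_intros continuous_on_snd_apply)
    show ?thesis
      unfolding F_def norm2_def mapply_def
      by (intro continuous_intros j continuous_on_snd_apply)
  qed
  ultimately have min: "K \<noteq> {} \<Longrightarrow> \<exists>p\<in>K. \<forall>q\<in>K. F (fst p) (snd p) \<le> F (fst q) (snd q)"
    by (intro continuous_attains_inf) auto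
  obtain m where m: "m > 0" "\<And>\<zeta> y. (\<zeta>, y) \<in> K \<Longrightarrow> m \<le> F \<zeta> y"
  proof (cases "K = {}")
    case True
    then show thesis using that[of 1] by simp
  next
    case False
    then obtain \<zeta> y where p: "(\<zeta>, y) \<in> K" "\<And>\<zeta>' y'. (\<zeta>', y') \<in> K \<Longrightarrow> F \<zeta> y \<le> F \<zeta>' y'"
      using min by fastforce
    have "F \<zeta> y \<noteq> 0"
    proof
      assume "F \<zeta> y = 0"
      then have "y a = 0" if "d \<le> a" "a < N" for a
        using p(1) that by (intro stable_energy[of \<zeta>]) (auto simp: F_def norm2_eq_0_iff K_def)
      then have "norm2 ?I y = 0" by (simp add: norm2_eq_0_iff)
      then show False using p(1) by (simp add: K_def)
    qed
    then have "F \<zeta> y > 0" using norm2_nonneg F_def by (metis less_eq_real_def)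
    then show thesis using that p(2) by blast
  qed
  have "norm2 ?I x \<le> 1 / m * norm2 {..<d} x"
    if z: "norm \<zeta> = 1" and x: "\<And>a. d \<le> a \<Longrightarrow> a < N \<Longrightarrow> step \<zeta> x a = x a" for \<zeta> x
  proof (cases "norm2 ?I x = 0")
    case True
    then show ?thesis using m(1) by simp
  next
    case False
    define s where "s = norm2 ?I x"
    have s: "s > 0" using False norm2_nonneg[of ?I x] by (metis s_def less_eq_real_def)
    define y where "y a = (if a \<in> ?I then of_real (1 / sqrt s) * x a else 0)" for a
    have "norm2 ?I y = norm2 ?I (\<lambda>a. of_real (1 / sqrt s) * x a)" by (rule norm2_cong) (simp add: y_def)
    also have "\<dots> = 1" using s unfolding norm2_scale by (simp add: s_def[symmetric] power_divide norm_divide)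
    finally have y1: "norm2 ?I y = 1" .
    have "norm (y a) \<le> 1" for a
    proof (cases "a \<in> ?I")
      case True
      have "(norm (y a))\<^sup>2 \<le> norm2 ?I y" unfolding norm2_def by (rule member_le_sum[OF True]) auto
      then show ?thesis using y1 by (simp add: power_le_one_iff abs_square_le_1)
    qed (auto simp: y_def)
    then have "(\<zeta>, y) \<in> K" using y1 z by (simp add: K_def)
    then have "m \<le> F \<zeta> y" by (rule m(2))
    also have "F \<zeta> y = F \<zeta> (\<lambda>a. of_real (1 / sqrt s) * x a)" by (rule F_cong) (simp add: y_def)
    also have "\<dots> = F \<zeta> x / s" unfolding F_scale using s by (simp add: power_divide norm_divide)
    finally have mF: "m * s \<le> F \<zeta> x" using s by (simp add: field_simps)
    have "F \<zeta> x = norm2 ?I (\<lambda>a. (- 1) * mapply N U (join d x (\<lambda>_. 0)) a)"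
      unfolding F_def
    proof (rule norm2_cong)
      fix a assume a: "a \<in> ?I"
      have "join d x (\<lambda>j. \<zeta> * x j) = (\<lambda>j. join d x (\<lambda>_. 0) j + join d (\<lambda>_. 0) (\<lambda>j. \<zeta> * x j) j)"
        by (auto simp: join_def)
      then have "x a = mapply N U (join d x (\<lambda>_. 0)) a + mapply N U (join d (\<lambda>_. 0) (\<lambda>j. \<zeta> * x j)) a"
        using x[of a] a by (simp add: step_def mapply_add)
      then show "mapply N U (join d (\<lambda>_. 0) (\<lambda>j. \<zeta> * x j)) a - x a = (- 1) * mapply N U (join d x (\<lambda>_. 0)) a"
        by (simp add: algebra_simps)
    qed
    also have "\<dots> = norm2 ?I (mapply N U (join d x (\<lambda>_. 0)))" unfolding norm2_scale by simp
    also have "\<dots> \<le> norm2 {..<d} x"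
    proof -
      let ?w = "mapply N U (join d x (\<lambda>_. 0))"
      have "norm2 {..<d} x + norm2 ?I (\<lambda>_. 0) = norm2 {..<d} ?w + norm2 ?I ?w"
        by (rule io_energy) (simp add: join_def)
      moreover have "norm2 ?I (\<lambda>_. 0) = 0" by (simp add: norm2_def)
      ultimately show ?thesis using norm2_nonneg[of "{..<d}" ?w] by linarith
    qed
    finally show ?thesis using mF m(1) by (simp add: s_def field_simps)
  qed
  then show thesis using that[of "1 / m"] m(1) by auto
qed

text \<open>In \<open>R i k\<close> the index \<open>k\<close> is the time and \<open>i\<close> the number of a run of the system, whose output is the
  input of the next run. Time is traversed backwards: the state at \<open>Suc k\<close> enters at \<open>k\<close>, in the same
  way as \<open>\<phi> (A2 x)\<close> enters for \<open>x\<close> in a realized pair below.\<close>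

definition trajectory :: "(nat \<Rightarrow> nat \<Rightarrow> nat \<Rightarrow> complex) \<Rightarrow> bool" where
  "trajectory R \<longleftrightarrow> (\<forall>i k. \<forall>a<N. mapply N U (join d (R i k) (R i (Suc k))) a = join d (R (Suc i) k) (R i k) a)"

text \<open>At every \<open>P\<close>-th root of unity there is a solution whose input is the Fourier coefficient of \<open>x\<close>. The
  inverse transform of these solutions is a periodic trajectory with input \<open>x\<close>, and Parseval's identity
  carries over the two bounds that hold at each frequency.\<close>

lemma periodic_trajectory:
  assumes P: "P > 0" and I: "finite I" and M: "0 \<le> M"
    and bound: "\<And>\<kappa> \<zeta>. norm \<kappa> = 1 \<Longrightarrow> norm \<zeta> = 1 \<Longrightarrow> (\<kappa>, \<zeta>) \<in> curve \<Longrightarrow>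
        norm (\<Sum>s\<in>I. c s * \<kappa> ^ e s * \<zeta> ^ f s) \<le> M"
    and C: "C \<ge> 0" "\<And>\<zeta> x. norm \<zeta> = 1 \<Longrightarrow> (\<And>a. d \<le> a \<Longrightarrow> a < N \<Longrightarrow> step \<zeta> x a = x a) \<Longrightarrow>
      norm2 {d..<N} x \<le> C * norm2 {..<d} x"
  obtains R where "trajectory R" "\<And>k a. k < P \<Longrightarrow> a < d \<Longrightarrow> R 0 k a = x k a"
    "(\<Sum>k<P. norm2 {..<d} (\<lambda>a. \<Sum>s\<in>I. c s * R (e s) (k + f s) a)) \<le> M\<^sup>2 * (\<Sum>k<P. norm2 {..<d} (x k))"
    "\<And>i. (\<Sum>k<P. norm2 {d..<N} (R i k)) \<le> C * (\<Sum>k<P. norm2 {..<d} (x k))"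
proof -
  let ?\<zeta> = "\<lambda>s. dft_char P s 1"
  define X where "X s = (\<Sum>t<P. vscale (cnj (dft_char P s t)) (x t))" for s
  have "\<exists>v. v \<in> solutions (?\<zeta> s) \<and> (\<forall>a<d. v 0 a = X s a)" for s
    using solutions_exist[of "?\<zeta> s" "X s"] by (metis norm_dft_char)
  then obtain v where v: "\<And>s. v s \<in> solutions (?\<zeta> s)" "\<And>s a. a < d \<Longrightarrow> v s 0 a = X s a"
    by metis
  define W where "W u k = vscale (1 / of_nat P) (\<Sum>s<P. vscale (dft_char P s k) (u s))" for u :: "nat \<Rightarrow> nat \<Rightarrow> complex" and k
  have W: "W u k a = (\<Sum>s<P. 1 / of_nat P * dft_char P s k * u s a)" for u k a
    by (simp add: W_def vscale_def sum_fun_apply sum_distrib_left)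
  define R where "R i = W (\<lambda>s. v s i)" for i
  have parseval: "(\<Sum>k<P. norm2 J (W u k)) = (\<Sum>s<P. norm2 J (u s)) / real P" for J u
    using cv.dft_parseval[OF P, of J u] by (simp add: cv_sq W_def)
  have nX: "(\<Sum>s<P. norm2 {..<d} (v s 0)) / real P = (\<Sum>k<P. norm2 {..<d} (x k))"
  proof -
    have "norm2 {..<d} (v s 0) = norm2 {..<d} (X s)" for s by (rule norm2_cong) (simp add: v)
    then have "(\<Sum>s<P. norm2 {..<d} (v s 0)) / real P = (\<Sum>k<P. norm2 {..<d} (W X k))"
      by (simp add: parseval)
    also have "\<dots> = (\<Sum>k<P. norm2 {..<d} (x k))"
      by (rule sum.cong) (simp_all add: W_def X_def cv.dft_inversion)
    finally show ?thesis .
  qed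
  have "trajectory R"
    unfolding trajectory_def
  proof (intro allI impI)
    fix i k a assume a: "a < N"
    let ?w = "\<lambda>s. 1 / of_nat P * dft_char P s k"
    have "join d (R i k) (R i (Suc k)) = (\<lambda>j. \<Sum>s<P. ?w s * join d (v s i) (\<lambda>j. ?\<zeta> s * v s i j) j)"
      using dft_char_add[of P _ k 1] by (auto simp: join_def R_def W mult_ac)
    then have "mapply N U (join d (R i k) (R i (Suc k))) a = (\<Sum>s<P. ?w s * step (?\<zeta> s) (v s i) a)"
      by (simp only: mapply_sum mapply_scale step_def)
    also have "\<dots> = (\<Sum>s<P. ?w s * join d (v s (Suc i)) (v s i) a)"
      by (intro sum.cong refl) (simp only: solutionsD[OF v(1) a])
    also have "\<dots> = join d (R (Suc i) k) (R i k) a"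
      by (simp add: join_def R_def W)
    finally show "mapply N U (join d (R i k) (R i (Suc k))) a = join d (R (Suc i) k) (R i k) a" .
  qed
  moreover have "R 0 k a = x k a" if "k < P" "a < d" for k a
  proof -
    have "R 0 k a = W X k a" using that by (simp add: R_def W v)
    also have "W X k = x k" using that by (simp add: W_def X_def cv.dft_inversion)
    finally show ?thesis .
  qed
  moreover have "(\<Sum>k<P. norm2 {..<d} (\<lambda>a. \<Sum>s\<in>I. c s * R (e s) (k + f s) a)) \<le> M\<^sup>2 * (\<Sum>k<P. norm2 {..<d} (x k))"
  proof -
    define u where "u t = (\<lambda>a. \<Sum>s\<in>I. (c s * ?\<zeta> t ^ f s) * v t (e s) a)" for t
    have "(\<lambda>a. \<Sum>s\<in>I. c s * R (e s) (k + f s) a) = W u k" for k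
    proof
      fix a
      have "(\<Sum>s\<in>I. c s * R (e s) (k + f s) a)
          = (\<Sum>s\<in>I. \<Sum>t<P. 1 / of_nat P * dft_char P t k * ((c s * ?\<zeta> t ^ f s) * v t (e s) a))"
        unfolding R_def W dft_char_add sum_distrib_left
        by (intro sum.cong refl) (simp only: dft_char_1_power[symmetric] mult_ac)
      also have "\<dots> = (\<Sum>t<P. \<Sum>s\<in>I. 1 / of_nat P * dft_char P t k * ((c s * ?\<zeta> t ^ f s) * v t (e s) a))"
        by (rule sum.swap)
      finally show "(\<Sum>s\<in>I. c s * R (e s) (k + f s) a) = W u k a"
        by (simp only: W u_def sum_distrib_left)
    qed
    then have "(\<Sum>k<P. norm2 {..<d} (\<lambda>a. \<Sum>s\<in>I. c s * R (e s) (k + f s) a)) = (\<Sum>t<P. norm2 {..<d} (u t)) / real P"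
      by (simp add: parseval)
    also have "\<dots> \<le> (\<Sum>t<P. M\<^sup>2 * norm2 {..<d} (v t 0)) / real P"
    proof (intro divide_right_mono sum_mono)
      fix t
      show "norm2 {..<d} (u t) \<le> M\<^sup>2 * norm2 {..<d} (v t 0)"
        unfolding u_def
      proof (rule solutions_functional_calculus_bound[OF _ v(1) I M])
        fix \<kappa> assume "norm \<kappa> = 1" "(\<kappa>, ?\<zeta> t) \<in> curve"
        then have "norm (\<Sum>s\<in>I. c s * \<kappa> ^ e s * ?\<zeta> t ^ f s) \<le> M" by (intro bound) auto
        then show "norm (\<Sum>s\<in>I. c s * ?\<zeta> t ^ f s * \<kappa> ^ e s) \<le> M" by (simp add: mult_ac)
      qed simp
    qed auto
    also have "\<dots> = M\<^sup>2 * ((\<Sum>t<P. norm2 {..<d} (v t 0)) / real P)" by (simp add: sum_distrib_left)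
    finally show ?thesis by (simp only: nX)
  qed
  moreover have "(\<Sum>k<P. norm2 {d..<N} (R i k)) \<le> C * (\<Sum>k<P. norm2 {..<d} (x k))" for i
  proof -
    have "(\<Sum>k<P. norm2 {d..<N} (R i k)) = (\<Sum>s<P. norm2 {d..<N} (v s i)) / real P"
      by (simp add: R_def parseval)
    also have "\<dots> \<le> (\<Sum>s<P. C * norm2 {..<d} (v s 0)) / real P"
    proof (intro divide_right_mono sum_mono)
      fix s
      have "norm2 {d..<N} (v s i) \<le> C * norm2 {..<d} (v s i)"
        by (rule C(2)[of "?\<zeta> s"]) (use solutionsD[OF v(1)] in \<open>auto simp: join_def\<close>)
      then show "norm2 {d..<N} (v s i) \<le> C * norm2 {..<d} (v s 0)"
        using solutions_norm2[OF _ v(1), of s i] by simp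
    qed auto
    also have "\<dots> = C * ((\<Sum>s<P. norm2 {..<d} (v s 0)) / real P)" by (simp add: sum_distrib_left)
    finally show ?thesis by (simp only: nX)
  qed
  ultimately show thesis by (rule that)
qed

lemma trajectory_diff:
  assumes "trajectory R" "trajectory S"
  shows "trajectory (\<lambda>i k a. R i k a - S i k a)"
proof -
  have "join d (\<lambda>a. x a - x' a) (\<lambda>a. y a - y' a) = (\<lambda>j. join d x y j - join d x' y' j)" for x x' y y'
    by (auto simp: join_def)
  then show ?thesis using assms by (simp add: trajectory_def mapply_diff)
qed

text \<open>Energy conservation at each time, summed over the window \<open>k < m\<close>: a run can gain energy only from the
  state that enters the window at time \<open>m\<close>.\<close>

lemma trajectory_energy:
  assumes "trajectory R"
  shows "(\<Sum>k<m. norm2 {..<d} (R i k)) \<le> (\<Sum>k<m. norm2 {..<d} (R 0 k)) + (\<Sum>i'<i. norm2 {d..<N} (R i' m))"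
proof (induction i)
  case (Suc i)
  have "norm2 {..<d} (R i k) + norm2 {d..<N} (R i (Suc k)) = norm2 {..<d} (R (Suc i) k) + norm2 {d..<N} (R i k)" for k
    by (rule io_energy) (use assms in \<open>auto simp: trajectory_def\<close>)
  then have *: "norm2 {..<d} (R (Suc i) k) = norm2 {..<d} (R i k) + (norm2 {d..<N} (R i (Suc k)) - norm2 {d..<N} (R i k))" for k
    by (simp add: algebra_simps)
  have "(\<Sum>k<m. norm2 {..<d} (R (Suc i) k)) = (\<Sum>k<m. norm2 {..<d} (R i k)) + (norm2 {d..<N} (R i m) - norm2 {d..<N} (R i 0))"
    unfolding * sum.distrib sum_lessThan_telescope[of "\<lambda>k. norm2 {d..<N} (R i k)"] ..
  also have "\<dots> \<le> (\<Sum>k<m. norm2 {..<d} (R i k)) + norm2 {d..<N} (R i m)" by simp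
  finally show ?case using Suc by simp
qed simp

end

section \<open>The von Neumann inequality on the curve of a pair\<close>

text \<open>The map \<open>\<phi>\<close> lists the coordinates of a vector for the defect of \<open>b\<close> under \<open>A2\<close>, which are inputs, and
  then those for the defect under \<open>A1\<close>, which are states.\<close>

locale realized_pair = psd_form sc b + colligation N d U
  for sc :: "complex \<Rightarrow> 'v::ab_group_add \<Rightarrow> 'v" and b N d U +
  fixes A1 A2 :: "'v \<Rightarrow> 'v" and \<phi> :: "'v \<Rightarrow> nat \<Rightarrow> complex"
  assumes A1_add: "A1 (x + y) = A1 x + A1 y" and A1_sc: "A1 (sc c x) = sc c (A1 x)"
    and A2_add: "A2 (x + y) = A2 x + A2 y" and A2_sc: "A2 (sc c x) = sc c (A2 x)"
    and A_commute: "A1 (A2 x) = A2 (A1 x)"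
    and \<phi>_add: "\<phi> (x + y) a = \<phi> x a + \<phi> y a" and \<phi>_sc: "\<phi> (sc c x) a = cnj c * \<phi> x a"
    and io: "a < N \<Longrightarrow> mapply N U (join d (\<phi> x) (\<phi> (A2 x))) a = join d (\<phi> (A1 x)) (\<phi> x) a"
    and outer_norm: "norm2 {..<d} (\<phi> x) = sq x - sq (A2 x)"
    and inner_norm: "norm2 {d..<N} (\<phi> x) \<le> sq x"
    and pure: "(\<lambda>k. sq ((A2 ^^ k) x)) \<longlonglongrightarrow> 0"
begin

lemma A2_pow_add: "(A2 ^^ k) (x + y) = (A2 ^^ k) x + (A2 ^^ k) y"
  by (induction k) (auto simp: A2_add)

lemma A2_pow_sc: "(A2 ^^ k) (sc c x) = sc c ((A2 ^^ k) x)"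
  by (induction k) (auto simp: A2_sc)

lemma A1_pow_A2: "(A1 ^^ i) (A2 x) = A2 ((A1 ^^ i) x)"
  by (induction i) (auto simp: A_commute)

lemma A2_pow_A1_pow: "(A2 ^^ k) ((A1 ^^ i) x) = (A1 ^^ i) ((A2 ^^ k) x)"
  by (induction k) (auto simp: A1_pow_A2)

lemma A2_0: "A2 0 = 0" using A2_add[of 0 0] by simp

lemma \<phi>_0: "\<phi> 0 a = 0" using \<phi>_add[of 0 0 a] by simp

lemma sq_A2: "sq (A2 x) \<le> sq x"
  using outer_norm[of x] norm2_nonneg[of "{..<d}" "\<phi> x"] by linarith

lemma sq_A2_pow_antimono: "m \<le> n \<Longrightarrow> sq ((A2 ^^ n) x) \<le> sq ((A2 ^^ m) x)"
  by (induction n rule: dec_induct) (auto intro: order_trans sq_A2)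

lemma outer_norm_sum: "(\<Sum>k<m. norm2 {..<d} (\<phi> ((A2 ^^ k) x))) = sq x - sq ((A2 ^^ m) x)"
  by (induction m) (auto simp: outer_norm)

lemma sq_le_of_partial_sums:
  assumes "\<And>m. (\<Sum>k<m. norm2 {..<d} (\<phi> ((A2 ^^ k) x))) \<le> B"
  shows "sq x \<le> B"
proof (rule LIMSEQ_le_const2)
  show "(\<lambda>m. sq x - sq ((A2 ^^ m) x)) \<longlonglongrightarrow> sq x"
    using tendsto_diff[OF tendsto_const pure, of "sq x" x] by simp
  show "\<exists>N. \<forall>n\<ge>N. sq x - sq ((A2 ^^ n) x) \<le> B"
    using assms by (simp add: outer_norm_sum)
qed

text \<open>The orbit of \<open>h\<close> gives a trajectory, but on an infinite time axis. It is compared with the periodic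
  trajectory of period \<open>2 (K + 1)\<close> whose input is the orbit truncated after \<open>K + 1\<close> terms. The difference
  is a trajectory whose input vanishes up to time \<open>K\<close> and has small energy after that. Its energy in a
  window that ends at \<open>m\<close> is controlled by the states at time \<open>m\<close>: the true ones are small for large
  \<open>m\<close> by purity, and the total energy of the periodic ones is bounded independently of \<open>K\<close>, so that
  they are small for some \<open>m\<close> in the second half of the period.\<close>

lemma approximation:
  assumes I: "finite I" and M: "0 \<le> M"
    and bound: "\<And>\<kappa> \<zeta>. norm \<kappa> = 1 \<Longrightarrow> norm \<zeta> = 1 \<Longrightarrow> (\<kappa>, \<zeta>) \<in> curve \<Longrightarrow>
        norm (\<Sum>s\<in>I. c s * \<kappa> ^ e s * \<zeta> ^ f s) \<le> M"
  obtains R where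
    "\<And>i k a. i \<le> n \<Longrightarrow> a < d \<Longrightarrow> (\<lambda>K. R K i k a) \<longlonglongrightarrow> \<phi> ((A1 ^^ i) ((A2 ^^ k) h)) a"
    "\<And>m. \<forall>\<^sub>F K in sequentially. (\<Sum>k<m. norm2 {..<d} (\<lambda>a. \<Sum>s\<in>I. c s * R K (e s) (k + f s) a)) \<le> M\<^sup>2 * sq h"
proof -
  define V where "V i k = \<phi> ((A1 ^^ i) ((A2 ^^ k) h))" for i k
  have V: "trajectory V"
    unfolding trajectory_def V_def using io by (simp add: A1_pow_A2)
  obtain C where C: "C \<ge> 0" "\<And>\<zeta> x. norm \<zeta> = 1 \<Longrightarrow> (\<And>a. d \<le> a \<Longrightarrow> a < N \<Longrightarrow> step \<zeta> x a = x a) \<Longrightarrow>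
      norm2 {d..<N} x \<le> C * norm2 {..<d} x"
    using inner_state_bound by blast
  define x where "x K k = (if k < K then V 0 k else (\<lambda>_. 0))" for K k
  have nx: "(\<Sum>k<2 * Suc K. norm2 {..<d} (x (Suc K) k)) \<le> sq h" for K
  proof -
    have "(\<Sum>k<2 * Suc K. norm2 {..<d} (x (Suc K) k)) = (\<Sum>k<Suc K. norm2 {..<d} (V 0 k))"
      by (rule sum.mono_neutral_cong_right) (auto simp: x_def norm2_def)
    also have "\<dots> = sq h - sq ((A2 ^^ Suc K) h)"
      using outer_norm_sum[of h "Suc K"] by (simp only: V_def funpow_0)
    finally show ?thesis by simp
  qed
  define good where "good K R \<longleftrightarrow> trajectory R \<and> (\<forall>k<2 * Suc K. \<forall>a<d. R 0 k a = x (Suc K) k a) \<and>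
    (\<Sum>k<2 * Suc K. norm2 {..<d} (\<lambda>a. \<Sum>s\<in>I. c s * R (e s) (k + f s) a)) \<le> M\<^sup>2 * sq h \<and>
    (\<forall>i. (\<Sum>k<2 * Suc K. norm2 {d..<N} (R i k)) \<le> C * sq h)" for K R
  have "\<exists>R. good K R" for K
  proof -
    have P: "2 * Suc K > 0" by simp
    show ?thesis
    proof (rule periodic_trajectory[OF P I M bound C])
      fix R
      let ?S = "\<Sum>k<2 * Suc K. norm2 {..<d} (x (Suc K) k)"
      assume R: "trajectory R" "\<And>k a. k < 2 * Suc K \<Longrightarrow> a < d \<Longrightarrow> R 0 k a = x (Suc K) k a"
        "(\<Sum>k<2 * Suc K. norm2 {..<d} (\<lambda>a. \<Sum>s\<in>I. c s * R (e s) (k + f s) a)) \<le> M\<^sup>2 * ?S"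
        "\<And>i. (\<Sum>k<2 * Suc K. norm2 {d..<N} (R i k)) \<le> C * ?S"
      have "M\<^sup>2 * ?S \<le> M\<^sup>2 * sq h" by (rule mult_left_mono[OF nx]) simp
      moreover have "C * ?S \<le> C * sq h" by (rule mult_left_mono[OF nx C(1)])
      ultimately show ?thesis
        unfolding good_def
        by (intro exI[of _ R] conjI allI impI R(1,2) order_trans[OF R(3)] order_trans[OF R(4)])
    qed
  qed
  then obtain R where good: "\<And>K. good K (R K)" by metis
  have R: "\<And>K. trajectory (R K)"
    "\<And>K k a. k < 2 * Suc K \<Longrightarrow> a < d \<Longrightarrow> R K 0 k a = x (Suc K) k a"
    "\<And>K. (\<Sum>k<2 * Suc K. norm2 {..<d} (\<lambda>a. \<Sum>s\<in>I. c s * R K (e s) (k + f s) a)) \<le> M\<^sup>2 * sq h"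
    "\<And>K i. (\<Sum>k<2 * Suc K. norm2 {d..<N} (R K i k)) \<le> C * sq h"
    using good unfolding good_def by blast+
  define \<epsilon> where "\<epsilon> K = sq ((A2 ^^ Suc K) h) + (\<Sum>i<n. 2 * sq ((A2 ^^ Suc K) ((A1 ^^ i) h)))
      + 2 * (real n * (C * sq h) / real (Suc K))" for K
  have err: "norm2 {..<d} (\<lambda>a. V i k a - R K i k a) \<le> \<epsilon> K" if i: "i \<le> n" and k: "k \<le> K" for i k K
  proof -
    define y where "y m = (\<Sum>i<n. norm2 {d..<N} (R K i m))" for m
    \<comment> \<open>By averaging, some time in the second half of the period has small states.\<close>
    have "\<exists>m\<in>{Suc K..<2 * Suc K}. y m \<le> real n * (C * sq h) / real (Suc K)"
    proof (rule ccontr)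
      assume "\<not> ?thesis"
      then have "real n * (C * sq h) / real (Suc K) < y m" if "m \<in> {Suc K..<2 * Suc K}" for m
        using that by (auto simp: not_le)
      then have "(\<Sum>m\<in>{Suc K..<2 * Suc K}. real n * (C * sq h) / real (Suc K)) < (\<Sum>m\<in>{Suc K..<2 * Suc K}. y m)"
        by (intro sum_strict_mono) auto
      moreover have "(\<Sum>m\<in>{Suc K..<2 * Suc K}. real n * (C * sq h) / real (Suc K)) = real n * (C * sq h)"
        by (simp del: of_nat_Suc)
      moreover have "(\<Sum>m\<in>{Suc K..<2 * Suc K}. y m) \<le> (\<Sum>m<2 * Suc K. y m)"
        by (rule sum_mono2) (auto simp: y_def intro: sum_nonneg)
      moreover have "(\<Sum>m<2 * Suc K. y m) \<le> (\<Sum>i<n. C * sq h)"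
        unfolding y_def by (subst sum.swap) (intro sum_mono R(4))
      ultimately show False by simp
    qed
    then obtain m where m: "Suc K \<le> m" "m < 2 * Suc K" "y m \<le> real n * (C * sq h) / real (Suc K)" by auto
    let ?E = "\<lambda>i k a. V i k a - R K i k a"
    have E: "trajectory ?E" by (rule trajectory_diff[OF V R(1)])
    have "norm2 {..<d} (?E i k) \<le> (\<Sum>k<m. norm2 {..<d} (?E i k))"
      by (rule member_le_sum) (use k m in auto)
    also have "\<dots> \<le> (\<Sum>k<m. norm2 {..<d} (?E 0 k)) + (\<Sum>i'<i. norm2 {d..<N} (?E i' m))"
      by (rule trajectory_energy[OF E])
    also have "(\<Sum>k<m. norm2 {..<d} (?E 0 k)) \<le> sq ((A2 ^^ Suc K) h)"
    proof -
      have "(\<Sum>k<m. norm2 {..<d} (?E 0 k)) = (\<Sum>k\<in>{Suc K..<m}. norm2 {..<d} (V 0 k))"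
      proof (rule sum.mono_neutral_cong_right)
        show "\<forall>k\<in>{..<m} - {Suc K..<m}. norm2 {..<d} (?E 0 k) = 0"
        proof
          fix k assume "k \<in> {..<m} - {Suc K..<m}"
          then have "k < Suc K" "k < 2 * Suc K" by auto
          then show "norm2 {..<d} (?E 0 k) = 0" by (simp add: norm2_eq_0_iff R(2) x_def)
        qed
        show "norm2 {..<d} (?E 0 k) = norm2 {..<d} (V 0 k)" if "k \<in> {Suc K..<m}" for k
          by (rule norm2_cong) (use that m(2) in \<open>simp add: R(2) x_def\<close>)
      qed auto
      also have "\<dots> = (\<Sum>k\<in>{..<m} - {..<Suc K}. norm2 {..<d} (V 0 k))"
        by (rule sum.cong) auto
      also have "\<dots> = (\<Sum>k<m. norm2 {..<d} (V 0 k)) - (\<Sum>k<Suc K. norm2 {..<d} (V 0 k))"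
        by (rule sum_diff) (use m(1) in auto)
      also have "\<dots> = sq ((A2 ^^ Suc K) h) - sq ((A2 ^^ m) h)"
        using outer_norm_sum[of h m] outer_norm_sum[of h "Suc K"] by (simp only: V_def funpow_0)
      finally show ?thesis by simp
    qed
    also have "(\<Sum>i'<i. norm2 {d..<N} (?E i' m)) \<le> (\<Sum>i'<n. norm2 {d..<N} (?E i' m))"
      by (rule sum_mono2) (use i in auto)
    also have "\<dots> \<le> (\<Sum>i'<n. 2 * sq ((A2 ^^ Suc K) ((A1 ^^ i') h)) + 2 * norm2 {d..<N} (R K i' m))"
    proof (rule sum_mono)
      fix i'
      have "norm2 {d..<N} (?E i' m) \<le> 2 * norm2 {d..<N} (V i' m) + 2 * norm2 {d..<N} (R K i' m)"
        by (rule norm2_diff_le)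
      moreover have "norm2 {d..<N} (V i' m) \<le> sq ((A2 ^^ m) ((A1 ^^ i') h))"
        unfolding V_def A2_pow_A1_pow by (rule inner_norm)
      moreover have "\<dots> \<le> sq ((A2 ^^ Suc K) ((A1 ^^ i') h))" by (rule sq_A2_pow_antimono[OF m(1)])
      ultimately show "norm2 {d..<N} (?E i' m) \<le> 2 * sq ((A2 ^^ Suc K) ((A1 ^^ i') h)) + 2 * norm2 {d..<N} (R K i' m)"
        by linarith
    qed
    also have "\<dots> = (\<Sum>i'<n. 2 * sq ((A2 ^^ Suc K) ((A1 ^^ i') h))) + 2 * y m"
      by (simp add: sum.distrib y_def sum_distrib_left)
    finally show ?thesis using m(3) unfolding \<epsilon>_def by linarith
  qed
  have "\<epsilon> \<longlonglongrightarrow> 0 + (\<Sum>i<n. 2 * 0) + 2 * 0"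
  proof -
    have 1: "(\<lambda>K. sq ((A2 ^^ Suc K) x)) \<longlonglongrightarrow> 0" for x
      using pure[of x] by (rule LIMSEQ_Suc)
    have 2: "(\<lambda>K. real n * (C * sq h) / real (Suc K)) \<longlonglongrightarrow> 0"
      using LIMSEQ_Suc[OF lim_const_over_n[of "real n * (C * sq h)"]] by simp
    show ?thesis
      unfolding \<epsilon>_def by (intro tendsto_add tendsto_sum tendsto_mult tendsto_const 1 2)
  qed
  then have \<epsilon>: "(\<lambda>K. sqrt (\<epsilon> K)) \<longlonglongrightarrow> 0" using tendsto_real_sqrt by fastforce
  have "(\<lambda>K. R K i k a) \<longlonglongrightarrow> \<phi> ((A1 ^^ i) ((A2 ^^ k) h)) a" if i: "i \<le> n" and a: "a < d" for i k a
  proof (rule Lim_transform_bound[THEN Lim_null[THEN iffD2]])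
    show "\<forall>\<^sub>F K in sequentially. norm (R K i k a - \<phi> ((A1 ^^ i) ((A2 ^^ k) h)) a) \<le> norm (sqrt (\<epsilon> K))"
      using eventually_ge_at_top[of k]
    proof eventually_elim
      case (elim K)
      have "(norm (V i k a - R K i k a))\<^sup>2 \<le> norm2 {..<d} (\<lambda>a. V i k a - R K i k a)"
        unfolding norm2_def by (rule member_le_sum) (use a in auto)
      also have "\<dots> \<le> \<epsilon> K" by (rule err[OF i elim])
      finally have "norm (V i k a - R K i k a) \<le> sqrt (\<epsilon> K)" by (rule real_le_rsqrt)
      then show ?case by (simp add: V_def norm_minus_commute)
    qed
  qed (rule \<epsilon>)
  moreover have "\<forall>\<^sub>F K in sequentially. (\<Sum>k<m. norm2 {..<d} (\<lambda>a. \<Sum>s\<in>I. c s * R K (e s) (k + f s) a)) \<le> M\<^sup>2 * sq h" for m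
    using eventually_ge_at_top[of m]
  proof eventually_elim
    case (elim K)
    have "(\<Sum>k<m. norm2 {..<d} (\<lambda>a. \<Sum>s\<in>I. c s * R K (e s) (k + f s) a))
        \<le> (\<Sum>k<2 * Suc K. norm2 {..<d} (\<lambda>a. \<Sum>s\<in>I. c s * R K (e s) (k + f s) a))"
      by (rule sum_mono2) (use elim in auto)
    then show ?case using R(3)[of K] by linarith
  qed
  ultimately show thesis by (rule that)
qed

text \<open>The approximating trajectories satisfy the inequality at each finite number of times, hence so does
  their limit; by purity the defects along the orbit add up to the square.\<close>

theorem pair_bound:
  assumes I: "finite I" and M: "0 \<le> M"
    and bound: "\<And>\<kappa> \<zeta>. norm \<kappa> = 1 \<Longrightarrow> norm \<zeta> = 1 \<Longrightarrow> (\<kappa>, \<zeta>) \<in> curve \<Longrightarrow>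
        norm (\<Sum>s\<in>I. c s * \<kappa> ^ e s * \<zeta> ^ f s) \<le> M"
  shows "sq (\<Sum>s\<in>I. sc (cnj (c s)) ((A1 ^^ e s) ((A2 ^^ f s) h))) \<le> M\<^sup>2 * sq h"
proof (rule sq_le_of_partial_sums)
  fix m
  let ?g = "\<Sum>s\<in>I. sc (cnj (c s)) ((A1 ^^ e s) ((A2 ^^ f s) h))"
  define n where "n = (\<Sum>s\<in>I. e s)"
  have n: "e s \<le> n" if "s \<in> I" for s
    unfolding n_def by (rule member_le_sum) (use that I in auto)
  obtain R where R:
    "\<And>i k a. i \<le> n \<Longrightarrow> a < d \<Longrightarrow> (\<lambda>K. R K i k a) \<longlonglongrightarrow> \<phi> ((A1 ^^ i) ((A2 ^^ k) h)) a"
    "\<And>m. \<forall>\<^sub>F K in sequentially. (\<Sum>k<m. norm2 {..<d} (\<lambda>a. \<Sum>s\<in>I. c s * R K (e s) (k + f s) a)) \<le> M\<^sup>2 * sq h"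
    using approximation[OF I M bound, where n = n and h = h] by blast
  have \<phi>: "\<phi> ((A2 ^^ k) ?g) a = (\<Sum>s\<in>I. c s * \<phi> ((A1 ^^ e s) ((A2 ^^ (k + f s)) h)) a)" for k a
  proof -
    have "(A2 ^^ k) 0 = 0" by (induction k) (auto simp: A2_0)
    then have "\<phi> ((A2 ^^ k) (\<Sum>s\<in>S. sc (cnj (c s)) (u s))) a = (\<Sum>s\<in>S. c s * \<phi> ((A2 ^^ k) (u s)) a)" for S u
      by (induction S rule: infinite_finite_induct) (auto simp: \<phi>_0 \<phi>_add \<phi>_sc A2_pow_add A2_pow_sc)
    then show ?thesis by (simp add: A2_pow_A1_pow funpow_add)
  qed
  have "(\<lambda>K. \<Sum>k<m. norm2 {..<d} (\<lambda>a. \<Sum>s\<in>I. c s * R K (e s) (k + f s) a)) \<longlonglongrightarrow>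
        (\<Sum>k<m. norm2 {..<d} (\<phi> ((A2 ^^ k) ?g)))"
    unfolding norm2_def \<phi> by (intro tendsto_intros R(1) n) auto
  then show "(\<Sum>k<m. norm2 {..<d} (\<phi> ((A2 ^^ k) ?g))) \<le> M\<^sup>2 * sq h"
    by (rule tendsto_upperbound[OF _ R(2)]) simp
qed

end


section \<open>Adjoints\<close>

interpretation H: psd_form scaleC cinner
proof
  show "cinner x y = cnj (cinner y x)" for x y :: 'a by (rule cinner_commute)
qed (simp_all add: cinner_add_left cinner_scaleC_left cinner_self)

lemma H_sq: "H.sq x = (norm x)\<^sup>2"
  by (simp add: H.sq_def cinner_self)

lemma norm_cinner_le: "norm (cinner x y) \<le> norm x * norm y"
proof (rule power2_le_imp_le)
  show "(norm (cinner x y))\<^sup>2 \<le> (norm x * norm y)\<^sup>2"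
    using H.cauchy_schwarz[of x y] by (simp add: H_sq power_mult_distrib)
qed simp

lemma norm2_add: "(norm (x + y))\<^sup>2 = (norm x)\<^sup>2 + 2 * Re (cinner x y) + (norm y)\<^sup>2" for x :: "'h::chilbert_space"
proof -
  have "Re (cinner (x + y) (x + y)) = Re (cinner x x) + (Re (cinner x y) + Re (cinner y x)) + Re (cinner y y)"
    by (simp add: H.linear_simps)
  moreover have "Re (cinner y x) = Re (cinner x y)" using cinner_commute[of y x] by simp
  ultimately show ?thesis by (simp add: cinner_self)
qed

text \<open>The representing vector minimizes \<open>(norm x)\<^sup>2 - 2 * Re (f x)\<close>; a minimizing sequence is Cauchy by the
  parallelogram law.\<close>

lemma riesz_representation:
  fixes f :: "'h::chilbert_space \<Rightarrow> complex"
  assumes add: "\<And>x y. f (x + y) = f x + f y" and sc: "\<And>c x. f (scaleC c x) = c * f x"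
    and bnd: "\<And>x. norm (f x) \<le> K * norm x"
  obtains z where "\<And>x. f x = cinner x z"
proof -
  define F where "F x = (norm x)\<^sup>2 - 2 * Re (f x)" for x
  have real: "f (r *\<^sub>R x) = of_real r * f x" for r x
    using sc[of "of_real r" x] by (simp add: scaleC_of_real)
  have diff: "f (x - y) = f x - f y" for x y
    using add[of "x - y" y] by simp
  have lower: "- K\<^sup>2 \<le> F x" for x
  proof -
    have "Re (f x) \<le> K * norm x" using complex_Re_le_cmod[of "f x"] bnd[of x] by linarith
    moreover have "0 \<le> (norm x - K)\<^sup>2" by simp
    ultimately show ?thesis by (simp add: F_def power2_diff mult_ac)
  qed
  define m where "m = Inf (range F)"
  have bdd: "bdd_below (range F)" by (rule bdd_belowI2[of _ "- K\<^sup>2"]) (rule lower)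
  have mF: "m \<le> F x" for x unfolding m_def by (rule cInf_lower[OF _ bdd]) simp
  have "\<exists>x. F x < m + 1 / real (Suc n)" for n
  proof -
    have "Inf (range F) < m + 1 / real (Suc n)" by (simp add: m_def)
    then show ?thesis using cInf_less_iff[of "range F" "m + 1 / real (Suc n)"] bdd by auto
  qed
  then obtain X where X: "\<And>n. F (X n) < m + 1 / real (Suc n)" by metis
  have par: "(norm (x - y))\<^sup>2 \<le> 2 * (F x + F y - 2 * m)" for x y
  proof -
    let ?a = "(1 / 2) *\<^sub>R (x + y)"
    have "4 * (norm ?a)\<^sup>2 = (norm (x + y))\<^sup>2" by (simp add: power2_eq_square)
    moreover have "(norm (x + y))\<^sup>2 + (norm (x - y))\<^sup>2 = 2 * (norm x)\<^sup>2 + 2 * (norm y)\<^sup>2"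
      using norm2_add[of x y] norm2_add[of x "- y"] by (simp add: H.minus_right)
    moreover have "2 * Re (f ?a) = Re (f x) + Re (f y)" by (simp add: real add)
    moreover have "m \<le> F ?a" by (rule mF)
    ultimately show ?thesis unfolding F_def by (simp add: algebra_simps)
  qed
  have "Cauchy X"
  proof (rule metric_CauchyI)
    fix e :: real assume e: "e > 0"
    obtain n0 where n0: "1 / real (Suc n0) < e\<^sup>2 / 4" using e
      by (meson nat_approx_posE zero_less_divide_iff zero_less_numeral zero_less_power)
    have "dist (X i) (X j) < e" if "i \<ge> n0" "j \<ge> n0" for i j
    proof -
      have mono: "1 / real (Suc k) \<le> 1 / real (Suc n0)" if "k \<ge> n0" for k
        using that by (simp add: frac_le)
      have "(norm (X i - X j))\<^sup>2 \<le> 2 * (F (X i) + F (X j) - 2 * m)" by (rule par)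
      also have "\<dots> < 2 * (1 / real (Suc i) + 1 / real (Suc j))" using X[of i] X[of j] by simp
      also have "\<dots> \<le> 2 * (1 / real (Suc n0) + 1 / real (Suc n0))"
        by (intro mult_left_mono add_mono mono that) simp
      also have "\<dots> = 4 * (1 / real (Suc n0))" by simp
      also have "\<dots> < e\<^sup>2" using n0 by simp
      finally have "norm (X i - X j) < e" by (rule power2_less_imp_less) (use e in simp)
      then show ?thesis by (simp add: dist_norm)
    qed
    then show "\<exists>M. \<forall>m\<ge>M. \<forall>n\<ge>M. dist (X m) (X n) < e"
      by (intro exI[of _ n0]) simp
  qed
  then obtain z where z: "X \<longlonglongrightarrow> z" using Cauchy_convergent convergent_def by blast
  have "(\<lambda>n. f (X n)) \<longlonglongrightarrow> f z"
  proof (rule Lim_transform_bound[THEN Lim_null[THEN iffD2]])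
    show "\<forall>\<^sub>F n in sequentially. norm (f (X n) - f z) \<le> norm (K * norm (X n - z))"
      using bnd by (intro always_eventually allI) (metis diff abs_ge_self order_trans real_norm_def)
    show "(\<lambda>n. K * norm (X n - z)) \<longlonglongrightarrow> 0"
      using tendsto_mult[OF tendsto_const[of K] tendsto_norm[OF z[THEN Lim_null[THEN iffD1]]]] by simp
  qed
  then have "(\<lambda>n. F (X n)) \<longlonglongrightarrow> F z"
    unfolding F_def by (intro tendsto_intros z)
  moreover have "(\<lambda>n. m + 1 / real (Suc n)) \<longlonglongrightarrow> m + 0"
    by (intro tendsto_add tendsto_const LIMSEQ_Suc[OF lim_const_over_n])
  ultimately have "F z \<le> m + 0"
    by (rule LIMSEQ_le) (use X less_imp_le in blast)
  then have Fz: "F z \<le> F x" for x using mF[of x] by simp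
  have Re: "Re (f x) = Re (cinner x z)" for x
  proof (rule ccontr)
    assume ne: "Re (f x) \<noteq> Re (cinner x z)"
    define s where "s = Re (cinner x z) - Re (f x)"
    have s: "s \<noteq> 0" using ne by (simp add: s_def)
    have key: "0 \<le> 2 * t * s + t\<^sup>2 * (norm x)\<^sup>2" for t
    proof -
      have c: "cinner z (t *\<^sub>R x) = of_real t * cinner z x"
        using H.sc_right[of z "of_real t" x] by (simp add: scaleC_of_real)
      have r: "Re (cinner z x) = Re (cinner x z)" using cinner_commute[of z x] by simp
      have "F (z + t *\<^sub>R x) = F z + 2 * t * s + t\<^sup>2 * (norm x)\<^sup>2"
        unfolding F_def norm2_add c by (simp add: add real r s_def algebra_simps power_mult_distrib)
      then show ?thesis using Fz[of "z + t *\<^sub>R x"] by simp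
    qed
    have x: "norm x > 0"
    proof (rule ccontr)
      assume "\<not> norm x > 0"
      then show False using key[of "- s"] s by (simp add: not_sum_power2_lt_zero power2_eq_square mult_less_0_iff)
          (metis mult_eq_0_iff not_square_less_zero order_le_less)
    qed
    have "2 * (- s / (norm x)\<^sup>2) * s + (- s / (norm x)\<^sup>2)\<^sup>2 * (norm x)\<^sup>2 = - (s\<^sup>2 / (norm x)\<^sup>2)"
      using x by (simp add: power2_eq_square field_simps)
    moreover have "s\<^sup>2 / (norm x)\<^sup>2 > 0" using s x by simp
    ultimately show False using key[of "- s / (norm x)\<^sup>2"] by linarith
  qed
  have "f x = cinner x z" for x
  proof (rule complex_eqI)
    show "Re (f x) = Re (cinner x z)" by (rule Re)
    have "Re (f (scaleC \<i> x)) = Re (cinner (scaleC \<i> x) z)" by (rule Re)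
    then show "Im (f x) = Im (cinner x z)" by (simp add: sc cinner_scaleC_left)
  qed
  then show thesis by (rule that)
qed

lemma cinner_ext: "(\<And>x. cinner x y = cinner x z) \<Longrightarrow> y = z"
proof -
  assume "\<And>x. cinner x y = cinner x z"
  then have "cinner (y - z) (y - z) = 0" by (simp add: H.diff_right)
  then show "y = z" by (simp add: cinner_self)
qed

lemma bounded_clinear_add: "bounded_clinear A \<Longrightarrow> A (x + y) = A x + A y"
  by (simp add: bounded_clinear_def linear_simps bounded_linear.linear linear_add)

lemma bounded_clinear_scaleC: "bounded_clinear A \<Longrightarrow> A (scaleC c x) = scaleC c (A x)"
  by (simp add: bounded_clinear_def)

lemma cadjoint:
  assumes A: "bounded_clinear A"
  shows "cinner (A x) y = cinner x (cadjoint A y)"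
proof -
  have bl: "bounded_linear A" using A by (simp add: bounded_clinear_def)
  have "\<exists>z. \<forall>x. cinner (A x) y = cinner x z" for y
  proof -
    have "norm (cinner (A x) y) \<le> onorm A * norm y * norm x" for x
    proof -
      have "norm (cinner (A x) y) \<le> norm (A x) * norm y" by (rule norm_cinner_le)
      also have "\<dots> \<le> onorm A * norm x * norm y" by (intro mult_right_mono onorm[OF bl]) auto
      finally show ?thesis by (simp add: mult_ac)
    qed
    then show ?thesis
      using riesz_representation[of "\<lambda>x. cinner (A x) y" "onorm A * norm y"]
      by (metis A H.add_left H.sc_left bounded_clinear_add bounded_clinear_scaleC)
  qed
  then obtain B where B: "\<forall>x y. cinner (A x) y = cinner x (B y)" by metis
  have "cadjoint A = B"
    unfolding cadjoint_def
  proof (rule the_equality)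
    show "\<forall>x y. cinner (A x) y = cinner x (B y)" by (rule B)
    fix B' assume "\<forall>x y. cinner (A x) y = cinner x (B' y)"
    then show "B' = B" using B by (intro ext cinner_ext) metis
  qed
  then show ?thesis using B by simp
qed

lemma cadjoint_add:
  assumes "bounded_clinear A" shows "cadjoint A (x + y) = cadjoint A x + cadjoint A y"
  by (rule cinner_ext) (simp add: cadjoint[OF assms, symmetric] H.add_right)

lemma cadjoint_scaleC:
  assumes "bounded_clinear A" shows "cadjoint A (scaleC c x) = scaleC c (cadjoint A x)"
  by (rule cinner_ext) (simp add: cadjoint[OF assms, symmetric] H.sc_right)

lemma cadjoint_commute:
  assumes "bounded_clinear A" "bounded_clinear B" "A \<circ> B = B \<circ> A"
  shows "cadjoint A (cadjoint B x) = cadjoint B (cadjoint A x)"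
proof (rule cinner_ext)
  fix y
  have "cinner y (cadjoint A (cadjoint B x)) = cinner ((B \<circ> A) y) x" by (simp add: cadjoint assms(1,2))
  also have "\<dots> = cinner ((A \<circ> B) y) x" by (simp add: assms)
  also have "\<dots> = cinner y (cadjoint B (cadjoint A x))" by (simp add: cadjoint assms(1,2))
  finally show "cinner y (cadjoint A (cadjoint B x)) = cinner y (cadjoint B (cadjoint A x))" .
qed

lemma norm_contraction_le:
  assumes "contraction A" shows "norm (A x) \<le> norm x"
proof -
  have "norm (A x) \<le> onorm A * norm x"
    using assms by (intro onorm) (simp add: contraction_def bounded_clinear_def)
  also have "\<dots> \<le> 1 * norm x" using assms by (intro mult_right_mono) (auto simp: contraction_def)
  finally show ?thesis by simp
qed

lemma norm_cadjoint_le: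
  assumes "contraction A" shows "norm (cadjoint A y) \<le> norm y"
proof -
  have A: "bounded_clinear A" using assms by (simp add: contraction_def)
  let ?z = "cadjoint A y"
  have "(norm ?z)\<^sup>2 = norm (cinner (A ?z) y)"
    by (simp add: cadjoint[OF A] cinner_self norm_power)
  also have "\<dots> \<le> norm (A ?z) * norm y" by (rule norm_cinner_le)
  also have "\<dots> \<le> norm ?z * norm y" by (intro mult_right_mono norm_contraction_le assms) auto
  finally have "norm ?z * norm ?z \<le> norm ?z * norm y" by (simp add: power2_eq_square)
  then show ?thesis by (cases "norm ?z = 0") auto
qed


section \<open>Defect forms of commuting tuples\<close>

lemma tuple_power_cong:
  assumes "\<And>i. 1 \<le> i \<Longrightarrow> i \<le> m \<Longrightarrow> A i = A' i" "\<And>i. 1 \<le> i \<Longrightarrow> i \<le> m \<Longrightarrow> k i = k' i"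
  shows "tuple_power m A k = tuple_power m A' k'"
  using assms by (induction m) auto

lemma funpow_commute:
  assumes "\<And>x. g (A x) = A (g x)"
  shows "g ((A ^^ r) x) = (A ^^ r) (g x)"
  by (induction r) (auto simp: assms)

lemma tuple_power_commute:
  assumes "\<And>i x. 1 \<le> i \<Longrightarrow> i \<le> m \<Longrightarrow> g (A i x) = A i (g x)"
  shows "g (tuple_power m A k x) = tuple_power m A k (g x)"
  using assms
proof (induction m arbitrary: x)
  case (Suc m)
  have "g (tuple_power m A k ((A (Suc m) ^^ k (Suc m)) x)) = tuple_power m A k (g ((A (Suc m) ^^ k (Suc m)) x))"
    by (rule Suc.IH) (use Suc.prems in auto)
  also have "g ((A (Suc m) ^^ k (Suc m)) x) = (A (Suc m) ^^ k (Suc m)) (g x)"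
    by (rule funpow_commute) (use Suc.prems in auto)
  finally show ?case by simp
qed simp

lemma tuple_power_extract:
  assumes comm: "\<And>i j x. 1 \<le> i \<Longrightarrow> i \<le> n \<Longrightarrow> 1 \<le> j \<Longrightarrow> j \<le> n \<Longrightarrow> C i (C j x) = C j (C i x)"
    and i: "1 \<le> i" "i \<le> n"
  shows "tuple_power n C k x = (C i ^^ k i) (tuple_power n (C(i := id)) k x)"
  using comm i
proof (induction n arbitrary: x)
  case (Suc n)
  show ?case
  proof (cases "i = Suc n")
    case True
    have "tuple_power n C k (C i x) = C i (tuple_power n C k x)" for x
      by (rule tuple_power_commute[symmetric]) (use Suc.prems in auto)
    then have "tuple_power n C k ((C i ^^ k i) x) = (C i ^^ k i) (tuple_power n C k x)"
      by (rule funpow_commute)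
    moreover have "tuple_power n (C(i := id)) k = tuple_power n C k"
      by (rule tuple_power_cong) (use True in auto)
    moreover have "(id ^^ r) x = x" for r by (induction r) auto
    ultimately show ?thesis using True by (simp only: tuple_power.simps o_apply fun_upd_same)
  next
    case False
    then show ?thesis using Suc by simp
  qed
qed simp

definition clinear_op :: "('h::chilbert_space \<Rightarrow> 'h) \<Rightarrow> bool" where
  "clinear_op A \<longleftrightarrow> (\<forall>x y. A (x + y) = A x + A y) \<and> (\<forall>c x. A (scaleC c x) = scaleC c (A x))"

lemma clinear_op_add: "clinear_op A \<Longrightarrow> A (x + y) = A x + A y"
  and clinear_op_scaleC: "clinear_op A \<Longrightarrow> A (scaleC c x) = scaleC c (A x)"
  by (auto simp: clinear_op_def)

lemma clinear_op_funpow: "clinear_op A \<Longrightarrow> clinear_op (A ^^ r)"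
  by (induction r) (auto simp: clinear_op_def)

lemma clinear_op_scale: "clinear_op (scaleC c)"
  by (simp add: clinear_op_def scaleC_add_right scaleC_scaleC mult.commute)

lemma clinear_op_tuple_power:
  assumes "\<And>i. 1 \<le> i \<Longrightarrow> i \<le> m \<Longrightarrow> clinear_op (A i)"
  shows "clinear_op (tuple_power m A k)"
  using assms
proof (induction m)
  case (Suc m)
  then have "clinear_op (tuple_power m A k)" "clinear_op (A (Suc m) ^^ k (Suc m))"
    by (auto intro: clinear_op_funpow)
  then show ?case by (auto simp: clinear_op_def)
qed (simp add: clinear_op_def)

lemma scaleC_funpow: "(scaleC c ^^ r) x = scaleC (c ^ r) x"
  by (induction r) (auto simp: scaleC_scaleC)

text \<open>This is the sesquilinear form of \<open>szego_inverse m T\<close> when \<open>A\<close> is the tuple of adjoints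
  (\<open>cinner_szego_inverse\<close> below). The recursion is the difference equation by which positivity and norm
  bounds pass between tuples of different length.\<close>

primrec dform :: "nat \<Rightarrow> (nat \<Rightarrow> 'h \<Rightarrow> 'h) \<Rightarrow> 'h \<Rightarrow> 'h::chilbert_space \<Rightarrow> complex" where
  "dform 0 A x y = cinner x y"
| "dform (Suc m) A x y = dform m A x y - dform m A (A (Suc m) x) (A (Suc m) y)"

lemma dform_cong:
  assumes "\<And>i. 1 \<le> i \<Longrightarrow> i \<le> m \<Longrightarrow> A i = A' i"
  shows "dform m A x y = dform m A' x y"
  using assms by (induction m arbitrary: x y) auto

text \<open>The recursion removes the last operator; commutativity allows the first one to be removed instead. The two
  tuples of the theorem differ in their first operator only.\<close>

lemma dform_Suc_shift:
  assumes "\<And>i x. 1 \<le> i \<Longrightarrow> i \<le> Suc m \<Longrightarrow> A 1 (A i x) = A i (A 1 x)"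
  shows "dform (Suc m) A x y = dform m (\<lambda>i. A (Suc i)) x y - dform m (\<lambda>i. A (Suc i)) (A 1 x) (A 1 y)"
  using assms
proof (induction m arbitrary: x y)
  case (Suc m)
  have IH: "dform (Suc m) A x y = dform m (\<lambda>i. A (Suc i)) x y - dform m (\<lambda>i. A (Suc i)) (A 1 x) (A 1 y)" for x y
    by (rule Suc.IH) (use Suc.prems in auto)
  have "A 1 (A (Suc (Suc m)) u) = A (Suc (Suc m)) (A 1 u)" for u by (rule Suc.prems) auto
  then show ?case by (subst dform.simps(2), subst (1 2) IH) simp
qed simp

lemma dform_eq_sum:
  "dform m A x y = (\<Sum>k\<in>{1..m} \<rightarrow>\<^sub>E {0, 1}. (-1) ^ (\<Sum>i=1..m. k i) * cinner (tuple_power m A k x) (tuple_power m A k y))"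
proof (induction m arbitrary: x y)
  case 0
  have "{1..0::nat} = {}" by simp
  then show ?case by simp
next
  case (Suc m)
  let ?S = "{1..m} \<rightarrow>\<^sub>E {0, 1::nat}"
  let ?g = "\<lambda>m k x y. (-1) ^ (\<Sum>i=1..m. k i) * cinner (tuple_power m A k x) (tuple_power m A k y)"
  let ?u = "\<lambda>(y, k). k(Suc m := y)"
  have S: "{1..Suc m} \<rightarrow>\<^sub>E {0, 1::nat} = ?u ` ({0, 1} \<times> ?S)"
    by (simp add: atLeastAtMostSuc_conv PiE_insert_eq)
  have tp: "tuple_power m A (k(Suc m := r)) = tuple_power m A k" for k and r :: nat
    by (rule tuple_power_cong) auto
  have sm: "(\<Sum>i=1..m. (k(Suc m := r)) i) = (\<Sum>i=1..m. k i)" for k and r :: nat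
    by (rule sum.cong) auto
  have "(\<Sum>k\<in>{1..Suc m} \<rightarrow>\<^sub>E {0, 1}. ?g (Suc m) k x y) = (\<Sum>p\<in>{0, 1} \<times> ?S. ?g (Suc m) (?u p) x y)"
    unfolding S by (rule sum.reindex_cong[OF inj_combinator]) auto
  also have "\<dots> = (\<Sum>r\<in>{0, 1}. \<Sum>k\<in>?S. ?g (Suc m) (k(Suc m := r)) x y)"
    by (simp add: sum.cartesian_product split_def)
  also have "\<dots> = (\<Sum>k\<in>?S. ?g m k x y) - (\<Sum>k\<in>?S. ?g m k (A (Suc m) x) (A (Suc m) y))"
    by (simp add: tp sm sum_negf)
  finally show ?case using Suc by simp
qed

lemma dform_commute: "dform m A x y = cnj (dform m A y x)"
proof (induction m arbitrary: x y)
  case 0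
  show ?case using cinner_commute[of x y] by simp
next
  case (Suc m)
  show ?case
    unfolding dform.simps complex_cnj_diff Suc[of x y, symmetric]
      Suc[of "A (Suc m) x" "A (Suc m) y", symmetric] ..
qed

locale commuting_contractions =
  fixes n :: nat and A :: "nat \<Rightarrow> 'h::chilbert_space \<Rightarrow> 'h"
  assumes linear: "\<And>i. 1 \<le> i \<Longrightarrow> i \<le> n \<Longrightarrow> clinear_op (A i)"
    and comm: "\<And>i j x. 1 \<le> i \<Longrightarrow> i \<le> n \<Longrightarrow> 1 \<le> j \<Longrightarrow> j \<le> n \<Longrightarrow> A i (A j x) = A j (A i x)"
    and norm_le: "\<And>i x. 1 \<le> i \<Longrightarrow> i \<le> n \<Longrightarrow> norm (A i x) \<le> norm x"
begin

lemma dform_add: "m \<le> n \<Longrightarrow> dform m A (x + y) z = dform m A x z + dform m A y z"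
proof (induction m arbitrary: x y z)
  case (Suc m)
  then show ?case using clinear_op_add[OF linear[of "Suc m"]] by simp
qed (simp add: cinner_add_left)

lemma dform_scaleC: "m \<le> n \<Longrightarrow> dform m A (scaleC c x) z = c * dform m A x z"
proof (induction m arbitrary: x z)
  case (Suc m)
  then show ?case using clinear_op_scaleC[OF linear[of "Suc m"]] by (simp add: right_diff_distrib)
qed (simp add: cinner_scaleC_left)

lemma psd_dform:
  assumes "m \<le> n" "\<And>x. 0 \<le> Re (dform m A x x)"
  shows "psd_form scaleC (dform m A)"
proof
  show "dform m A x y = cnj (dform m A y x)" for x y by (rule dform_commute)
qed (simp_all add: assms dform_add dform_scaleC)

lemma norm_dform_le:
  assumes "m \<le> n" shows "norm (dform m A x x) \<le> 2 ^ m * (norm x)\<^sup>2"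
  using assms
proof (induction m arbitrary: x)
  case 0
  then show ?case by (simp add: cinner_self norm_power)
next
  case (Suc m)
  have "norm (dform (Suc m) A x x) \<le> norm (dform m A x x) + norm (dform m A (A (Suc m) x) (A (Suc m) x))"
    by (simp add: norm_triangle_ineq4)
  also have "norm (dform m A (A (Suc m) x) (A (Suc m) x)) \<le> 2 ^ m * (norm (A (Suc m) x))\<^sup>2"
    using Suc by simp
  also have "2 ^ m * (norm (A (Suc m) x))\<^sup>2 \<le> 2 ^ m * (norm x)\<^sup>2"
    using Suc.prems norm_le[of "Suc m" x] by (intro mult_left_mono power_mono) auto
  finally show ?case using Suc.IH[of x] Suc.prems by simp
qed

lemma dform_tendsto_0:
  assumes "m \<le> n" "(\<lambda>r. norm (X r)) \<longlonglongrightarrow> 0"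
  shows "(\<lambda>r. Re (dform m A (X r) (X r))) \<longlonglongrightarrow> 0"
proof (rule Lim_null_comparison)
  have "\<bar>Re (dform m A (X r) (X r))\<bar> \<le> 2 ^ m * (norm (X r))\<^sup>2" for r
    using abs_Re_le_cmod[of "dform m A (X r) (X r)"] norm_dform_le[OF assms(1), of "X r"] by linarith
  then show "\<forall>\<^sub>F r in sequentially. norm (Re (dform m A (X r) (X r))) \<le> 2 ^ m * (norm (X r))\<^sup>2"
    by simp
  show "(\<lambda>r. 2 ^ m * (norm (X r))\<^sup>2) \<longlonglongrightarrow> 0"
    using tendsto_mult[OF tendsto_const[of "2 ^ m"] tendsto_power[OF assms(2), of 2]] by simp
qed

end

text \<open>Purity makes a form positive as soon as its defect is.\<close>

lemma nonneg_of_decreasing_to_0: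
  fixes q :: "'a \<Rightarrow> real"
  assumes "\<And>x. q (A x) \<le> q x" "\<And>x. (\<lambda>k. q ((A ^^ k) x)) \<longlonglongrightarrow> 0"
  shows "0 \<le> q x"
proof (rule LIMSEQ_le_const2[OF assms(2)])
  have "q ((A ^^ k) x) \<le> q x" for k by (induction k) (auto intro: order_trans assms(1))
  then show "\<exists>N. \<forall>n\<ge>N. q ((A ^^ n) x) \<le> q x" by blast
qed

lemma commuting_contractions_adjoint:
  assumes "T \<in> contraction_tuples n"
  shows "commuting_contractions n (\<lambda>i. cadjoint (T i))"
proof
  have c: "contraction (T i)" if "1 \<le> i" "i \<le> n" for i
    using assms that by (auto simp: contraction_tuples_def)
  then have b: "bounded_clinear (T i)" if "1 \<le> i" "i \<le> n" for i
    using that by (auto simp: contraction_def)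
  fix i assume i: "1 \<le> i" "i \<le> n"
  show "clinear_op (cadjoint (T i))"
    using b[OF i] by (simp add: clinear_op_def cadjoint_add cadjoint_scaleC)
  show "norm (cadjoint (T i) x) \<le> norm x" for x by (rule norm_cadjoint_le[OF c[OF i]])
  fix j x assume j: "1 \<le> j" "j \<le> n"
  show "cadjoint (T i) (cadjoint (T j) x) = cadjoint (T j) (cadjoint (T i) x)"
    by (rule cadjoint_commute[OF b[OF i] b[OF j]]) (use assms i j in \<open>auto simp: contraction_tuples_def\<close>)
qed

lemma funpow_adjoint:
  assumes "bounded_clinear A"
  shows "cinner ((A ^^ r) x) y = cinner x ((cadjoint A ^^ r) y)"
  by (induction r arbitrary: x y) (simp_all add: cadjoint[OF assms] funpow_swap1)

lemma contraction_tuples_Suc: "T \<in> contraction_tuples (Suc m) \<Longrightarrow> T \<in> contraction_tuples m"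
  by (auto simp: contraction_tuples_def)

text \<open>Taking adjoints reverses the order of the factors, and commutativity restores it.\<close>

lemma tuple_power_adjoint:
  assumes "T \<in> contraction_tuples m"
  shows "cinner (tuple_power m T k x) y = cinner x (tuple_power m (\<lambda>i. cadjoint (T i)) k y)"
  using assms
proof (induction m arbitrary: x y)
  case (Suc m)
  let ?A = "\<lambda>i. cadjoint (T i)"
  interpret commuting_contractions "Suc m" ?A by (rule commuting_contractions_adjoint[OF Suc.prems])
  have b: "bounded_clinear (T (Suc m))"
    using Suc.prems by (auto simp: contraction_tuples_def contraction_def)
  have c: "tuple_power m ?A k (?A (Suc m) x) = ?A (Suc m) (tuple_power m ?A k x)" for x
    by (rule tuple_power_commute[symmetric]) (rule comm, auto)
  have "cinner (tuple_power (Suc m) T k x) y = cinner x ((?A (Suc m) ^^ k (Suc m)) (tuple_power m ?A k y))"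
    using Suc.IH[OF contraction_tuples_Suc[OF Suc.prems]] by (simp add: funpow_adjoint[OF b])
  also have "(?A (Suc m) ^^ k (Suc m)) (tuple_power m ?A k y) = tuple_power (Suc m) ?A k y"
    using funpow_commute[of "tuple_power m ?A k" "?A (Suc m)", OF c] by simp
  finally show ?case .
qed simp

lemma cinner_szego_inverse:
  assumes "T \<in> contraction_tuples m"
  shows "cinner (szego_inverse m T x) y = dform m (\<lambda>i. cadjoint (T i)) x y"
proof -
  have r: "cinner (r *\<^sub>R u) v = of_real r * cinner u v" for r and u v :: 'a
    using cinner_scaleC_left[of "of_real r" u v] by (simp add: scaleC_of_real)
  show ?thesis
    unfolding szego_inverse_def dform_eq_sum H.sum_left r tuple_power_adjoint[OF assms]
    by simp
qed

text \<open>The images under \<open>S\<close> of vectors that are orthonormal for \<open>b\<close> are linearly independent.\<close>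

lemma orthonormal_le_card:
  fixes S :: "'h::chilbert_space \<Rightarrow> 'h"
  assumes "psd_form scaleC b" and S: "\<And>x y. cinner (S x) y = b x y"
    and B: "finite B" "range S \<subseteq> chilbert.span B"
    and e: "psd_form.orthonormal b d e"
  shows "d \<le> card B"
proof -
  interpret psd_form scaleC b by fact
  have inj: "inj_on (\<lambda>i. S (e i)) {..<d}"
  proof (rule inj_onI, rule ccontr)
    fix i j assume ij: "i \<in> {..<d}" "j \<in> {..<d}" "S (e i) = S (e j)" "i \<noteq> j"
    then have "b (e i) (e i) = b (e j) (e i)" using S by metis
    then show False using ij orthonormalD[OF e, of i i] orthonormalD[OF e, of j i] by simp
  qed
  let ?X = "(\<lambda>i. S (e i)) ` {..<d}"
  have "chilbert.independent ?X"
  proof (rule chilbert.independent_if_scalars_zero)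
    fix f x assume f: "(\<Sum>x\<in>?X. scaleC (f x) x) = 0" and "x \<in> ?X"
    then obtain j where j: "j < d" "x = S (e j)" by auto
    have "0 = cinner (\<Sum>i<d. scaleC (f (S (e i))) (S (e i))) (e j)"
      using f by (simp add: sum.reindex[OF inj])
    also have "\<dots> = (\<Sum>i<d. f (S (e i)) * b (e i) (e j))"
      by (simp add: H.sum_left H.sc_left S)
    also have "\<dots> = (\<Sum>i<d. if i = j then f (S (e j)) else 0)"
      by (rule sum.cong) (use j in \<open>auto simp: orthonormalD[OF e]\<close>)
    also have "\<dots> = f x" using j by (simp add: sum.delta)
    finally show "f x = 0" by simp
  qed simp
  then have "card ?X \<le> card B" using chilbert.independent_span_bound[OF B(1)] B(2) by blast
  then show ?thesis using card_image[OF inj] by simp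
qed


section \<open>Realization of a pair of defects by an isometric matrix\<close>

text \<open>This is how purity excludes unimodular eigenvalues: pairing with an eigenvector is such a function
  \<open>g\<close>.\<close>

lemma vanishing_functional:
  fixes g :: "'v \<Rightarrow> complex" and q :: "'v \<Rightarrow> real"
  assumes inv: "\<And>x. norm (g (A x)) = norm (g x)" and le: "\<And>x. (norm (g x))\<^sup>2 \<le> q x * C"
    and pure: "\<And>x. (\<lambda>k. q ((A ^^ k) x)) \<longlonglongrightarrow> 0"
  shows "g x = 0"
proof -
  have eq: "norm (g ((A ^^ k) x)) = norm (g x)" for k by (induction k) (auto simp: inv)
  have "(\<lambda>k. q ((A ^^ k) x) * C) \<longlonglongrightarrow> 0 * C" by (intro tendsto_mult pure tendsto_const)
  moreover have "(norm (g x))\<^sup>2 \<le> q ((A ^^ k) x) * C" for k using le[of "(A ^^ k) x"] eq[of k] by simp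
  ultimately have "(norm (g x))\<^sup>2 \<le> 0 * C" by (intro LIMSEQ_le_const) auto
  then show ?thesis by simp
qed

text \<open>The counterpart of \<open>stable\<close> for the block from inputs to outputs.\<close>

definition outer_stable :: "nat \<Rightarrow> nat \<Rightarrow> (nat \<Rightarrow> nat \<Rightarrow> complex) \<Rightarrow> bool" where
  "outer_stable N d U \<longleftrightarrow> (\<forall>\<kappa> x. norm \<kappa> = 1 \<longrightarrow>
     (\<forall>a<N. mapply N U (join d x (\<lambda>_. 0)) a = join d (\<lambda>j. \<kappa> * x j) (\<lambda>_. 0) a) \<longrightarrow> (\<forall>a<d. x a = 0))"

text \<open>The identity \<open>b1 x y + b2 (A2 x) (A2 y) = b1 (A1 x) (A1 y) + b2 x y\<close>, which holds because \<open>A1\<close> and \<open>A2\<close>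
  commute, is an equality of Gram matrices. An eigenvector of a diagonal block of \<open>U\<close> with unimodular
  eigenvalue is an eigenvector of \<open>U\<close>, because \<open>U\<close> is isometric. Pairing it with the coordinates of \<open>x\<close>
  gives a function that is invariant in modulus under \<open>A2\<close> or \<open>A1\<close> and so vanishes by purity; the
  coordinate maps are onto, hence the eigenvector is zero.\<close>

lemma realization_exists:
  fixes sc :: "complex \<Rightarrow> 'v::ab_group_add \<Rightarrow> 'v" and A1 A2 :: "'v \<Rightarrow> 'v"
  assumes "psd_form sc b" and forms: "psd_form sc b1" "psd_form sc b2"
    and A1: "\<And>x y. A1 (x + y) = A1 x + A1 y" "\<And>c x. A1 (sc c x) = sc c (A1 x)"
    and A2: "\<And>x y. A2 (x + y) = A2 x + A2 y" "\<And>c x. A2 (sc c x) = sc c (A2 x)"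
    and comm: "\<And>x. A1 (A2 x) = A2 (A1 x)"
    and b1: "\<And>x y. b1 x y = b x y - b (A2 x) (A2 y)"
    and b2: "\<And>x y. b2 x y = b x y - b (A1 x) (A1 y)"
    and rank1: "\<And>d e. psd_form.orthonormal b1 d e \<Longrightarrow> d \<le> r1"
    and rank2: "\<And>d e. psd_form.orthonormal b2 d e \<Longrightarrow> d \<le> r2"
    and pure: "\<And>x. (\<lambda>k. Re (b ((A2 ^^ k) x) ((A2 ^^ k) x))) \<longlonglongrightarrow> 0"
  obtains N d U \<phi> where "realized_pair sc b N d U A1 A2 \<phi>"
    "(\<And>x. (\<lambda>k. Re (b ((A1 ^^ k) x) ((A1 ^^ k) x))) \<longlonglongrightarrow> 0) \<Longrightarrow> outer_stable N d U"
proof -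
  interpret psd_form sc b by fact
  interpret B1: psd_form sc b1 by fact
  interpret B2: psd_form sc b2 by fact
  have o: "B1.orthonormal 0 (\<lambda>_. 0)" "B2.orthonormal 0 (\<lambda>_. 0)"
    by (simp_all add: B1.orthonormal_def B2.orthonormal_def)
  obtain d e1 where e1: "B1.orthonormal d e1" "\<And>x y. b1 x y = (\<Sum>k<d. b1 x (e1 k) * b1 (e1 k) y)"
  proof (rule B1.orthonormal_basis_extension[OF o(1) rank1])
    fix m f assume "B1.orthonormal m f" "\<And>x y. b1 x y = (\<Sum>k<m. b1 x (f k) * b1 (f k) y)"
    then show thesis by (rule that)
  qed
  obtain d2 e2 where e2: "B2.orthonormal d2 e2" "\<And>x y. b2 x y = (\<Sum>k<d2. b2 x (e2 k) * b2 (e2 k) y)"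
  proof (rule B2.orthonormal_basis_extension[OF o(2) rank2])
    fix m f assume "B2.orthonormal m f" "\<And>x y. b2 x y = (\<Sum>k<m. b2 x (f k) * b2 (f k) y)"
    then show thesis by (rule that)
  qed
  define N where "N = d + d2"
  have le: "d \<le> N" by (simp add: N_def)
  define \<phi> where "\<phi> x a = (if a < d then b1 (e1 a) x else b2 (e2 (a - d)) x)" for x a
  have \<phi>_add: "\<phi> (x + y) a = \<phi> x a + \<phi> y a" and \<phi>_sc: "\<phi> (sc c x) a = cnj c * \<phi> x a" for x y c a
    by (simp_all add: \<phi>_def B1.linear_simps B2.linear_simps)
  have outer: "cdot {..<d} (\<phi> x) (\<phi> y) = b1 y x" for x y
    unfolding e1(2)[of y x] cdot_def
    by (rule sum.cong) (auto simp: \<phi>_def B1.commute[of y] mult.commute)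
  have inner: "cdot {d..<N} (\<phi> x) (\<phi> y) = b2 y x" for x y
  proof -
    have "cdot {d..<N} (\<phi> x) (\<phi> y) = (\<Sum>k<d2. \<phi> x (d + k) * cnj (\<phi> y (d + k)))"
      unfolding cdot_def
      by (rule sum.reindex_bij_witness[of _ "\<lambda>k. d + k" "\<lambda>a. a - d"]) (auto simp: N_def)
    also have "\<dots> = b2 y x"
      unfolding e2(2)[of y x]
      by (rule sum.cong) (auto simp: \<phi>_def B2.commute[of y] mult.commute)
    finally show ?thesis .
  qed
  define X where "X x = join d (\<phi> x) (\<phi> (A2 x))" for x
  define Y where "Y x = join d (\<phi> (A1 x)) (\<phi> x)" for x
  have gram: "cdot {..<N} (X x) (X y) = cdot {..<N} (Y x) (Y y)" for x y
    by (simp add: X_def Y_def cdot_join[OF le] outer inner b1 b2 comm)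
  have X: "X (x + y) a = X x a + X y a" "X (sc c x) a = cnj c * X x a" for x y c a
    by (simp_all add: X_def join_def \<phi>_add \<phi>_sc A2)
  have Y: "Y (x + y) a = Y x a + Y y a" "Y (sc c x) a = cnj c * Y x a" for x y c a
    by (simp_all add: Y_def join_def \<phi>_add \<phi>_sc A1)
  obtain U where U: "is_isometry N U" "\<And>x a. a < N \<Longrightarrow> mapply N U (X x) a = Y x a"
    using isometry_extension[where X = X and Y = Y, OF vector_space_axioms X Y gram] by blast
  have pairing: "cdot {..<d} (\<phi> x) v + cdot {d..<N} (\<phi> (A2 x)) w = cdot {..<d} (\<phi> (A1 x)) v' + cdot {d..<N} (\<phi> x) w'"
    if vw: "\<And>a. a < N \<Longrightarrow> mapply N U (join d v w) a = join d v' w' a" for x v w v' w'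
  proof -
    have "cdot {..<N} (X x) (join d v w) = cdot {..<N} (mapply N U (X x)) (mapply N U (join d v w))"
      using U(1) by (simp add: is_isometry_def)
    also have "\<dots> = cdot {..<N} (Y x) (join d v' w')"
      by (rule cdot_cong) (use U(2) vw in auto)
    finally show ?thesis by (simp add: X_def Y_def cdot_join le)
  qed
  have cdot_scale_right: "cdot I v (\<lambda>j. \<zeta> * w j) = cnj \<zeta> * cdot I v w" for I v \<zeta> w
    by (simp add: cdot_def sum_distrib_left mult_ac)
  have cdot_zero: "cdot I v (\<lambda>_. 0) = 0" for I v by (simp add: cdot_def)
  have nonneg: "0 \<le> sq x" for x by simp
  have norm_outer: "norm2 {..<d} (\<phi> x) = sq x - sq (A2 x)" for x
  proof -
    have "complex_of_real (norm2 {..<d} (\<phi> x)) = of_real (sq x - sq (A2 x))"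
      using outer[of x x] by (simp add: cdot_self b1 self)
    then show ?thesis using of_real_eq_iff by blast
  qed
  have norm_inner: "norm2 {d..<N} (\<phi> x) = sq x - sq (A1 x)" for x
  proof -
    have "complex_of_real (norm2 {d..<N} (\<phi> x)) = of_real (sq x - sq (A1 x))"
      using inner[of x x] by (simp add: cdot_self b2 self)
    then show ?thesis using of_real_eq_iff by blast
  qed
  have "y a = 0"
    if z: "norm \<zeta> = 1" and y: "\<And>a. a < N \<Longrightarrow> mapply N U (join d (\<lambda>_. 0) (\<lambda>j. \<zeta> * y j)) a = join d (\<lambda>_. 0) y a"
      and a: "d \<le> a" "a < N" for \<zeta> y a
  proof -
    have "cdot {d..<N} (\<phi> x) y = 0" for x
    proof (rule vanishing_functional[where A = A2 and q = sq and C = "norm2 {d..<N} y"])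
      fix x
      have "cnj \<zeta> * cdot {d..<N} (\<phi> (A2 x)) y = cdot {d..<N} (\<phi> x) y"
        using pairing[OF y, of x] by (simp add: cdot_scale_right cdot_zero)
      then have "norm (cnj \<zeta> * cdot {d..<N} (\<phi> (A2 x)) y) = norm (cdot {d..<N} (\<phi> x) y)" by simp
      then show "norm (cdot {d..<N} (\<phi> (A2 x)) y) = norm (cdot {d..<N} (\<phi> x) y)" by (simp add: norm_mult z)
      have "(norm (cdot {d..<N} (\<phi> x) y))\<^sup>2 \<le> norm2 {d..<N} (\<phi> x) * norm2 {d..<N} y"
        using cv.cauchy_schwarz[of "{d..<N}" "\<phi> x" y] by (simp add: cv_sq)
      also have "\<dots> \<le> sq x * norm2 {d..<N} y" by (rule mult_right_mono) (simp_all add: norm_inner)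
      finally show "(norm (cdot {d..<N} (\<phi> x) y))\<^sup>2 \<le> sq x * norm2 {d..<N} y" .
      show "(\<lambda>k. sq ((A2 ^^ k) x)) \<longlonglongrightarrow> 0" using pure by (simp add: sq_def)
    qed
    then have "0 = cdot {d..<N} (\<phi> (e2 (a - d))) y" by simp
    also have "\<dots> = (\<Sum>j\<in>{d..<N}. if j = a then cnj (y a) else 0)"
      unfolding cdot_def
    proof (rule sum.cong[OF refl])
      fix j assume j: "j \<in> {d..<N}"
      then have "\<phi> (e2 (a - d)) j = (if j = a then 1 else 0)"
        using B2.orthonormalD[OF e2(1), of "j - d" "a - d"] a by (auto simp: \<phi>_def N_def)
      then show "\<phi> (e2 (a - d)) j * cnj (y j) = (if j = a then cnj (y a) else 0)" by simp
    qed
    also have "\<dots> = cnj (y a)" using a by (simp add: sum.delta)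
    finally show "y a = 0" by simp
  qed
  then have real: "realized_pair sc b N d U A1 A2 \<phi>"
  proof unfold_locales
    show "a < N \<Longrightarrow> mapply N U (join d (\<phi> x) (\<phi> (A2 x))) a = join d (\<phi> (A1 x)) (\<phi> x) a" for x a
      using U(2)[of a x] by (simp add: X_def Y_def)
    show "(\<lambda>k. sq ((A2 ^^ k) x)) \<longlonglongrightarrow> 0" for x using pure by (simp add: sq_def)
  qed (simp_all add: le U(1) A1 A2 comm \<phi>_add \<phi>_sc norm_outer norm_inner)
  have "outer_stable N d U" if pure1: "\<And>x. (\<lambda>k. Re (b ((A1 ^^ k) x) ((A1 ^^ k) x))) \<longlonglongrightarrow> 0"
    unfolding outer_stable_def
  proof (intro allI impI)
    fix \<kappa> v a
    assume z: "norm \<kappa> = (1::real)" and a: "a < d"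
      and v: "\<forall>a<N. mapply N U (join d v (\<lambda>_. 0)) a = join d (\<lambda>j. \<kappa> * v j) (\<lambda>_. 0) a"
    have "cdot {..<d} (\<phi> x) v = 0" for x
    proof (rule vanishing_functional[where A = A1 and q = sq and C = "norm2 {..<d} v"])
      fix x
      have "cdot {..<d} (\<phi> x) v = cnj \<kappa> * cdot {..<d} (\<phi> (A1 x)) v"
        using pairing[of v "\<lambda>_. 0" "\<lambda>j. \<kappa> * v j" "\<lambda>_. 0" x] v by (simp add: cdot_scale_right cdot_zero)
      then have "norm (cdot {..<d} (\<phi> x) v) = norm (cnj \<kappa> * cdot {..<d} (\<phi> (A1 x)) v)" by simp
      then show "norm (cdot {..<d} (\<phi> (A1 x)) v) = norm (cdot {..<d} (\<phi> x) v)" by (simp add: norm_mult z)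
      have "(norm (cdot {..<d} (\<phi> x) v))\<^sup>2 \<le> norm2 {..<d} (\<phi> x) * norm2 {..<d} v"
        using cv.cauchy_schwarz[of "{..<d}" "\<phi> x" v] by (simp add: cv_sq)
      also have "\<dots> \<le> sq x * norm2 {..<d} v" by (rule mult_right_mono) (simp_all add: norm_outer)
      finally show "(norm (cdot {..<d} (\<phi> x) v))\<^sup>2 \<le> sq x * norm2 {..<d} v" .
      show "(\<lambda>k. sq ((A1 ^^ k) x)) \<longlonglongrightarrow> 0" using pure1 by (simp add: sq_def)
    qed
    then have "0 = cdot {..<d} (\<phi> (e1 a)) v" by simp
    also have "\<dots> = (\<Sum>j<d. if j = a then cnj (v a) else 0)"
      unfolding cdot_def
    proof (rule sum.cong[OF refl])
      fix j assume j: "j \<in> {..<d}"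
      then have "\<phi> (e1 a) j = (if j = a then 1 else 0)"
        using B1.orthonormalD[OF e1(1), of j a] a by (auto simp: \<phi>_def)
      then show "\<phi> (e1 a) j * cnj (v j) = (if j = a then cnj (v a) else 0)" by simp
    qed
    also have "\<dots> = cnj (v a)" using a by (simp add: sum.delta)
    finally show "v a = 0" by simp
  qed
  then show thesis using that real by blast
qed

section \<open>The variables after the first two\<close>

text \<open>The scalars are conjugated because they replace adjoints.\<close>

definition scalar_tuple :: "nat \<Rightarrow> (nat \<Rightarrow> complex) \<Rightarrow> (nat \<Rightarrow> 'h \<Rightarrow> 'h) \<Rightarrow> nat \<Rightarrow> 'h::chilbert_space \<Rightarrow> 'h" where
  "scalar_tuple m z A i = (if 3 \<le> i \<and> i \<le> m + 2 then scaleC (cnj (z i)) else A i)"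

definition adjoint_eval :: "nat \<Rightarrow> cmpoly \<Rightarrow> (nat \<Rightarrow> 'h \<Rightarrow> 'h) \<Rightarrow> 'h \<Rightarrow> 'h::chilbert_space" where
  "adjoint_eval n f A h = (\<Sum>k\<in>Poly_Mapping.keys f.
     scaleC (cnj (Poly_Mapping.lookup f k)) (tuple_power n A (Poly_Mapping.lookup k) h))"

lemma tuple_power_scalar:
  "tuple_power (m + 2) (scalar_tuple m z A) k h =
     scaleC (cnj (\<Prod>i=3..m + 2. z i ^ k i)) ((A 1 ^^ k 1) ((A 2 ^^ k 2) h))"
  if lin: "clinear_op (A 1)" "clinear_op (A 2)"
proof -
  have "tuple_power (j + 2) (scalar_tuple m z A) k h =
     scaleC (cnj (\<Prod>i=3..j + 2. z i ^ k i)) ((A 1 ^^ k 1) ((A 2 ^^ k 2) h))" if "j \<le> m" for j h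
    using that
  proof (induction j arbitrary: h)
    case 0
    have "scalar_tuple m z A (Suc 0) = A 1" "scalar_tuple m z A (Suc (Suc 0)) = A 2"
      by (simp_all add: scalar_tuple_def fun_eq_iff numeral_2_eq_2)
    then show ?case by (simp add: numeral_2_eq_2)
  next
    case (Suc j)
    have st: "scalar_tuple m z A (Suc (j + 2)) = scaleC (cnj (z (Suc (j + 2))))"
      using Suc.prems by (simp add: scalar_tuple_def fun_eq_iff)
    have l: "(A 1 ^^ k 1) ((A 2 ^^ k 2) (scaleC c h)) = scaleC c ((A 1 ^^ k 1) ((A 2 ^^ k 2) h))" for c
      using clinear_op_funpow[OF lin(1)] clinear_op_funpow[OF lin(2)] by (simp add: clinear_op_scaleC)
    have "tuple_power (Suc j + 2) (scalar_tuple m z A) k h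
      = tuple_power (j + 2) (scalar_tuple m z A) k ((scalar_tuple m z A (Suc (j + 2)) ^^ k (Suc (j + 2))) h)"
      by simp
    also have "\<dots> = tuple_power (j + 2) (scalar_tuple m z A) k (scaleC (cnj (z (Suc (j + 2))) ^ k (Suc (j + 2))) h)"
      by (simp only: st scaleC_funpow)
    also have "\<dots> = scaleC (cnj (\<Prod>i=3..j + 2. z i ^ k i)) (scaleC (cnj (z (Suc (j + 2))) ^ k (Suc (j + 2))) ((A 1 ^^ k 1) ((A 2 ^^ k 2) h)))"
      using Suc by (simp only: Suc_leD l)
    also have "\<dots> = scaleC (cnj (\<Prod>i=3..Suc (j + 2). z i ^ k i)) ((A 1 ^^ k 1) ((A 2 ^^ k 2) h))"
      unfolding scaleC_scaleC by (simp add: atLeastAtMostSuc_conv mult.commute)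
    finally show ?case by simp
  qed
  then show ?thesis by simp
qed

text \<open>One application of \<open>defect_step\<close> to the operator with index \<open>m + 3\<close>: commutativity moves its power to
  the front of each monomial, and the remaining factors are the operators \<open>L\<close> of that lemma.\<close>

lemma (in commuting_contractions) scalars_to_operators:
  fixes m :: nat and f :: cmpoly
  defines "B \<equiv> \<lambda>i. A (i + 2)"
  assumes m: "Suc m + 2 \<le> n"
    and nonneg: "\<And>x. 0 \<le> Re (dform m B x x)" "\<And>x. 0 \<le> Re (dform (Suc m) B x x)"
    and pure: "\<And>x. (\<lambda>k. norm ((B (Suc m) ^^ k) x)) \<longlonglongrightarrow> 0"
    and bound: "\<And>z h. (\<And>i. norm (z i) = 1) \<Longrightarrow>
        Re (dform (Suc m) B (adjoint_eval n f (scalar_tuple (Suc m) z A) h) (adjoint_eval n f (scalar_tuple (Suc m) z A) h))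
        \<le> M\<^sup>2 * Re (dform (Suc m) B h h)"
    and z: "\<And>i. norm (z i) = 1"
  shows "Re (dform m B (adjoint_eval n f (scalar_tuple m z A) h) (adjoint_eval n f (scalar_tuple m z A) h))
        \<le> M\<^sup>2 * Re (dform m B h h)"
proof -
  let ?K = "Poly_Mapping.keys f" and ?c = "Poly_Mapping.lookup f" and ?l = "Poly_Mapping.lookup"
  define i where "i = m + 3"
  have i: "1 \<le> i" "i \<le> n" "B (Suc m) = A i" using m by (auto simp: i_def B_def numeral_3_eq_3)
  interpret BC: commuting_contractions "n - 2" B
    by unfold_locales (auto simp: B_def intro!: linear comm norm_le)
  interpret D: psd_form scaleC "dform m B" by (rule BC.psd_dform) (use m nonneg in auto)
  define C where "C = scalar_tuple m z A"
  have C_lin: "clinear_op (C j)" if "1 \<le> j" "j \<le> n" for j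
    using linear[OF that] clinear_op_scale by (auto simp: C_def scalar_tuple_def)
  have Ci: "C i = A i" by (simp add: C_def scalar_tuple_def i_def fun_eq_iff)
  have C_A: "C j (A l x) = A l (C j x)" if "1 \<le> j" "j \<le> n" "1 \<le> l" "l \<le> n" for j l x
    using comm[OF that] clinear_op_scaleC[OF linear[OF that(3,4)]] by (auto simp: C_def scalar_tuple_def)
  define E where "E = C(i := id)"
  have E_lin: "clinear_op (E j)" if "1 \<le> j" "j \<le> n" for j
    using C_lin[OF that] by (auto simp: E_def clinear_op_def)
  have pull_out: "tuple_power n (C(i := S)) k x = (S ^^ k i) (tuple_power n E k x)"
    if S: "clinear_op S" "\<And>j x. 1 \<le> j \<Longrightarrow> j \<le> n \<Longrightarrow> C j (S x) = S (C j x)" for S k x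
  proof -
    have C_C: "C j (C l x) = C l (C j x)" if "1 \<le> j" "j \<le> n" "1 \<le> l" "l \<le> n" for j l x
      using C_A[OF that] clinear_op_scaleC[OF C_lin[OF that(1,2)]] unfolding C_def scalar_tuple_def by auto
    have "tuple_power n (C(i := S)) k x = ((C(i := S)) i ^^ k i) (tuple_power n ((C(i := S))(i := id)) k x)"
      by (rule tuple_power_extract) (use S C_C i in auto)
    then show ?thesis by (simp add: E_def)
  qed
  define L where "L k x = scaleC (cnj (?c k)) (tuple_power n E (?l k) x)" for k x
  have E_tp: "clinear_op (tuple_power n E k)" for k
    by (rule clinear_op_tuple_power) (rule E_lin)
  have L: "clinear_op (L k)" for k
    using E_tp unfolding clinear_op_def L_def by (simp add: scaleC_add_right scaleC_scaleC mult.commute)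
  have E_A: "tuple_power n E k (A i x) = A i (tuple_power n E k x)" for k x
    by (rule tuple_power_commute[symmetric]) (use C_A i in \<open>auto simp: E_def\<close>)
  have L_A: "L k (A i x) = A i (L k x)" for k x
    by (simp add: L_def E_A clinear_op_scaleC[OF linear[OF i(1,2)]])
  have Dsq: "D.sq x = Re (dform m B x x)" for x by (simp add: D.sq_def)
  have Ai: "clinear_op (A i)" by (rule linear[OF i(1,2)])
  have "D.sq (\<Sum>k\<in>?K. (A i ^^ ?l k i) (L k h)) \<le> M\<^sup>2 * D.sq h"
  proof (rule D.defect_step[where M = M])
    fix x show "D.sq (A i x) \<le> D.sq x" using nonneg(2)[of x] by (simp add: Dsq i(3))
    show "(\<lambda>k. D.sq ((A i ^^ k) x)) \<longlonglongrightarrow> 0"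
      unfolding Dsq by (rule BC.dform_tendsto_0) (use m pure i(3) in auto)
  next
    fix \<zeta> :: complex and x
    assume z1: "norm \<zeta> = 1"
    define z' where "z' = z(i := cnj \<zeta>)"
    have st: "scalar_tuple (Suc m) z' A = C(i := scaleC \<zeta>)"
      by (auto simp: scalar_tuple_def C_def z'_def i_def fun_eq_iff)
    have "adjoint_eval n f (scalar_tuple (Suc m) z' A) x = (\<Sum>k\<in>?K. scaleC (\<zeta> ^ ?l k i) (L k x))"
      unfolding adjoint_eval_def st
    proof (rule sum.cong[OF refl])
      fix k
      have "tuple_power n (C(i := scaleC \<zeta>)) (?l k) x = (scaleC \<zeta> ^^ ?l k i) (tuple_power n E (?l k) x)"
        by (rule pull_out) (auto simp: clinear_op_scale clinear_op_scaleC[OF C_lin])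
      then show "scaleC (cnj (?c k)) (tuple_power n (C(i := scaleC \<zeta>)) (?l k) x) = scaleC (\<zeta> ^ ?l k i) (L k x)"
        by (simp add: scaleC_funpow L_def scaleC_scaleC mult.commute)
    qed
    moreover have "norm (z' j) = 1" for j by (simp add: z'_def z z1)
    ultimately show "D.sq (\<Sum>k\<in>?K. scaleC (\<zeta> ^ ?l k i) (L k x)) - D.sq (A i (\<Sum>k\<in>?K. scaleC (\<zeta> ^ ?l k i) (L k x)))
        \<le> M\<^sup>2 * (D.sq x - D.sq (A i x))"
      using bound[of z' x] by (simp add: Dsq i(3))
  qed (simp_all add: clinear_op_add[OF Ai] clinear_op_scaleC[OF Ai] clinear_op_add[OF L] clinear_op_scaleC[OF L] L_A)
  also have "(\<Sum>k\<in>?K. (A i ^^ ?l k i) (L k h)) = adjoint_eval n f (scalar_tuple m z A) h"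
    unfolding adjoint_eval_def
  proof (rule sum.cong[OF refl])
    fix k
    have "tuple_power n (C(i := A i)) (?l k) h = (A i ^^ ?l k i) (tuple_power n E (?l k) h)"
      by (rule pull_out) (use Ai C_A i in auto)
    moreover have "C(i := A i) = scalar_tuple m z A" using Ci by (auto simp: C_def)
    ultimately show "(A i ^^ ?l k i) (L k h) = scaleC (cnj (?c k)) (tuple_power n (scalar_tuple m z A) (?l k) h)"
      by (simp add: L_def clinear_op_scaleC[OF clinear_op_funpow[OF Ai]])
  qed
  finally show ?thesis by (simp add: Dsq)
qed


section \<open>The von Neumann inequality on the curve of the tuple\<close>

lemma cinner_eval_tuple:
  assumes "T \<in> contraction_tuples n"
  shows "cinner (eval_tuple n f T x) y = cinner x (adjoint_eval n f (\<lambda>i. cadjoint (T i)) y)"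
  by (simp add: eval_tuple_def adjoint_eval_def H.linear_simps tuple_power_adjoint[OF assms])

text \<open>The bound starts from \<open>pair_bound\<close> for the form of \<open>T 3, \<dots>, T n\<close>, with all of these replaced by
  unimodular scalars. Restoring them one at a time shortens the form until it is the inner product, and
  the inequality for the adjoint of \<open>f(T)\<close> then gives the inequality for \<open>f(T)\<close>.\<close>

theorem spectral_bound:
  fixes T :: "nat \<Rightarrow> 'h::chilbert_space \<Rightarrow> 'h"
  assumes n: "n \<ge> 3" and T: "T \<in> pq_tuples n 1 2" and fin: "finite_rank n 1 2 T"
  obtains N d U where "colligation N d U" "pure_contraction (T 1) \<Longrightarrow> outer_stable N d U"
    "\<And>f M h. 0 \<le> M \<Longrightarrow> (\<And>z. z \<in> {1..n} \<rightarrow>\<^sub>E sphere 0 1 \<Longrightarrow> (z 1, z 2) \<in> colligation.curve N d U \<Longrightarrow>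
        norm (eval_point n f z) \<le> M) \<Longrightarrow> norm (eval_tuple n f T h) \<le> M * norm h"
proof -
  define A where "A i = cadjoint (T i)" for i
  define B where "B i = A (i + 2)" for i
  define m where "m = n - 2"
  have nm: "n = m + 2" "n - 1 = Suc m" using n by (simp_all add: m_def)
  define R1 where "R1 = remove_entry 1 T"
  define R2 where "R2 = remove_entry 2 T"
  have Tc: "T \<in> contraction_tuples n" and R1: "R1 \<in> szego_tuples (Suc m)" and R2: "R2 \<in> szego_tuples (Suc m)"
    and R1p: "pure_tuple (Suc m) R1"
    using T unfolding pq_tuples_def R1_def R2_def nm(2) by simp_all
  interpret commuting_contractions n A
    unfolding A_def by (rule commuting_contractions_adjoint[OF Tc])
  interpret BC: commuting_contractions m B
    by unfold_locales (auto simp: B_def nm intro!: linear comm norm_le)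
  define b where "b = dform m B"
  have A1: "clinear_op (A 1)" and A2: "clinear_op (A 2)" using n by (auto intro!: linear)
  have A12: "A 1 (A 2 x) = A 2 (A 1 x)" for x using n by (auto intro!: comm)
  have S1: "cinner (szego_inverse (Suc m) R1 x) y = b x y - b (A 2 x) (A 2 y)" for x y
  proof -
    have "cinner (szego_inverse (Suc m) R1 x) y = dform (Suc m) (\<lambda>i. cadjoint (R1 i)) x y"
      using R1 by (intro cinner_szego_inverse) (simp add: szego_tuples_def)
    also have "\<dots> = dform (Suc m) (\<lambda>i. A (Suc i)) x y"
      by (rule dform_cong) (simp add: R1_def remove_entry_def A_def)
    also have "\<dots> = dform m (\<lambda>i. A (Suc (Suc i))) x y - dform m (\<lambda>i. A (Suc (Suc i))) (A (Suc 1) x) (A (Suc 1) y)"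
      by (rule dform_Suc_shift) (auto intro!: comm simp: nm)
    finally show ?thesis by (simp add: b_def B_def[abs_def] numeral_2_eq_2)
  qed
  have S2: "cinner (szego_inverse (Suc m) R2 x) y = b x y - b (A 1 x) (A 1 y)" for x y
  proof -
    let ?C = "\<lambda>i. if i = 1 then A 1 else A (Suc i)"
    have "cinner (szego_inverse (Suc m) R2 x) y = dform (Suc m) (\<lambda>i. cadjoint (R2 i)) x y"
      using R2 by (intro cinner_szego_inverse) (simp add: szego_tuples_def)
    also have "\<dots> = dform (Suc m) ?C x y"
      by (rule dform_cong) (auto simp: R2_def remove_entry_def A_def)
    also have "\<dots> = dform m (\<lambda>i. ?C (Suc i)) x y - dform m (\<lambda>i. ?C (Suc i)) (?C 1 x) (?C 1 y)"
      by (rule dform_Suc_shift) (auto intro!: comm simp: nm)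
    also have "\<dots> = b x y - b (?C 1 x) (?C 1 y)"
    proof -
      have "dform m (\<lambda>i. ?C (Suc i)) x y = b x y" for x y
        unfolding b_def by (rule dform_cong) (simp add: B_def)
      then show ?thesis by (simp only:)
    qed
    finally show ?thesis by simp
  qed
  have pos: "0 \<le> Re (cinner (szego_inverse (Suc m) R x) x)" if "R \<in> szego_tuples (Suc m)" for R x
    using that by (auto simp: szego_tuples_def positive_op_def complex_nonneg_Reals_iff)
  have pure: "(\<lambda>k. norm ((A i ^^ k) x)) \<longlonglongrightarrow> 0" if "2 \<le> i" "i \<le> n" for i x
  proof -
    have "i - 1 \<in> {1..Suc m}" using that nm by auto
    then have "pure_contraction (R1 (i - 1))" using R1p unfolding pure_tuple_def by blast
    moreover have "R1 (i - 1) = T i" using that by (simp add: R1_def remove_entry_def)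
    ultimately show ?thesis by (simp add: pure_contraction_def A_def)
  qed
  have b_lim: "(\<lambda>k. Re (b ((C ^^ k) x) ((C ^^ k) x))) \<longlonglongrightarrow> 0" if "(\<lambda>k. norm ((C ^^ k) x)) \<longlonglongrightarrow> 0" for C x
    unfolding b_def by (rule BC.dform_tendsto_0[OF order_refl that])
  have b_lim2: "(\<lambda>k. Re (b ((A 2 ^^ k) x) ((A 2 ^^ k) x))) \<longlonglongrightarrow> 0" for x
    by (rule b_lim[OF pure]) (use n in auto)
  have b_nonneg: "0 \<le> Re (b x x)" for x
  proof (rule nonneg_of_decreasing_to_0[of "\<lambda>x. Re (b x x)" "A 2"])
    show "Re (b (A 2 x) (A 2 x)) \<le> Re (b x x)" for x
      using pos[OF R1, of x] by (simp add: S1)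
  qed (rule b_lim2)
  have nonneg: "0 \<le> Re (dform j B x x)" if "j \<le> m" for j x
    using that
  proof (induction j arbitrary: x rule: inc_induct)
    case base
    then show ?case using b_nonneg by (simp add: b_def)
  next
    case (step j)
    show ?case
    proof (rule nonneg_of_decreasing_to_0[of "\<lambda>x. Re (dform j B x x)" "B (Suc j)"])
      show "Re (dform j B (B (Suc j) x) (B (Suc j) x)) \<le> Re (dform j B x x)" for x
        using step.IH[of x] by simp
      show "(\<lambda>k. Re (dform j B ((B (Suc j) ^^ k) x) ((B (Suc j) ^^ k) x))) \<longlonglongrightarrow> 0" for x
        by (rule BC.dform_tendsto_0) (use step.hyps pure[of "j + 3"] nm in \<open>auto simp: B_def numeral_3_eq_3\<close>)
    qed
  qed
  have psd: "psd_form scaleC b"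
    unfolding b_def by (rule BC.psd_dform) (use nonneg in auto)
  interpret b: psd_form scaleC b by (rule psd)
  define b1 where "b1 x y = b x y - b (A 2 x) (A 2 y)" for x y
  define b2 where "b2 x y = b x y - b (A 1 x) (A 1 y)" for x y
  have psd_defect: "psd_form scaleC (\<lambda>x y. b x y - b (C x) (C y))"
    if C: "clinear_op C" and "\<And>x. 0 \<le> Re (b x x - b (C x) (C x))" for C
  proof
    show "b x y - b (C x) (C y) = cnj (b y x - b (C y) (C x))" for x y
      unfolding complex_cnj_diff b.commute[of x y, symmetric] b.commute[of "C x" "C y", symmetric] ..
  qed (use that in \<open>simp_all add: b.add_left b.sc_left clinear_op_add[OF C] clinear_op_scaleC[OF C] algebra_simps\<close>)
  have p1: "psd_form scaleC b1" unfolding b1_def[abs_def]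
    by (rule psd_defect[OF A2]) (use pos[OF R1] in \<open>simp only: S1\<close>)
  have p2: "psd_form scaleC b2" unfolding b2_def[abs_def]
    by (rule psd_defect[OF A1]) (use pos[OF R2] in \<open>simp only: S2\<close>)
  have rank: "\<exists>r. \<forall>d e. psd_form.orthonormal b' d e \<longrightarrow> d \<le> r"
    if b': "psd_form scaleC b'" "\<And>x y. cinner (szego_inverse (Suc m) R x) y = b' x y"
      and R: "finite_cdim (defect_space (Suc m) R)" for b' R
  proof -
    obtain F where F: "finite F" "defect_space (Suc m) R \<subseteq> chilbert.span F"
      using R by (auto simp: finite_cdim_def)
    then have "range (szego_inverse (Suc m) R) \<subseteq> chilbert.span F"
      using closure_subset by (fastforce simp: defect_space_def)
    then show ?thesis using orthonormal_le_card[OF b' F(1)] by blast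
  qed
  have fin1: "finite_cdim (defect_space (Suc m) R1)" and fin2: "finite_cdim (defect_space (Suc m) R2)"
    using fin unfolding finite_rank_def R1_def R2_def nm(2) by simp_all
  have S1': "cinner (szego_inverse (Suc m) R1 x) y = b1 x y" for x y by (simp add: S1 b1_def)
  have S2': "cinner (szego_inverse (Suc m) R2 x) y = b2 x y" for x y by (simp add: S2 b2_def)
  obtain r1 where r1: "\<And>d e. psd_form.orthonormal b1 d e \<Longrightarrow> d \<le> r1"
    using rank[OF p1 S1' fin1] by blast
  obtain r2 where r2: "\<And>d e. psd_form.orthonormal b2 d e \<Longrightarrow> d \<le> r2"
    using rank[OF p2 S2' fin2] by blast
  obtain N d U \<phi> where real: "realized_pair scaleC b N d U (A 1) (A 2) \<phi>"
    and out: "(\<And>x. (\<lambda>k. Re (b ((A 1 ^^ k) x) ((A 1 ^^ k) x))) \<longlonglongrightarrow> 0) \<Longrightarrow> outer_stable N d U"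
  proof (rule realization_exists[OF psd p1 p2, of "A 1" "A 2" r1 r2])
  qed (use r1 r2 b_lim2 in \<open>auto simp: A12 b1_def b2_def clinear_op_add[OF A1] clinear_op_scaleC[OF A1] clinear_op_add[OF A2] clinear_op_scaleC[OF A2]
    simp del: One_nat_def\<close>)
  interpret P: realized_pair scaleC b N d U "A 1" "A 2" \<phi> by (rule real)
  have "colligation N d U" by unfold_locales
  moreover have "outer_stable N d U" if "pure_contraction (T 1)"
    by (rule out, rule b_lim) (use that in \<open>simp add: pure_contraction_def A_def\<close>)
  moreover have "norm (eval_tuple n f T h) \<le> M * norm h"
    if M: "0 \<le> M" and bound: "\<And>z. z \<in> {1..n} \<rightarrow>\<^sub>E sphere 0 1 \<Longrightarrow> (z 1, z 2) \<in> P.curve \<Longrightarrow> norm (eval_point n f z) \<le> M"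
    for f M h
  proof -
    let ?K = "Poly_Mapping.keys f" and ?c = "Poly_Mapping.lookup f" and ?l = "Poly_Mapping.lookup"
    let ?G = "\<lambda>j z h. adjoint_eval n f (scalar_tuple j z A) h"
    have top: "Re (dform m B (?G m z h) (?G m z h)) \<le> M\<^sup>2 * Re (dform m B h h)" if z: "\<And>i. norm (z i) = 1" for z h
    proof -
      let ?p = "\<lambda>k. \<Prod>i=3..n. z i ^ ?l k i"
      have "?G m z h = (\<Sum>k\<in>?K. scaleC (cnj (?c k * ?p k)) ((A 1 ^^ ?l k 1) ((A 2 ^^ ?l k 2) h)))"
        unfolding adjoint_eval_def nm(1) tuple_power_scalar[OF A1 A2] by (simp add: scaleC_scaleC)
      moreover have "b.sq (\<Sum>k\<in>?K. scaleC (cnj (?c k * ?p k)) ((A 1 ^^ ?l k 1) ((A 2 ^^ ?l k 2) h))) \<le> M\<^sup>2 * b.sq h"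
      proof (rule P.pair_bound[OF finite_keys M])
        fix \<kappa> \<zeta> assume k: "norm \<kappa> = 1" "norm \<zeta> = 1" "(\<kappa>, \<zeta>) \<in> P.curve"
        define Z where "Z = (\<lambda>i\<in>{1..n}. if i = 1 then \<kappa> else if i = 2 then \<zeta> else z i)"
        have Z12: "Z 1 = \<kappa>" "Z 2 = \<zeta>" using n by (simp_all add: Z_def)
        have "Z \<in> {1..n} \<rightarrow>\<^sub>E sphere 0 1" using k z by (auto simp: Z_def)
        then have "norm (eval_point n f Z) \<le> M" using k Z12 by (intro bound) simp_all
        moreover have "(\<Prod>i=1..n. Z i ^ ?l k i) = \<kappa> ^ ?l k 1 * (\<zeta> ^ ?l k 2 * ?p k)" for k
        proof -
          have "{1..n} = insert 1 (insert 2 {3..n})" using n by auto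
          moreover have "(\<Prod>i=3..n. Z i ^ ?l k i) = ?p k" by (rule prod.cong) (auto simp: Z_def)
          ultimately show ?thesis by (simp add: Z12 Z12[simplified])
        qed
        ultimately show "norm (\<Sum>k\<in>?K. ?c k * ?p k * \<kappa> ^ ?l k 1 * \<zeta> ^ ?l k 2) \<le> M"
          by (simp add: eval_point_def mult_ac)
      qed
      ultimately show ?thesis by (simp only: b.sq_def b_def[symmetric])
    qed
    have all: "Re (dform j B (?G j z h) (?G j z h)) \<le> M\<^sup>2 * Re (dform j B h h)"
      if "j \<le> m" "\<And>i. norm (z i) = 1" for j z h
      using that
    proof (induction j arbitrary: z h rule: inc_induct)
      case base
      then show ?case by (intro top)
    next
      case (step j)
      have pB: "(\<lambda>k. norm ((A (Suc j + 2) ^^ k) x)) \<longlonglongrightarrow> 0" for x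
        by (rule pure) (use step.hyps nm in auto)
      show ?case
        unfolding B_def[abs_def]
        by (rule scalars_to_operators)
           (use step nm nonneg[of j] nonneg[of "Suc j"] pB in \<open>auto simp: B_def[abs_def] simp del: dform.simps\<close>)
    qed
    have "scalar_tuple 0 (\<lambda>_. 1) A = A" by (intro ext) (auto simp: scalar_tuple_def)
    then have sq_le: "(norm (adjoint_eval n f A h))\<^sup>2 \<le> (M * norm h)\<^sup>2" for h
      using all[of 0 "\<lambda>_. 1" h] by (simp add: cinner_self power_mult_distrib)
    have adj: "norm (adjoint_eval n f A h) \<le> M * norm h" for h
      by (rule power2_le_imp_le[OF sq_le]) (use M in simp)
    let ?x = "eval_tuple n f T h"
    have "cinner h (adjoint_eval n f A ?x) = of_real ((norm ?x)\<^sup>2)"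
      using cinner_eval_tuple[OF Tc, of f h ?x] by (simp add: A_def[abs_def] cinner_self)
    then have "(norm ?x)\<^sup>2 = norm (cinner h (adjoint_eval n f A ?x))"
      by (simp only: norm_of_real) simp
    also have "\<dots> \<le> norm h * (M * norm ?x)"
      by (rule order_trans[OF norm_cinner_le mult_left_mono[OF adj]]) simp
    finally have "norm ?x * norm ?x \<le> (M * norm h) * norm ?x" by (simp add: power2_eq_square mult_ac)
    then show ?thesis using M by (cases "norm ?x = 0") auto
  qed
  ultimately show thesis by (rule that)
qed


section \<open>The curve as a distinguished variety\<close>

definition monomial :: "nat \<Rightarrow> (nat \<Rightarrow>\<^sub>0 nat) \<Rightarrow> (nat \<Rightarrow> complex) \<Rightarrow> complex" where
  "monomial n k z = (\<Prod>i=1..n. z i ^ Poly_Mapping.lookup k i)"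

lemma eval_point_superset:
  assumes "finite S" "Poly_Mapping.keys f \<subseteq> S"
  shows "eval_point n f z = (\<Sum>k\<in>S. Poly_Mapping.lookup f k * monomial n k z)"
  unfolding eval_point_def monomial_def
  by (rule sum.mono_neutral_left) (use assms in \<open>auto simp: in_keys_iff\<close>)

lemma eval_point_add: "eval_point n (f + g) z = eval_point n f z + eval_point n g z"
proof -
  let ?S = "Poly_Mapping.keys f \<union> Poly_Mapping.keys g"
  have "eval_point n h z = (\<Sum>k\<in>?S. Poly_Mapping.lookup h k * monomial n k z)" if "h \<in> {f, g, f + g}" for h
    using that keys_add[of f g] by (intro eval_point_superset) auto
  then show ?thesis by (simp add: lookup_add distrib_right sum.distrib)
qed

lemma eval_point_0: "eval_point n 0 z = 0"
  by (simp add: eval_point_def)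

lemma eval_point_sum: "eval_point n (\<Sum>s\<in>S. f s) z = (\<Sum>s\<in>S. eval_point n (f s) z)"
  by (induction S rule: infinite_finite_induct) (auto simp: eval_point_0 eval_point_add)

lemma eval_point_single: "eval_point n (Poly_Mapping.single k c) z = c * monomial n k z"
  by (subst eval_point_superset[of "{k}"]) auto

lemma monomial_add: "monomial n (k + l) z = monomial n k z * monomial n l z"
  by (simp add: monomial_def lookup_add power_add prod.distrib)

lemma poly_mapping_expand: "f = (\<Sum>k\<in>Poly_Mapping.keys f. Poly_Mapping.single k (Poly_Mapping.lookup f k))"
  for f :: cmpoly
proof (rule poly_mapping_eqI)
  fix k
  have "Poly_Mapping.lookup (\<Sum>k\<in>Poly_Mapping.keys f. Poly_Mapping.single k (Poly_Mapping.lookup f k)) k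
     = (\<Sum>l\<in>Poly_Mapping.keys f. if l = k then Poly_Mapping.lookup f k else 0)"
    unfolding lookup_sum by (rule sum.cong) (auto simp: lookup_single)
  also have "\<dots> = Poly_Mapping.lookup f k" by (auto simp: sum.delta in_keys_iff)
  finally show "Poly_Mapping.lookup f k
    = Poly_Mapping.lookup (\<Sum>k\<in>Poly_Mapping.keys f. Poly_Mapping.single k (Poly_Mapping.lookup f k)) k" by simp
qed

lemma eval_point_mult: "eval_point n (f * g) z = eval_point n f z * eval_point n g z"
proof -
  let ?s = "\<lambda>h k. Poly_Mapping.single k (Poly_Mapping.lookup h k) :: cmpoly"
  have "f * g = (\<Sum>k\<in>Poly_Mapping.keys f. ?s f k) * (\<Sum>l\<in>Poly_Mapping.keys g. ?s g l)"
    using poly_mapping_expand[of f] poly_mapping_expand[of g] by simp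
  also have "\<dots> = (\<Sum>k\<in>Poly_Mapping.keys f. \<Sum>l\<in>Poly_Mapping.keys g.
      Poly_Mapping.single (k + l) (Poly_Mapping.lookup f k * Poly_Mapping.lookup g l))"
    by (simp add: sum_product mult_single)
  finally have "eval_point n (f * g) z = (\<Sum>k\<in>Poly_Mapping.keys f. \<Sum>l\<in>Poly_Mapping.keys g.
      (Poly_Mapping.lookup f k * Poly_Mapping.lookup g l) * (monomial n k z * monomial n l z))"
    by (simp only: eval_point_sum eval_point_single monomial_add)
  also have "\<dots> = eval_point n f z * eval_point n g z"
    unfolding eval_point_def monomial_def[symmetric] sum_product
    by (intro sum.cong refl) (simp add: mult_ac)
  finally show ?thesis .
qed

text \<open>One polynomial represents the function for every number \<open>n \<ge> 2\<close> of variables, so that it defines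
  varieties both in the bidisc and in the closed polydisc.\<close>

definition polynomial2 :: "(complex \<Rightarrow> complex \<Rightarrow> complex) \<Rightarrow> bool" where
  "polynomial2 F \<longleftrightarrow> (\<exists>g\<in>polys 2. \<forall>n\<ge>2. \<forall>z. eval_point n g z = F (z 1) (z 2))"

lemma polynomial2_const: "polynomial2 (\<lambda>x y. c)"
  unfolding polynomial2_def
  by (rule bexI[of _ "Poly_Mapping.single 0 c"]) (auto simp: eval_point_single monomial_def polys_def)

lemma polynomial2_fst: "polynomial2 (\<lambda>x y. x)"
  and polynomial2_snd: "polynomial2 (\<lambda>x y. y)"
proof -
  have m: "monomial n (Poly_Mapping.single j 1) z = z j" if "j \<in> {1..n}" for n j z
  proof -
    have "monomial n (Poly_Mapping.single j 1) z = (\<Prod>i=1..n. if i = j then z j else 1)"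
      unfolding monomial_def by (rule prod.cong) (auto simp: lookup_single)
    then show ?thesis using that by (simp add: prod.delta)
  qed
  show "polynomial2 (\<lambda>x y. x)"
    unfolding polynomial2_def
    by (rule bexI[of _ "Poly_Mapping.single (Poly_Mapping.single 1 1) 1"])
       (auto simp: eval_point_single m polys_def simp del: One_nat_def)
  show "polynomial2 (\<lambda>x y. y)"
    unfolding polynomial2_def
    by (rule bexI[of _ "Poly_Mapping.single (Poly_Mapping.single 2 1) 1"])
       (auto simp: eval_point_single m polys_def simp del: One_nat_def)
qed

lemma polynomial2_add: "polynomial2 F \<Longrightarrow> polynomial2 G \<Longrightarrow> polynomial2 (\<lambda>x y. F x y + G x y)"
proof -
  assume "polynomial2 F" "polynomial2 G"
  then obtain f g where fg: "f \<in> polys 2" "g \<in> polys 2"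
    "\<And>n z. n \<ge> 2 \<Longrightarrow> eval_point n f z = F (z 1) (z 2)" "\<And>n z. n \<ge> 2 \<Longrightarrow> eval_point n g z = G (z 1) (z 2)"
    unfolding polynomial2_def by blast
  have "f + g \<in> polys 2" using fg(1,2) keys_add[of f g] by (auto simp: polys_def)
  then show ?thesis unfolding polynomial2_def
    by (rule bexI[rotated]) (simp add: eval_point_add fg(3,4))
qed

lemma polynomial2_mult: "polynomial2 F \<Longrightarrow> polynomial2 G \<Longrightarrow> polynomial2 (\<lambda>x y. F x y * G x y)"
proof -
  assume "polynomial2 F" "polynomial2 G"
  then obtain f g where fg: "f \<in> polys 2" "g \<in> polys 2"
    "\<And>n z. n \<ge> 2 \<Longrightarrow> eval_point n f z = F (z 1) (z 2)" "\<And>n z. n \<ge> 2 \<Longrightarrow> eval_point n g z = G (z 1) (z 2)"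
    unfolding polynomial2_def by blast
  have "f * g \<in> polys 2"
    unfolding polys_def
  proof (intro CollectI ballI)
    fix k assume "k \<in> Poly_Mapping.keys (f * g)"
    then obtain a b where "k = a + b" "a \<in> Poly_Mapping.keys f" "b \<in> Poly_Mapping.keys g"
      using keys_mult[of f g] by blast
    then show "Poly_Mapping.keys k \<subseteq> {1..2}" using fg(1,2) keys_add[of a b] unfolding polys_def by blast
  qed
  then show ?thesis unfolding polynomial2_def
    by (rule bexI[rotated]) (simp add: eval_point_mult fg(3,4))
qed

lemma polynomial2_sum: "(\<And>s. s \<in> S \<Longrightarrow> polynomial2 (F s)) \<Longrightarrow> polynomial2 (\<lambda>x y. \<Sum>s\<in>S. F s x y)"
  by (induction S rule: infinite_finite_induct) (auto intro: polynomial2_const polynomial2_add)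

lemma polynomial2_prod: "(\<And>s. s \<in> S \<Longrightarrow> polynomial2 (F s)) \<Longrightarrow> polynomial2 (\<lambda>x y. \<Prod>s\<in>S. F s x y)"
  by (induction S rule: infinite_finite_induct) (auto intro: polynomial2_const polynomial2_mult)

lemma continuous_on_eval_point:
  assumes "\<And>i. i \<in> {1..n} \<Longrightarrow> continuous_on S (\<lambda>p. Z p i)"
  shows "continuous_on S (\<lambda>p. eval_point n g (Z p))"
  unfolding eval_point_def by (intro continuous_intros assms)

lemma holomorphic_on_eval_point:
  assumes "\<And>i. i \<in> {1..n} \<Longrightarrow> (\<lambda>p. Z p i) holomorphic_on S"
  shows "(\<lambda>p. eval_point n g (Z p)) holomorphic_on S"
  unfolding eval_point_def by (intro holomorphic_intros assms)

lemma frontier_bidisc: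
  "frontier (ball 0 1 \<times> ball (0::complex) 1) = (cball (0::complex) 1 \<times> sphere 0 1) \<union> (sphere 0 1 \<times> cball 0 1)"
  unfolding frontier_def closure_Times interior_Times by (auto simp: not_less)

context colligation
begin

text \<open>Points of the curve are the parameters for which a matrix with polynomial entries is singular.\<close>

lemma curve_algebraic:
  obtains g where "g \<in> polys 2" "\<And>n z. n \<ge> 2 \<Longrightarrow> eval_point n g z = 0 \<longleftrightarrow> (z 1, z 2) \<in> curve"
proof -
  define M where "M \<kappa> \<zeta> i j = U i j * (if j < d then 1 else \<zeta>) + (- 1) * (if i = j then if j < d then \<kappa> else 1 else 0)" for \<kappa> \<zeta> i j
  define D where "D \<kappa> \<zeta> = det (Matrix.mat N N (\<lambda>(i, j). M \<kappa> \<zeta> i j))" for \<kappa> \<zeta>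
  have entry: "polynomial2 (\<lambda>x y. M x y i j)" for i j
    unfolding M_def
    by (intro polynomial2_add polynomial2_mult polynomial2_const)
       (cases "j < d"; cases "i = j"; simp add: polynomial2_const polynomial2_fst polynomial2_snd)+
  have "D = (\<lambda>x y. \<Sum>p | p permutes {0..<N}. signof p * (\<Prod>i=0..<N. M x y i (p i)))"
  proof (intro ext)
    fix x y
    show "D x y = (\<Sum>p | p permutes {0..<N}. signof p * (\<Prod>i=0..<N. M x y i (p i)))"
      unfolding D_def det_def
      by (auto intro!: sum.cong prod.cong simp: permutes_in_image)
  qed
  moreover have "polynomial2 (\<lambda>x y. \<Sum>p | p permutes {0..<N}. signof p * (\<Prod>i=0..<N. M x y i (p i)))"
    by (intro polynomial2_sum polynomial2_mult polynomial2_const polynomial2_prod entry)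
  ultimately have "polynomial2 D" by simp
  then obtain g where g: "g \<in> polys 2" "\<And>n z. n \<ge> 2 \<Longrightarrow> eval_point n g z = D (z 1) (z 2)"
    unfolding polynomial2_def by blast
  have "D \<kappa> \<zeta> = 0 \<longleftrightarrow> (\<kappa>, \<zeta>) \<in> curve" for \<kappa> \<zeta>
  proof -
    have "(\<Sum>j<N. M \<kappa> \<zeta> a j * u j) = step \<zeta> u a - join d (\<lambda>j. \<kappa> * u j) u a" if a: "a < N" for a u
    proof -
      have "(\<Sum>j<N. M \<kappa> \<zeta> a j * u j)
        = (\<Sum>j<N. U a j * join d u (\<lambda>j. \<zeta> * u j) j - (if j = a then join d (\<lambda>j. \<kappa> * u j) u a else 0))"
        by (rule sum.cong) (auto simp: M_def join_def algebra_simps)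
      then show ?thesis using a by (simp add: step_def mapply_def sum_subtractf sum.delta)
    qed
    then show ?thesis
      unfolding D_def det_eq_0_iff_kernel curve_def eigenvector_def by auto
  qed
  then show thesis using that g by simp
qed

text \<open>The two sides of the eigenvalue equation have equal norms because \<open>U\<close> is isometric. The position of the
  curve relative to the bidisc and its boundary follows from this identity and the two
  stability conditions.\<close>

lemma curve_energy:
  assumes "eigenvector \<kappa> \<zeta> u"
  shows "(1 - (norm \<kappa>)\<^sup>2) * norm2 {..<d} u = (1 - (norm \<zeta>)\<^sup>2) * norm2 {d..<N} u"
proof -
  have "norm2 {..<d} u + norm2 {d..<N} (\<lambda>j. \<zeta> * u j) = norm2 {..<d} (\<lambda>j. \<kappa> * u j) + norm2 {d..<N} u"
    by (rule io_energy) (use assms in \<open>simp add: eigenvector_def step_def\<close>)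
  then show ?thesis by (simp add: norm2_scale algebra_simps)
qed

lemma curve_unimodular:
  assumes "(\<kappa>, \<zeta>) \<in> curve" "norm \<zeta> = 1"
  shows "norm \<kappa> = 1"
proof (rule ccontr)
  assume k: "norm \<kappa> \<noteq> 1"
  obtain u where u: "\<exists>a<N. u a \<noteq> 0" "eigenvector \<kappa> \<zeta> u" using assms(1) by (auto simp: curve_def)
  have "(1 - (norm \<kappa>)\<^sup>2) * norm2 {..<d} u = 0" using curve_energy[OF u(2)] assms(2) by simp
  moreover have "(norm \<kappa>)\<^sup>2 \<noteq> 1" using k norm_ge_zero[of \<kappa>] by (auto simp: power2_eq_1_iff simp del: norm_ge_zero)
  ultimately have x0: "u a = 0" if "a < d" for a using that by (simp add: norm2_eq_0_iff)
  have eq: "join d u w = join d (\<lambda>_. 0) w" "join d (\<lambda>j. \<kappa> * u j) w = join d (\<lambda>_. 0) w" for w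
    using x0 by (auto simp: join_def)
  have "u a = 0" if "d \<le> a" "a < N" for a
    by (rule stable[OF assms(2) _ that]) (use u(2) in \<open>simp add: eigenvector_def step_def eq\<close>)
  then show False using u(1) x0 not_less by blast
qed

lemma curve_contractive:
  assumes out: "outer_stable N d U" and "(\<kappa>, \<zeta>) \<in> curve" "norm \<zeta> < 1"
  shows "norm \<kappa> < 1"
proof (rule ccontr)
  assume k: "\<not> norm \<kappa> < 1"
  obtain u where u: "\<exists>a<N. u a \<noteq> 0" "eigenvector \<kappa> \<zeta> u" using assms(2) by (auto simp: curve_def)
  have z2: "1 - (norm \<zeta>)\<^sup>2 > 0" using assms(3) by (simp add: abs_square_less_1)
  have k2: "1 - (norm \<kappa>)\<^sup>2 \<le> 0" using k by (simp add: one_le_power)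
  have "(1 - (norm \<zeta>)\<^sup>2) * norm2 {d..<N} u \<le> 0"
    using curve_energy[OF u(2)] mult_nonpos_nonneg[OF k2 norm2_nonneg[of "{..<d}" u]] by simp
  then have y: "norm2 {d..<N} u = 0"
    using z2 norm2_nonneg[of "{d..<N}" u] by (simp add: mult_le_0_iff)
  then have y0: "u a = 0" if "d \<le> a" "a < N" for a using that by (simp add: norm2_eq_0_iff)
  have "(1 - (norm \<kappa>)\<^sup>2) * norm2 {..<d} u = 0" using curve_energy[OF u(2)] y by simp
  moreover have "norm2 {..<d} u \<noteq> 0"
    using u(1) y0 by (auto simp: norm2_eq_0_iff) (metis lessThan_iff not_le)
  ultimately have "(norm \<kappa>)\<^sup>2 = 1" by simp
  then have k1: "norm \<kappa> = 1" using norm_ge_zero[of \<kappa>] by (auto simp: power2_eq_1_iff simp del: norm_ge_zero)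
  have "mapply N U (join d u (\<lambda>_. 0)) a = join d (\<lambda>j. \<kappa> * u j) (\<lambda>_. 0) a" if a: "a < N" for a
  proof -
    have "mapply N U (join d u (\<lambda>_. 0)) = mapply N U (join d u (\<lambda>j. \<zeta> * u j))"
      by (rule mapply_cong) (use y0 in \<open>auto simp: join_def\<close>)
    then show ?thesis using u(2) a y0[of a] by (simp add: eigenvector_def step_def join_def)
  qed
  then have "\<forall>a<d. u a = 0" using out k1 unfolding outer_stable_def by blast
  then show False using u(1) y0 not_less by blast
qed

text \<open>Near \<open>\<zeta>0\<close> inside the disc every point of the curve has its first coordinate in the disc as well, so
  it suffices to find zeros \<open>\<kappa>\<close> of the defining polynomial near \<open>\<kappa>0\<close> at frequencies \<open>\<zeta>\<close> that tend to
  \<open>\<zeta>0\<close>. Hurwitz's theorem provides them: the polynomial at \<open>\<zeta>0\<close> is not constant near \<open>\<kappa>0\<close>, because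
  its zeros there are unimodular.\<close>

lemma curve_torus_in_closure:
  assumes out: "outer_stable N d U" and c: "(\<kappa>0, \<zeta>0) \<in> curve" and 1: "norm \<kappa>0 = 1" "norm \<zeta>0 = 1"
  shows "(\<kappa>0, \<zeta>0) \<in> closure (curve \<inter> (ball 0 1 \<times> ball 0 1))"
proof (rule ccontr)
  let ?W = "curve \<inter> (ball 0 1 \<times> ball 0 1)"
  assume "(\<kappa>0, \<zeta>0) \<notin> closure ?W"
  define S where "S = - closure ?W"
  have S: "open S" "S \<inter> ?W = {}" using closure_subset[of ?W] by (auto simp: S_def)
  have "(\<kappa>0, \<zeta>0) \<in> S" using \<open>(\<kappa>0, \<zeta>0) \<notin> closure ?W\<close> by (simp add: S_def)
  with S(1) obtain A B where AB: "open A" "open B" "\<kappa>0 \<in> A" "\<zeta>0 \<in> B" "A \<times> B \<subseteq> S"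
    by (auto elim: open_prod_elim)
  obtain r where r: "r > 0" "ball \<kappa>0 r \<subseteq> A" using AB(1,3) open_contains_ball by blast
  obtain s where s: "s > 0" "ball \<zeta>0 s \<subseteq> B" using AB(2,4) open_contains_ball by blast
  obtain g where g: "g \<in> polys 2" "\<And>n z. n \<ge> 2 \<Longrightarrow> eval_point n g z = 0 \<longleftrightarrow> (z 1, z 2) \<in> curve"
    using curve_algebraic by blast
  define F where "F \<kappa> \<zeta> = eval_point 2 g (\<lambda>i. if i = 1 then \<kappa> else \<zeta>)" for \<kappa> \<zeta>
  have F0: "F \<kappa> \<zeta> = 0 \<longleftrightarrow> (\<kappa>, \<zeta>) \<in> curve" for \<kappa> \<zeta> using g(2)[of 2] by (simp add: F_def)
  define e where "e = min s 1"
  define \<zeta> where "\<zeta> n = of_real (1 - e / real (n + 2)) * \<zeta>0" for n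
  have e: "e > 0" "e \<le> 1" "e \<le> s" using s by (auto simp: e_def)
  have frac: "0 < e / real (n + 2)" "e / real (n + 2) < 1" "e / real (n + 2) < s" for n
  proof -
    show "0 < e / real (n + 2)" using e by simp
    have "e / real (n + 2) < e / 1" using e by (intro divide_strict_left_mono) auto
    then show "e / real (n + 2) < 1" "e / real (n + 2) < s" using e by linarith+
  qed
  have z_lt: "norm (\<zeta> n) < 1" for n
    using frac[of n] by (simp add: \<zeta>_def norm_mult 1 del: of_real_diff)
  have z_B: "\<zeta> n \<in> B" for n
  proof -
    have "\<zeta>0 - \<zeta> n = of_real (e / real (n + 2)) * \<zeta>0" by (simp add: \<zeta>_def algebra_simps)
    then have "dist \<zeta>0 (\<zeta> n) = \<bar>e / real (n + 2)\<bar>" by (simp only: dist_norm norm_mult norm_of_real 1)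
    also have "\<dots> = e / real (n + 2)" by (rule abs_of_pos[OF frac(1)])
    finally have "dist \<zeta>0 (\<zeta> n) = e / real (n + 2)" .
    then show ?thesis using frac(3)[of n] s(2) by auto
  qed
  have z_lim: "\<zeta> \<longlonglongrightarrow> \<zeta>0"
  proof -
    have "(\<lambda>n. e / real (n + 2)) \<longlonglongrightarrow> 0"
      using LIMSEQ_ignore_initial_segment[OF lim_const_over_n[of e], of 2] by simp
    then have "\<zeta> \<longlonglongrightarrow> of_real (1 - 0) * \<zeta>0"
      unfolding \<zeta>_def by (intro tendsto_intros)
    then show ?thesis by simp
  qed
  have cont: "continuous_on X (\<lambda>p. F (snd p) (fst p))" for X
    unfolding F_def
  proof (rule continuous_on_eval_point)
    show "continuous_on X (\<lambda>p. if i = 1 then snd p else fst p)" for i :: nat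
      by (cases "i = 1") (auto intro!: continuous_intros)
  qed
  have hol: "(\<lambda>\<kappa>. F \<kappa> w) holomorphic_on X" for w X
    unfolding F_def
  proof (rule holomorphic_on_eval_point)
    show "(\<lambda>\<kappa>. if i = 1 then \<kappa> else w) holomorphic_on X" for i :: nat
      by (cases "i = 1") (auto intro!: holomorphic_intros)
  qed
  have "F \<kappa>0 \<zeta>0 \<noteq> 0"
  proof (rule Hurwitz_no_zeros[of "ball \<kappa>0 r" "\<lambda>n \<kappa>. F \<kappa> (\<zeta> n)" "\<lambda>\<kappa>. F \<kappa> \<zeta>0" \<kappa>0])
    fix K assume K: "compact K" "K \<subseteq> ball \<kappa>0 r"
    show "uniform_limit K (\<lambda>n \<kappa>. F \<kappa> (\<zeta> n)) (\<lambda>\<kappa>. F \<kappa> \<zeta>0) sequentially"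
    proof (rule uniform_limitI)
      fix \<epsilon> :: real assume eps: "\<epsilon> > 0"
      obtain X0 where X0: "\<zeta>0 \<in> X0" "open X0"
        "\<forall>x\<in>X0 \<inter> UNIV. \<forall>t\<in>K. dist (F (snd (x, t)) (fst (x, t))) (F (snd (\<zeta>0, t)) (fst (\<zeta>0, t))) \<le> \<epsilon> / 2"
        using continuous_on_prod_compactE[OF cont[of "UNIV \<times> K"] K(1), of \<zeta>0 "\<epsilon> / 2"] eps by auto
      have "\<forall>\<^sub>F n in sequentially. \<zeta> n \<in> X0" by (rule topological_tendstoD[OF z_lim X0(2,1)])
      then show "\<forall>\<^sub>F n in sequentially. \<forall>\<kappa>\<in>K. dist (F \<kappa> (\<zeta> n)) (F \<kappa> \<zeta>0) < \<epsilon>"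
        by eventually_elim (use X0(3) eps in fastforce)
    qed
  next
    show "\<not> (\<lambda>\<kappa>. F \<kappa> \<zeta>0) constant_on ball \<kappa>0 r"
    proof
      assume "(\<lambda>\<kappa>. F \<kappa> \<zeta>0) constant_on ball \<kappa>0 r"
      then obtain y where y: "\<And>\<kappa>. \<kappa> \<in> ball \<kappa>0 r \<Longrightarrow> F \<kappa> \<zeta>0 = y" by (auto simp: constant_on_def)
      define t where "t = min r 1 / 2"
      define \<kappa> where "\<kappa> = of_real (1 - t) * \<kappa>0"
      have t: "0 < t" "t < 1" "t < r" using r by (auto simp: t_def)
      have "\<kappa>0 - \<kappa> = of_real t * \<kappa>0" by (simp add: \<kappa>_def algebra_simps)
      then have "\<kappa> \<in> ball \<kappa>0 r" using t by (simp add: dist_norm norm_mult 1)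
      then have "F \<kappa> \<zeta>0 = F \<kappa>0 \<zeta>0" using y r(1) by simp
      then have "(\<kappa>, \<zeta>0) \<in> curve" using F0 c by metis
      then have "norm \<kappa> = 1" using curve_unimodular 1(2) by blast
      moreover have "norm \<kappa> = 1 - t" using t by (simp add: \<kappa>_def norm_mult 1 del: of_real_diff)
      ultimately show False using t by simp
    qed
  next
    fix n \<kappa> assume k: "\<kappa> \<in> ball \<kappa>0 r"
    show "F \<kappa> (\<zeta> n) \<noteq> 0"
    proof
      assume "F \<kappa> (\<zeta> n) = 0"
      then have cu: "(\<kappa>, \<zeta> n) \<in> curve" by (simp add: F0)
      then have "norm \<kappa> < 1" by (rule curve_contractive[OF out _ z_lt])
      then have "(\<kappa>, \<zeta> n) \<in> ?W" using cu z_lt by simp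
      moreover have "(\<kappa>, \<zeta> n) \<in> S" using AB(5) r(2) k z_B by blast
      ultimately show False using S(2) by blast
    qed
  qed (use r in \<open>auto intro: hol\<close>)
  then show False using F0 c by simp
qed

lemma distinguished_curve:
  assumes out: "outer_stable N d U" and ne: "curve \<inter> (ball 0 1 \<times> ball 0 1) \<noteq> {}"
  shows "distinguished_variety (curve \<inter> (ball 0 1 \<times> ball 0 1))"
proof -
  let ?D = "ball 0 1 \<times> ball 0 1 :: (complex \<times> complex) set" and ?W = "curve \<inter> (ball 0 1 \<times> ball 0 1)"
  obtain g where g: "g \<in> polys 2" "\<And>n z. n \<ge> 2 \<Longrightarrow> eval_point n g z = 0 \<longleftrightarrow> (z 1, z 2) \<in> curve"
    using curve_algebraic by blast
  have W: "?W = {(z1, z2) \<in> ?D. eval_point 2 g (\<lambda>i. if i = 1 then z1 else z2) = 0}"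
    using g(2)[of 2] by auto
  have "closed {p. eval_point 2 g (\<lambda>i. if i = 1 then fst p else snd p) = 0}"
  proof (intro closed_Collect_eq continuous_on_eval_point continuous_on_const)
    show "continuous_on UNIV (\<lambda>p::complex \<times> complex. if i = 1 then fst p else snd p)" for i :: nat
      by (cases "i = 1") (auto intro!: continuous_intros)
  qed
  moreover have "{p. eval_point 2 g (\<lambda>i. if i = 1 then fst p else snd p) = 0} = curve"
    using g(2)[of 2] by auto
  ultimately have cl: "closed curve" by simp
  note fr = frontier_bidisc
  have "closure ?W \<subseteq> curve" using cl by (simp add: closure_minimal)
  moreover have "p \<in> sphere 0 1 \<times> sphere 0 1" if p: "p \<in> curve" "p \<in> frontier ?D" for p
  proof -
    obtain \<kappa> \<zeta> where pk: "p = (\<kappa>, \<zeta>)" by force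
    have "norm \<kappa> = 1 \<or> norm \<zeta> = 1" "norm \<zeta> \<le> 1" using p(2) unfolding fr pk by auto
    moreover have "norm \<kappa> < 1" if "norm \<zeta> < 1"
      using curve_contractive[OF out _ that, of \<kappa>] p(1) by (simp add: pk)
    ultimately have "norm \<zeta> = 1" by linarith
    then show ?thesis using curve_unimodular p(1) by (simp add: pk)
  qed
  moreover have "sphere 0 1 \<times> sphere 0 1 \<subseteq> frontier ?D" unfolding fr by auto
  ultimately have "closure ?W \<inter> frontier ?D = closure ?W \<inter> (sphere 0 1 \<times> sphere 0 1)" by blast
  then show ?thesis unfolding distinguished_variety_def using ne W g(1) by blast
qed

end

text \<open>The variety for the zero space, on which the curve of the tuple may be empty.\<close>

lemma distinguished_diagonal: "distinguished_variety {(z1, z2) \<in> ball 0 1 \<times> ball 0 1. z1 = z2}"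
proof -
  let ?D = "ball 0 1 \<times> ball 0 1 :: (complex \<times> complex) set"
  let ?W = "{(z1, z2) \<in> ?D. z1 = z2}"
  have "polynomial2 (\<lambda>x y. x + (- 1) * y)"
    by (intro polynomial2_add polynomial2_mult polynomial2_const polynomial2_fst polynomial2_snd)
  then obtain g where g: "g \<in> polys 2" "\<And>n z. n \<ge> 2 \<Longrightarrow> eval_point n g z = z 1 + (- 1) * z 2"
    unfolding polynomial2_def by blast
  have W: "?W = {(z1, z2) \<in> ?D. eval_point 2 g (\<lambda>i. if i = 1 then z1 else z2) = 0}"
    by (auto simp: g(2))
  note fr = frontier_bidisc
  have "closed {p::complex \<times> complex. fst p = snd p}" by (intro closed_Collect_eq continuous_intros)
  then have "closure ?W \<subseteq> {p. fst p = snd p}" by (intro closure_minimal) auto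
  then have "closure ?W \<inter> frontier ?D = closure ?W \<inter> (sphere 0 1 \<times> sphere 0 1)"
    unfolding fr by auto
  moreover have "(0, 0) \<in> ?W" by simp
  ultimately show ?thesis unfolding distinguished_variety_def using W g(1) by blast
qed

section \<open>The theorem\<close>

text \<open>The supremum may be infinite, and it is at least \<open>0\<close> because the set is nonempty.\<close>

lemma ereal_le_SUP:
  fixes F :: "'z \<Rightarrow> real"
  assumes ne: "V \<noteq> {}" and F: "\<And>z. z \<in> V \<Longrightarrow> 0 \<le> F z"
    and b: "\<And>M. 0 \<le> M \<Longrightarrow> (\<And>z. z \<in> V \<Longrightarrow> F z \<le> M) \<Longrightarrow> x \<le> M"
  shows "ereal x \<le> (SUP z\<in>V. ereal (F z))"
proof -
  have up: "ereal (F z) \<le> (SUP z\<in>V. ereal (F z))" if "z \<in> V" for z by (rule SUP_upper[OF that])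
  obtain z0 where z0: "z0 \<in> V" using ne by blast
  show ?thesis
  proof (cases "SUP z\<in>V. ereal (F z)")
    case (real r)
    have "F z \<le> r" if "z \<in> V" for z using up[OF that] real by simp
    then have "x \<le> r" using b[of r] F[OF z0] z0 order_trans by blast
    then show ?thesis using real by simp
  next
    case MInf
    then show ?thesis using up[OF z0] by simp
  qed simp
qed

lemma eval_tuple_1: "eval_tuple n 1 T h = h"
proof -
  have "tuple_power n T (\<lambda>_. 0) h = h" by (induction n) auto
  moreover have "scaleC 1 h = h" using scaleC_of_real[of 1 h] by simp
  ultimately show ?thesis by (simp add: eval_tuple_def lookup_one lookup_zero[abs_def])
qed

theorem theorem4p2:
  fixes n :: nat and T :: "nat \<Rightarrow> 'h::chilbert_space \<Rightarrow> 'h"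
  assumes "n \<ge> 3"
    and "T \<in> pq_tuples n 1 2"
    and "finite_rank n 1 2 T"
  shows "(\<exists>V. algebraic_variety n V \<and>
            (\<forall>f\<in>polys n. ereal (onorm (eval_tuple n f T)) \<le>
               (SUP z\<in>V. ereal (norm (eval_point n f z))))) \<and>
         (pure_contraction (T 1) \<longrightarrow>
            (\<exists>V'. distinguished_variety V' \<and>
               (\<forall>f\<in>polys n. ereal (onorm (eval_tuple n f T)) \<le>
                  (SUP z\<in>times_polydisc n V'. ereal (norm (eval_point n f z))))))"
proof (cases "\<exists>h::'h. h \<noteq> 0")
  \<comment> \<open>On the zero space the curve may be empty, and any nonempty variety will do.\<close>
  case False
  then have "eval_tuple n f T = (\<lambda>_. 0)" for f by auto
  then have z: "onorm (eval_tuple n f T) = 0" for f by (simp add: onorm_zero)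
  have le: "ereal (onorm (eval_tuple n f T)) \<le> (SUP z\<in>V. ereal (norm (eval_point n f z)))" if "V \<noteq> {}" for f V
    unfolding z by (rule ereal_le_SUP[OF that]) auto
  let ?V = "{1..n} \<rightarrow>\<^sub>E cball (0::complex) 1" and ?W = "{(z1, z2) \<in> ball 0 1 \<times> ball (0::complex) 1. z1 = z2}"
  have "algebraic_variety n ?V" unfolding algebraic_variety_def by (rule exI[of _ "{}"]) auto
  moreover have "(\<lambda>i\<in>{1..n}. 0) \<in> ?V" by auto
  moreover have "(\<lambda>i\<in>{1..n}. 0) \<in> times_polydisc n ?W" using assms(1) by (auto simp: times_polydisc_def)
  ultimately show ?thesis using le distinguished_diagonal by blast
next
  case True
  then obtain h0 :: 'h where h0: "h0 \<noteq> 0" by blast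
  obtain N d U where col: "colligation N d U" and out: "pure_contraction (T 1) \<Longrightarrow> outer_stable N d U"
    and bound: "\<And>f M h. 0 \<le> M \<Longrightarrow> (\<And>z. z \<in> {1..n} \<rightarrow>\<^sub>E sphere 0 1 \<Longrightarrow> (z 1, z 2) \<in> colligation.curve N d U \<Longrightarrow>
        norm (eval_point n f z) \<le> M) \<Longrightarrow> norm (eval_tuple n f T h) \<le> M * norm h"
    using spectral_bound[OF assms] by blast
  interpret colligation N d U by (rule col)
  \<comment> \<open>If the curve had no point on the torus, then the bound would hold with \<open>M = 0\<close> for the constant \<open>1\<close>.\<close>
  obtain g where g: "g \<in> polys 2" "\<And>n z. n \<ge> 2 \<Longrightarrow> eval_point n g z = 0 \<longleftrightarrow> (z 1, z 2) \<in> curve"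
    using curve_algebraic by blast
  have "\<exists>z. z \<in> {1..n} \<rightarrow>\<^sub>E sphere 0 1 \<and> (z 1, z 2) \<in> curve"
  proof (rule ccontr)
    assume "\<not> ?thesis"
    then have "norm (eval_tuple n 1 T h0) \<le> 0 * norm h0" by (intro bound) auto
    then show False using h0 by (simp add: eval_tuple_1)
  qed
  then obtain z0 where z0: "z0 \<in> {1..n} \<rightarrow>\<^sub>E sphere 0 1" "(z0 1, z0 2) \<in> curve" by blast
  have onorm_le: "onorm (eval_tuple n f T) \<le> M"
    if "0 \<le> M" "\<And>z. z \<in> {1..n} \<rightarrow>\<^sub>E sphere 0 1 \<Longrightarrow> (z 1, z 2) \<in> curve \<Longrightarrow> norm (eval_point n f z) \<le> M" for f M
    using that by (intro onorm_bound bound)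
  show ?thesis
  proof (intro conjI impI)
    define V where "V = {z \<in> {1..n} \<rightarrow>\<^sub>E cball 0 1. (z 1, z 2) \<in> curve}"
    have "g \<in> polys n" using g(1) assms(1) by (fastforce simp: polys_def)
    then have "algebraic_variety n V"
      unfolding algebraic_variety_def V_def using assms(1) by (intro exI[of _ "{g}"]) (auto simp: g(2))
    moreover have sub: "z \<in> V" if "z \<in> {1..n} \<rightarrow>\<^sub>E sphere 0 1" "(z 1, z 2) \<in> curve" for z
      using that PiE_mono[of "{1..n}" "\<lambda>_. sphere (0::complex) 1" "\<lambda>_. cball 0 1"] by (auto simp: V_def)
    have "ereal (onorm (eval_tuple n f T)) \<le> (SUP z\<in>V. ereal (norm (eval_point n f z)))" for f
    proof (rule ereal_le_SUP)
      show "V \<noteq> {}" using sub z0 by blast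
    qed (auto intro!: onorm_le sub)
    ultimately show "\<exists>V. algebraic_variety n V \<and> (\<forall>f\<in>polys n. ereal (onorm (eval_tuple n f T)) \<le>
               (SUP z\<in>V. ereal (norm (eval_point n f z))))" by blast
  next
    assume "pure_contraction (T 1)"
    then have stable1: "outer_stable N d U" by (rule out)
    define W where "W = curve \<inter> (ball 0 1 \<times> ball 0 1)"
    have torus: "\<exists>w. (\<forall>j. w j \<in> W) \<and> w \<longlonglongrightarrow> (z 1, z 2)"
      if z: "z \<in> {1..n} \<rightarrow>\<^sub>E sphere 0 1" "(z 1, z 2) \<in> curve" for z
    proof -
      have "z 1 \<in> sphere 0 1" "z 2 \<in> sphere 0 1" using z(1) assms(1) by (auto intro!: PiE_mem[OF z(1)])
      then have "(z 1, z 2) \<in> closure W"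
        unfolding W_def by (intro curve_torus_in_closure[OF stable1 z(2)]) auto
      then show ?thesis unfolding closure_sequential by blast
    qed
    have "W \<noteq> {}" using torus[OF z0] by blast
    then have dist: "distinguished_variety W"
      unfolding W_def by (intro distinguished_curve[OF stable1])
    have approx: "\<exists>Z. (\<forall>j. Z j \<in> times_polydisc n W) \<and> (\<lambda>j. eval_point n f (Z j)) \<longlonglongrightarrow> eval_point n f z"
      if z: "z \<in> {1..n} \<rightarrow>\<^sub>E sphere 0 1" "(z 1, z 2) \<in> curve" for z f
    proof -
      obtain w where w: "\<And>j. w j \<in> W" "w \<longlonglongrightarrow> (z 1, z 2)" using torus[OF z] by blast
      define r where "r j = 1 - 1 / real (j + 2)" for j
      have r: "0 \<le> r j" "r j < 1" for j by (simp_all add: r_def field_simps)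
      have r_lim: "r \<longlonglongrightarrow> 1 - 0"
        unfolding r_def
        using LIMSEQ_ignore_initial_segment[OF lim_const_over_n[of 1], of 2] by (intro tendsto_intros) simp
      define Z where "Z j = (\<lambda>i\<in>{1..n}. if i = 1 then fst (w j) else if i = 2 then snd (w j) else of_real (r j) * z i)" for j
      have Z12: "(Z j 1, Z j 2) = w j" for j using assms(1) by (simp add: Z_def)
      have nz: "norm (z i) = 1" if "i \<in> {1..n}" for i using PiE_mem[OF z(1) that] by simp
      have "Z j \<in> {1..n} \<rightarrow>\<^sub>E ball 0 1" for j
      proof (rule PiE_I)
        fix i assume i: "i \<in> {1..n}"
        have "fst (w j) \<in> ball 0 1" "snd (w j) \<in> ball 0 1" using w(1)[of j] by (auto simp: W_def)
        then show "Z j i \<in> ball 0 1" using i nz[OF i] r[of j] by (auto simp: Z_def norm_mult)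
      qed (auto simp: Z_def)
      then have mem: "Z j \<in> times_polydisc n W" for j
        using w(1) Z12 by (simp add: times_polydisc_def)
      have "(\<lambda>j. Z j i) \<longlonglongrightarrow> z i" if i: "i \<in> {1..n}" for i
      proof -
        consider "i = 1" | "i = 2" | "i \<noteq> 1" "i \<noteq> 2" by blast
        then show ?thesis
        proof cases
          case 1
          then show ?thesis using i tendsto_fst[OF w(2)] by (simp add: Z_def)
        next
          case 2
          then show ?thesis using i tendsto_snd[OF w(2)] by (simp add: Z_def)
        next
          case 3
          have "(\<lambda>j. of_real (r j) * z i) \<longlonglongrightarrow> of_real (1 - 0) * z i"
            by (intro tendsto_intros r_lim)
          then show ?thesis using i 3 by (simp add: Z_def)
        qed
      qed
      then have "(\<lambda>j. eval_point n f (Z j)) \<longlonglongrightarrow> eval_point n f z"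
        unfolding eval_point_def by (intro tendsto_intros) auto
      then show ?thesis using mem by blast
    qed
    have "ereal (onorm (eval_tuple n f T)) \<le> (SUP z\<in>times_polydisc n W. ereal (norm (eval_point n f z)))" for f
    proof (rule ereal_le_SUP)
      show "times_polydisc n W \<noteq> {}" using approx[OF z0] by blast
    next
      fix M :: real
      assume M: "0 \<le> M" "\<And>z. z \<in> times_polydisc n W \<Longrightarrow> norm (eval_point n f z) \<le> M"
      show "onorm (eval_tuple n f T) \<le> M"
      proof (rule onorm_le[OF M(1)])
        fix z assume "z \<in> {1..n} \<rightarrow>\<^sub>E sphere 0 1" "(z 1, z 2) \<in> curve"
        then obtain Z where Z: "\<And>j. Z j \<in> times_polydisc n W" "(\<lambda>j. eval_point n f (Z j)) \<longlonglongrightarrow> eval_point n f z"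
          using approx by metis
        show "norm (eval_point n f z) \<le> M"
          by (rule LIMSEQ_le_const2[OF tendsto_norm[OF Z(2)]]) (use M(2) Z(1) in blast)
      qed
    qed auto
    then show "\<exists>V'. distinguished_variety V' \<and> (\<forall>f\<in>polys n. ereal (onorm (eval_tuple n f T)) \<le>
                  (SUP z\<in>times_polydisc n V'. ereal (norm (eval_point n f z))))"
      using dist by blast
  qed
qed

end
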